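(* Let $(X,d)$ be a (nonempty) compact metric space, $\alpha:X\to X$ a continuous map that is open and non-contracting on $X_\alpha$ (i.e. the restriction $\alpha:X_\alpha\to X_\alpha$ is an open non-contracting map) and a finite-sheeted cover on $X_\alpha$ (i.e. $\sup_{x\in X_\alpha}|\alpha^{-1}(x)\cap X_\alpha|<\infty$), and let $A:C(X)\to C(X)$ be an $X_\alpha$-compatible transfer operator for $(X,\alpha)$ with cocycle $\rho$. Suppose the entropy map $M_\alpha(X)\ni\mu\mapsto h_\alpha(\mu)\in[0,\infty)$ is upper semicontinuous in the weak-$*$ topology (in particular, these conditions on $\alpha$ hold when $\alpha$ is open and expanding on $X_\alpha$). Then for every $\mu\in M_\alpha(X)$ $$\tau(\mu)=\int_{X_\alpha}\ln\rho\,d\mu+h_\alpha(\mu).$$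
   Context: A transfer operator for $(X,\alpha)$ is a positive linear operator $A:C(X)\to C(X)$ with $A((f\circ\alpha)g)=f\,Ag$ for all $f,g\in C(X)$. $M_\alpha(X)$ is the set of Borel $\alpha$-invariant probability measures on $X$; $\mu[f]=\int f\,d\mu$; $h_\alpha(\mu)$ is the Kolmogorov–Sinai (metric) entropy. Convention $\ln0=-\infty$; integrals of logarithms take values in $[-\infty,\infty)$. A point $x\in X$ is essential if every neighborhood $V$ of $x$ satisfies $\mu(V)>0$ for some $\mu\in M_\alpha(X)$; $X_\alpha$ is the (closed) set of essential points; $\alpha(X_\alpha)=X_\alpha$ and every $\mu\in M_\alpha(X)$ is supported in $X_\alpha$. For $x\in X_\alpha$ put $\tilde\alpha^{-1}(x):=\alpha^{-1}(x)\cap X_\alpha$. A map $\alpha$ of a metric space into itself is non-contracting if there is $r>0$ such that $d(x,y)\le r$ implies $d(\alpha(x),\alpha(y))\ge d(x,y)$; it is expanding if there are $r>0$ and $\Lambda>1$ such that $d(x,y)\le r$ implies $d(\alpha(x),\alpha(y))\ge\Lambda d(x,y)$. Compatibility and cocycle: for $x\in X$ let $\nu_x$ be the regular Borel measure (possibly $0$) with $\int f\,d\nu_x=[Af](x)$ for $f\in C(X)$; its support lies in $\alpha^{-1}(x)$. $A$ is $X_\alpha$-compatible if for every $f\in C(X_\alpha)$ the function $x\mapsto\int_{X_\alpha}f\,d\nu_x$ is continuous on $X_\alpha$; then $[A_{X_\alpha}f](x):=\int_{X_\alpha}f\,d\nu_x$ defines a transfer operator on $C(X_\alpha)$. It has the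 form $[A_{X_\alpha}f](x)=\sum_{y\in\tilde\alpha^{-1}(x)}\rho(y)f(y)$, where $\rho(y)=\nu_{\alpha(y)}(\{y\})\ge0$, $y\in X_\alpha$; $\rho$ is called the cocycle. $t$-entropy: for $\mu\in M_\alpha(X)$, $$\tau(\mu):=\inf_{n\in\mathbb N}\frac1n\inf_G\sum_{g\in G}\mu[g]\ln\frac{\mu[A^ng]}{\mu[g]},$$ where $G$ runs over all (finite) continuous partitions of unity in $C(X)$ by nonnegative functions and a summand with $\mu[g]=0$ is set equal to $0$. *)

theory Defs
  imports "HOL-Probability.Probability"
begin

text \<open>
  The compact metric space is the universe of a type of class \<^class>\<open>metric_space\<close> (with compactness
  a hypothesis of the theorem), and its real continuous functions are the functions satisfying
  \<^term>\<open>continuous_on UNIV\<close>. Operators on continuous functions are total functions on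
  \<^typ>\<open>'a \<Rightarrow> real\<close>; only their values on continuous functions are ever constrained or used.
\<close>

definition transfer_operator ::
    "('a::metric_space \<Rightarrow> 'a) \<Rightarrow> (('a \<Rightarrow> real) \<Rightarrow> 'a \<Rightarrow> real) \<Rightarrow> bool" where
  "transfer_operator \<alpha> A \<longleftrightarrow>
     (\<forall>f. continuous_on UNIV f \<longrightarrow> continuous_on UNIV (A f)) \<and>
     (\<forall>f g. continuous_on UNIV f \<longrightarrow> continuous_on UNIV g \<longrightarrow>
        A (\<lambda>x. f x + g x) = (\<lambda>x. A f x + A g x)) \<and>
     (\<forall>c f. continuous_on UNIV f \<longrightarrow> A (\<lambda>x. c * f x) = (\<lambda>x. c * A f x)) \<and>
     (\<forall>f. continuous_on UNIV f \<longrightarrow> (\<forall>x. 0 \<le> f x) \<longrightarrow> (\<forall>x. 0 \<le> A f x)) \<and>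
     (\<forall>f g. continuous_on UNIV f \<longrightarrow> continuous_on UNIV g \<longrightarrow>
        A (\<lambda>x. f (\<alpha> x) * g x) = (\<lambda>x. f x * A g x))"

definition invariant_measures :: "('a::metric_space \<Rightarrow> 'a) \<Rightarrow> 'a measure set" where
  "invariant_measures \<alpha> = {\<mu>. prob_space \<mu> \<and> sets \<mu> = sets borel \<and> distr \<mu> borel \<alpha> = \<mu>}"

definition weak_star_topology :: "'a::metric_space measure set \<Rightarrow> 'a measure topology" where
  "weak_star_topology M =
     topology_generated_by {{\<mu> \<in> M. (LINT x|\<mu>. f x) \<in> U} | f U. continuous_on UNIV f \<and> open (U :: real set)}"

definition upper_semicontinuous_map :: "'b topology \<Rightarrow> ('b \<Rightarrow> ereal) \<Rightarrow> bool" where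
  "upper_semicontinuous_map T h \<longleftrightarrow> (\<forall>c. openin T {x \<in> topspace T. h x < c})"

definition essential_points :: "('a::metric_space \<Rightarrow> 'a) \<Rightarrow> 'a set" where
  "essential_points \<alpha> = {x. \<forall>V. open V \<longrightarrow> x \<in> V \<longrightarrow> (\<exists>\<mu>\<in>invariant_measures \<alpha>. 0 < measure \<mu> V)}"

definition open_on_ess :: "('a::metric_space \<Rightarrow> 'a) \<Rightarrow> bool" where
  "open_on_ess \<alpha> \<longleftrightarrow>
     open_map (top_of_set (essential_points \<alpha>)) (top_of_set (essential_points \<alpha>)) \<alpha>"

definition non_contracting_on :: "'a::metric_space set \<Rightarrow> ('a \<Rightarrow> 'a) \<Rightarrow> bool" where
  "non_contracting_on S \<alpha> \<longleftrightarrow>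
     (\<exists>r>0. \<forall>x\<in>S. \<forall>y\<in>S. dist x y \<le> r \<longrightarrow> dist x y \<le> dist (\<alpha> x) (\<alpha> y))"

definition expanding_on :: "'a::metric_space set \<Rightarrow> ('a \<Rightarrow> 'a) \<Rightarrow> bool" where
  "expanding_on S \<alpha> \<longleftrightarrow>
     (\<exists>r>0. \<exists>\<Lambda>>1. \<forall>x\<in>S. \<forall>y\<in>S. dist x y \<le> r \<longrightarrow> \<Lambda> * dist x y \<le> dist (\<alpha> x) (\<alpha> y))"

definition finite_sheeted_on :: "'a set \<Rightarrow> ('a \<Rightarrow> 'a) \<Rightarrow> bool" where
  "finite_sheeted_on S \<alpha> \<longleftrightarrow>
     (\<exists>N. \<forall>x\<in>S. finite (\<alpha> -` {x} \<inter> S) \<and> card (\<alpha> -` {x} \<inter> S) \<le> N)"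

text \<open>
  The measure representing the positive functional \<open>f \<mapsto> A f x\<close> on continuous functions; for a
  transfer operator on a compact space it exists and is unique by the Riesz representation theorem.
  No regularity clause is needed, since finite Borel measures on metric spaces are regular.
  Finiteness is needed: the integral of a non-integrable function is 0.
\<close>

definition transfer_measure ::
    "(('a::metric_space \<Rightarrow> real) \<Rightarrow> 'a \<Rightarrow> real) \<Rightarrow> 'a \<Rightarrow> 'a measure" where
  "transfer_measure A x =
     (THE \<nu>. sets \<nu> = sets borel \<and> finite_measure \<nu> \<and>
             (\<forall>f. continuous_on UNIV f \<longrightarrow> (LINT y|\<nu>. f y) = A f x))"

definition ess_compatible ::
    "('a::metric_space \<Rightarrow> 'a) \<Rightarrow> (('a \<Rightarrow> real) \<Rightarrow> 'a \<Rightarrow> real) \<Rightarrow> bool" where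
  "ess_compatible \<alpha> A \<longleftrightarrow>
     (\<forall>f :: 'a \<Rightarrow> real. continuous_on (essential_points \<alpha>) f \<longrightarrow>
        continuous_on (essential_points \<alpha>) (\<lambda>x. LINT y:essential_points \<alpha>|transfer_measure A x. f y))"

definition cocycle ::
    "('a::metric_space \<Rightarrow> 'a) \<Rightarrow> (('a \<Rightarrow> real) \<Rightarrow> 'a \<Rightarrow> real) \<Rightarrow> 'a \<Rightarrow> real" where
  "cocycle \<alpha> A y = measure (transfer_measure A (\<alpha> y)) {y}"

definition eln :: "real \<Rightarrow> ereal" where
  "eln t = (if t = 0 then -\<infinity> else ereal (ln t))"

text \<open>
  Integral of an extended real function as the difference of the integrals of its positive and
  negative parts (\<^const>\<open>e2ennreal\<close> sends negative arguments to 0). It is meaningful if one of the two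
  is finite, as for logarithms of bounded functions.
\<close>

definition set_ereal_integral :: "'a measure \<Rightarrow> 'a set \<Rightarrow> ('a \<Rightarrow> ereal) \<Rightarrow> ereal" where
  "set_ereal_integral \<mu> S f =
     enn2ereal (\<integral>\<^sup>+x\<in>S. e2ennreal (f x) \<partial>\<mu>) - enn2ereal (\<integral>\<^sup>+x\<in>S. e2ennreal (- f x) \<partial>\<mu>)"

definition partition_entropy :: "'a measure \<Rightarrow> 'a set set \<Rightarrow> real" where
  "partition_entropy \<mu> P = - (\<Sum>B\<in>P. measure \<mu> B * ln (measure \<mu> B))"

text \<open>Coinciding pullbacks collapse in the set of partitions, which does not change the join.\<close>

definition dynamical_join :: "('a \<Rightarrow> 'a) \<Rightarrow> nat \<Rightarrow> 'a set set \<Rightarrow> 'a set set" where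
  "dynamical_join \<alpha> n P = common_refinement ((\<lambda>k. (\<lambda>B. (\<alpha> ^^ k) -` B) ` P) ` {..<n})"

definition ks_entropy :: "('a::metric_space \<Rightarrow> 'a) \<Rightarrow> 'a measure \<Rightarrow> ereal" where
  "ks_entropy \<alpha> \<mu> =
     (SUP P\<in>{P. finite P \<and> partition_on UNIV P \<and> P \<subseteq> sets borel}.
        ereal (lim (\<lambda>n. partition_entropy \<mu> (dynamical_join \<alpha> n P) / real n)))"

definition partitions_of_unity :: "('a::metric_space \<Rightarrow> real) set set" where
  "partitions_of_unity =
     {G. finite G \<and> (\<forall>g\<in>G. continuous_on UNIV g \<and> (\<forall>x. 0 \<le> g x)) \<and> (\<forall>x. (\<Sum>g\<in>G. g x) = 1)}"

definition t_entropy ::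
    "(('a::metric_space \<Rightarrow> real) \<Rightarrow> 'a \<Rightarrow> real) \<Rightarrow> 'a measure \<Rightarrow> ereal" where
  "t_entropy A \<mu> =
     (INF n\<in>{1..}. (INF G\<in>partitions_of_unity.
        (\<Sum>g\<in>G. if (LINT x|\<mu>. g x) = 0 then 0
               else ereal (LINT x|\<mu>. g x) *
                    eln ((LINT x|\<mu>. (A ^^ n) g x) / (LINT x|\<mu>. g x)))) / ereal (real n))"

end

theory Submission
  imports Defs
begin

text \<open>
  Let \<open>Y\<close> be the set of essential points and \<open>p(y)\<close> the \<open>\<mu>\<close>-probability of \<open>y\<close> conditioned on \<open>\<alpha> y\<close>; put
  \<open>e = - \<integral> ln p d\<mu>\<close>. The formula is the conjunction of \<open>\<tau>(\<mu>) = \<integral> ln \<rho> d\<mu> + e\<close> and \<open>h(\<mu>) = e\<close>.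

  For the first identity, let \<open>A*\<close> be the dual of \<open>A\<close>. The infimum over partitions of unity in \<open>\<tau>\<close> is minus
  the relative entropy of \<open>\<mu>\<close> with respect to \<open>(A*)\<^sup>n \<mu>\<close>. As the part of \<open>A*\<mu>\<close> on \<open>Y\<close> that is absolutely continuous
  with respect to \<open>\<mu>\<close> has density \<open>\<rho> / p\<close>, Jensen's inequality bounds every term of \<open>\<tau>\<close> from below,
  and fine partitions of unity attain the bound already for \<open>n = 1\<close>.

  For the second one, take a finite partition \<open>P\<close> into sets so small that \<open>\<alpha>\<close> is injective on them. The Gibbs
  inequality gives \<open>H(P\<^sub>n) \<ge> n e\<close>. Conversely, inverse branches do not increase distances, so a cylinder of length \<open>n\<close>
  whose \<open>n\<close>-th image is small is itself small. Continuous approximations of \<open>p\<close> are then almost constant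
  along the branches, which gives \<open>H(P\<^sub>n) \<le> n (e + \<epsilon>) + C\<close>.

  For expanding maps, the first identity for the counting operator (\<open>\<rho> = 1\<close>) exhibits \<open>h\<close> as an infimum of
  weak-* continuous functions, so it is upper semicontinuous.
\<close>


text \<open>A non-contracting map need not have a finite generating partition (the identity is
  non-contracting), so \<open>h\<close> cannot be read off a generator. Instead every partition
  \<open>P\<close> into small sets gets its own p, built from finitely many Radon-Nikodym
  derivatives, and the entropy rate of \<open>P\<close> is computed exactly from it. What the word
  of an orbit leaves open is the end point; locating it in one of finitely many balls costs a
  bounded amount of entropy, which is the constant \<open>C\<close> and disappears after division by
  n. That different \<open>P\<close> give the same rate is not shown directly: \<tau> does not
  mention \<open>P\<close>, so it forces the rates to agree whenever the integral of ln \<rho> is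
  finite, and when that integral is -\<infinity> the finiteness of \<open>h\<close> settles the
  formula. Zeros of \<rho> are the other difficulty: the upper bound works with \<rho> + \<epsilon>
  and lets \<epsilon> tend to 0 at the end.\<close>

section \<open>Riesz representation and density of continuous functions\<close>

lemma borel_measurable_if_sets_borel:
  assumes "f \<in> borel_measurable borel" "sets M = sets borel"
  shows "f \<in> borel_measurable M"
  using assms(1) unfolding measurable_cong_sets[OF assms(2) refl] .

lemma open_cozero_function:
  fixes U :: "'a::metric_space set"
  assumes "open U"
  obtains q :: "'a \<Rightarrow> real" where "continuous_on UNIV q" "\<And>x. 0 \<le> q x" "\<And>x. q x \<le> 1" "\<And>x. 0 < q x \<longleftrightarrow> x \<in> U"
\<comment> \<open>The distance to the empty set is 0 by convention, so the whole space is treated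
  apart.\<close>
proof (cases "U = UNIV")
  case True
  then show ?thesis by (intro that[of "\<lambda>_. 1"]) auto
next
  case False
  have "infdist x (- U) > 0 \<longleftrightarrow> x \<in> U" for x
    using infdist_pos_not_in_closed[of "- U" x] assms False infdist_zero[of x "- U"] by fastforce
  then show ?thesis
    by (intro that[of "\<lambda>x. min 1 (infdist x (- U))"]) (auto intro!: continuous_intros simp: infdist_nonneg)
qed

locale positive_functional =
  fixes L :: "('a::metric_space \<Rightarrow> real) \<Rightarrow> real"
  assumes compact_univ: "compact (UNIV :: 'a set)"
    and add: "continuous_on UNIV f \<Longrightarrow> continuous_on UNIV g \<Longrightarrow> L (\<lambda>x. f x + g x) = L f + L g"
    and scale: "continuous_on UNIV f \<Longrightarrow> L (\<lambda>x. c * f x) = c * L f"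
    and nonneg: "continuous_on UNIV f \<Longrightarrow> (\<And>x. 0 \<le> f x) \<Longrightarrow> 0 \<le> L f"
begin

lemma zero: "L (\<lambda>x. 0) = 0"
  using scale[of "\<lambda>x. 0" 0] by simp

lemma const: "L (\<lambda>x. c) = c * L (\<lambda>x. 1)"
  using scale[of "\<lambda>x. 1" c] by simp

lemma diff:
  assumes "continuous_on UNIV f" "continuous_on UNIV g"
  shows "L (\<lambda>x. f x - g x) = L f - L g"
  using add[of f "\<lambda>x. (-1) * g x"] scale[of g "-1"] assms continuous_on_minus[OF assms(2)] by simp

lemma mono:
  assumes "continuous_on UNIV f" "continuous_on UNIV g" "\<And>x. f x \<le> g x"
  shows "L f \<le> L g"
  using nonneg[of "\<lambda>x. g x - f x"] diff[OF assms(2,1)] assms by (simp add: continuous_on_diff)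

lemma sum:
  assumes "\<And>i. i \<in> I \<Longrightarrow> continuous_on UNIV (f i)"
  shows "L (\<lambda>x. \<Sum>i\<in>I. f i x) = (\<Sum>i\<in>I. L (f i))"
  using assms
proof (induction I rule: infinite_finite_induct)
  case (insert i I)
  then show ?case by (simp add: add continuous_on_sum)
qed (auto simp: zero)

text \<open>Truncation replaces compact supports: \<open>max 0 (f - \<epsilon>)\<close> vanishes off
  the compact set where \<open>f \<ge> \<epsilon>\<close>, and the loss is at most \<epsilon> times
  the total mass.\<close>

lemma cut_le:
  assumes "continuous_on UNIV f" "0 \<le> \<epsilon>"
  shows "L f \<le> L (\<lambda>x. max 0 (f x - \<epsilon>)) + \<epsilon> * L (\<lambda>x. 1)"
proof -
  have "L f \<le> L (\<lambda>x. max 0 (f x - \<epsilon>) + \<epsilon>)"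
    by (rule mono) (use assms in \<open>auto intro!: continuous_intros\<close>)
  also have "\<dots> = L (\<lambda>x. max 0 (f x - \<epsilon>)) + \<epsilon> * L (\<lambda>x. 1)"
    using assms by (subst add) (auto intro!: continuous_intros simp: const[of \<epsilon>])
  finally show ?thesis .
qed

text \<open>These functions only vanish outside U; their supports may reach the boundary of U. The
  two main lemmas on \<open>content\<close> repair this with \<open>cut_le\<close>.\<close>

definition below :: "'a set \<Rightarrow> ('a \<Rightarrow> real) set" where
  "below U = {f. continuous_on UNIV f \<and> (\<forall>x. 0 \<le> f x \<and> f x \<le> 1) \<and> (\<forall>x. x \<notin> U \<longrightarrow> f x = 0)}"

definition content :: "'a set \<Rightarrow> ennreal" where
  "content U = (SUP f\<in>below U. ennreal (L f))"

definition outer :: "'a set \<Rightarrow> ennreal" where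
  "outer E = (INF U\<in>{U. open U \<and> E \<subseteq> U}. content U)"

lemma below_mono: "U \<subseteq> V \<Longrightarrow> below U \<subseteq> below V"
  unfolding below_def by blast

lemma below_nonempty: "(\<lambda>x. 0) \<in> below U"
  unfolding below_def by auto

lemma content_mono: "U \<subseteq> V \<Longrightarrow> content U \<le> content V"
  unfolding content_def by (intro SUP_subset_mono below_mono) auto

lemma le_content: "f \<in> below U \<Longrightarrow> ennreal (L f) \<le> content U"
  unfolding content_def by (rule SUP_upper)

lemma content_empty: "content {} = 0"
proof -
  have "below {} = {\<lambda>x. 0}" unfolding below_def by auto
  then show ?thesis unfolding content_def by (simp add: zero)
qed

lemma content_UNIV: "content UNIV = ennreal (L (\<lambda>x. 1))"
  unfolding content_def
proof (rule antisym)
  show "(SUP f\<in>below UNIV. ennreal (L f)) \<le> ennreal (L (\<lambda>x. 1))"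
    by (rule SUP_least, intro ennreal_leI mono) (auto simp: below_def)
  show "ennreal (L (\<lambda>x. 1)) \<le> (SUP f\<in>below UNIV. ennreal (L f))"
    by (rule SUP_upper) (auto simp: below_def)
qed

text \<open>After truncation f lives on a compact set, which is covered by finitely many superlevel
  sets of cozero functions of the sets U n; finitely many functions below the U n then dominate the
  truncated f.\<close>

lemma content_UN_le:
  fixes U :: "nat \<Rightarrow> 'a set"
  assumes U: "\<And>n. open (U n)"
  shows "content (\<Union>n. U n) \<le> (\<Sum>n. content (U n))"
  unfolding content_def[of "\<Union>n. U n"]
proof (rule SUP_least)
  fix f assume f: "f \<in> below (\<Union>n. U n)"
  then have cf: "continuous_on UNIV f" by (auto simp: below_def)
  show "ennreal (L f) \<le> (\<Sum>n. content (U n))"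
  proof (rule ennreal_le_epsilon)
    fix e :: real assume e: "0 < e"
    define K where "K = L (\<lambda>x. 1)"
    have K: "0 \<le> K" unfolding K_def by (rule nonneg) auto
    \<comment> \<open>K may be 0, hence the \<open>+ 1\<close>; the loss \<epsilon> * K stays at
      most e.\<close>
    define \<epsilon> where "\<epsilon> = e / (K + 1)"
    have \<epsilon>: "0 < \<epsilon>" "\<epsilon> * K \<le> e" using e K by (auto simp: \<epsilon>_def field_simps)
    have "\<forall>n. \<exists>q :: 'a \<Rightarrow> real. continuous_on UNIV q \<and> (\<forall>x. 0 \<le> q x \<and> q x \<le> 1) \<and> (\<forall>x. 0 < q x \<longleftrightarrow> x \<in> U n)"
      using open_cozero_function[OF U] by metis
    then obtain q :: "nat \<Rightarrow> 'a \<Rightarrow> real"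
      where q: "\<And>n. continuous_on UNIV (q n)" "\<And>n x. 0 \<le> q n x" "\<And>n x. 0 < q n x \<longleftrightarrow> x \<in> U n"
      by metis
    have q0: "q n x = 0" if "x \<notin> U n" for n x
      using q(2,3)[of n x] that by auto
    \<comment> \<open>N is both the number of sets and the slope, so W increases with N and
      compactness yields a single N.\<close>
    define W where "W N = (\<Union>n<N. {x. 1 < real N * q n x})" for N
    have W_open: "open (W N)" for N
      unfolding W_def by (intro open_UN ballI open_Collect_less continuous_intros q(1))
    have W_mono: "W M \<subseteq> W N" if "M \<le> N" for M N
    proof
      fix x assume "x \<in> W M"
      then obtain n where n: "n < M" "1 < real M * q n x" by (auto simp: W_def)
      have "real M * q n x \<le> real N * q n x" using that q(2) by (intro mult_right_mono) auto
      then show "x \<in> W N" using n that by (auto simp: W_def intro!: bexI[of _ n])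
    qed
    define C where "C = {x. \<epsilon> \<le> f x}"
    have "closed C" unfolding C_def by (intro closed_Collect_le continuous_intros cf)
    then have "compact C" using compact_univ compact_Int_closed[of UNIV C] by simp
    moreover have "C \<subseteq> (\<Union>N. W N)"
    proof
      fix x assume "x \<in> C"
      then have "f x \<noteq> 0" using \<epsilon> by (auto simp: C_def)
      then obtain n where "x \<in> U n" using f by (auto simp: below_def)
      then have pos: "0 < q n x" using q(3) by auto
      obtain N where N: "1 / q n x < real N" using reals_Archimedean2 by blast
      have "1 / q n x < real (max N (Suc n))" using N by linarith
      then have "1 < real (max N (Suc n)) * q n x"
        using pos by (simp add: pos_divide_less_eq)
      then have "x \<in> W (max N (Suc n))" unfolding W_def by (auto intro!: bexI[of _ n])
      then show "x \<in> (\<Union>N. W N)" by blast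
    qed
    ultimately obtain D where D: "finite D" "C \<subseteq> (\<Union>N\<in>D. W N)"
      using compactE_image[of C UNIV W] W_open by (metis UNIV_I)
    define N where "N = Max (insert 0 D)"
    have CW: "C \<subseteq> W N"
    proof
      fix x assume "x \<in> C"
      then obtain M where "M \<in> D" "x \<in> W M" using D by blast
      moreover have "M \<le> N" using D \<open>M \<in> D\<close> by (auto simp: N_def intro: Max_ge)
      ultimately show "x \<in> W N" using W_mono by blast
    qed
    define h where "h n x = min 1 (real N * q n x)" for n x
    have h_cont: "continuous_on UNIV (h n)" for n
      unfolding h_def by (intro continuous_intros q(1))
    have h_below: "h n \<in> below (U n)" for n
      using h_cont q(2) q0 by (auto simp: below_def h_def)
    have f1: "f x \<le> 1" "0 \<le> f x" for x using f by (auto simp: below_def)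
    have fh: "max 0 (f x - \<epsilon>) \<le> (\<Sum>n<N. h n x)" for x
    proof (cases "x \<in> C")
      case True
      then obtain n where n: "n < N" "1 < real N * q n x" using CW by (auto simp: W_def)
      have "h n x \<le> (\<Sum>n<N. h n x)"
        using n q(2) by (intro member_le_sum) (auto simp: h_def)
      then show ?thesis using n f1[of x] \<epsilon> by (auto simp: h_def)
    next
      case False
      then have "max 0 (f x - \<epsilon>) = 0" by (auto simp: C_def)
      then show ?thesis using q(2) by (auto intro!: sum_nonneg simp: h_def)
    qed
    have "L f \<le> L (\<lambda>x. max 0 (f x - \<epsilon>)) + \<epsilon> * K"
      using cut_le[OF cf] \<epsilon> by (auto simp: K_def)
    also have "L (\<lambda>x. max 0 (f x - \<epsilon>)) \<le> L (\<lambda>x. \<Sum>n<N. h n x)"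
      by (rule mono) (use cf h_cont fh in \<open>auto intro!: continuous_intros\<close>)
    also have "L (\<lambda>x. \<Sum>n<N. h n x) = (\<Sum>n<N. L (h n))"
      by (rule sum) (use h_cont in auto)
    finally have "L f \<le> (\<Sum>n<N. L (h n)) + e" using \<epsilon> by auto
    then have "ennreal (L f) \<le> ennreal ((\<Sum>n<N. L (h n)) + e)" by (rule ennreal_leI)
    also have "\<dots> = (\<Sum>n<N. ennreal (L (h n))) + ennreal e"
      using e h_below by (auto simp: below_def ennreal_plus sum_nonneg nonneg simp flip: sum_ennreal)
    also have "(\<Sum>n<N. ennreal (L (h n))) \<le> (\<Sum>n<N. content (U n))"
      by (intro sum_mono le_content h_below)
    also have "\<dots> \<le> (\<Sum>n. content (U n))"
      by (rule sum_le_suminf) auto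
    finally show "ennreal (L f) \<le> (\<Sum>n. content (U n)) + ennreal e" by (auto simp: add_right_mono)
  qed
qed

lemma outer_open: "open U \<Longrightarrow> outer U = content U"
  unfolding outer_def by (intro antisym INF_lower INF_greatest) (auto intro: content_mono)

lemma outer_mono: "E \<subseteq> F \<Longrightarrow> outer E \<le> outer F"
  unfolding outer_def by (intro INF_superset_mono) auto

lemma outer_subadditive: "outer (\<Union>n. E n) \<le> (\<Sum>n. outer (E n))" for E :: "nat \<Rightarrow> 'a set"
proof (rule ennreal_le_epsilon)
  fix e :: real assume e: "0 < e" and fin: "(\<Sum>n. outer (E n)) < top"
  then have "outer (E n) < outer (E n) + e * (1/2)^Suc n" for n
    by (auto simp add: less_top dest!: ennreal_suminf_lessD)
  then have lt: "outer (E n) < outer (E n) + e * (1/2)^Suc n" for n .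
  have "\<exists>U. open U \<and> E n \<subseteq> U \<and> content U < t" if "outer (E n) < t" for n t
    using that unfolding outer_def INF_less_iff by auto
  from this[OF lt] have "\<exists>U. open U \<and> E n \<subseteq> U \<and> content U < outer (E n) + e * (1/2)^Suc n" for n .
  then obtain U where U: "\<And>n. open (U n)" "\<And>n. E n \<subseteq> U n"
    "\<And>n. content (U n) < outer (E n) + e * (1/2)^Suc n" by metis
  have "outer (\<Union>n. E n) \<le> outer (\<Union>n. U n)" using U(2) by (intro outer_mono) blast
  also have "\<dots> \<le> (\<Sum>n. content (U n))"
    using U(1) by (subst outer_open) (auto intro!: content_UN_le)
  also have "\<dots> \<le> (\<Sum>n. outer (E n) + e * (1/2) ^ Suc n)"
    using U(3) by (intro suminf_le) (auto intro: less_imp_le)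
  also have "... = (\<Sum>n. outer (E n)) + (\<Sum>n. ennreal e * ennreal ((1/2) ^ Suc n))"
    using e by (subst suminf_add[symmetric])
       (auto simp del: ennreal_suminf_cmult simp add: ennreal_mult[symmetric])
  also have "\<dots> = (\<Sum>n. outer (E n)) + e"
    unfolding ennreal_suminf_cmult
    by (subst suminf_ennreal_eq[OF zero_le_power power_half_series]) auto
  finally show "outer (\<Union>n. E n) \<le> (\<Sum>n. outer (E n)) + e" .
qed

lemma outer_measure_space_outer: "outer_measure_space (Pow UNIV) outer"
  unfolding outer_measure_space_def positive_def increasing_def countably_subadditive_def
  by (auto simp: outer_mono outer_subadditive outer_open content_empty)

lemma outer_Un: "outer (E \<union> F) \<le> outer E + outer F"
proof -
  define G where "G n = (if n = 0 then E else if n = 1 then F else {})" for n :: nat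
  have "outer (\<Union>n. G n) \<le> (\<Sum>n. outer (G n))" by (rule outer_subadditive)
  also have "(\<Sum>n. outer (G n)) = (\<Sum>n<2. outer (G n))"
    by (rule suminf_finite) (auto simp: G_def outer_open content_empty)
  also have "\<dots> = outer E + outer F" by (simp add: G_def numeral_2_eq_2)
  also have "(\<Union>n. G n) = E \<union> F"
  proof -
    have "E = G 0" "F = G 1" "\<And>n. G n \<subseteq> E \<union> F" by (auto simp: G_def)
    then show ?thesis by blast
  qed
  finally show ?thesis .
qed

text \<open>The Caratheodory condition for open U, tested on open V. A function f below V \<inter>
  U, once truncated, vanishes on an open W that contains V - U, so any g below W can be added to it
  without leaving \<open>below V\<close>.\<close>

lemma content_split:
  assumes U: "open U" and V: "open V"
  shows "content (V \<inter> U) + outer (V - U) \<le> content V"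
proof -
  have "ennreal (L f) + outer (V - U) \<le> content V" if f: "f \<in> below (V \<inter> U)" for f
  proof (rule ennreal_le_epsilon)
    fix e :: real assume e: "0 < e"
    have cf: "continuous_on UNIV f" using f by (auto simp: below_def)
    define K where "K = L (\<lambda>x. 1)"
    have K: "0 \<le> K" unfolding K_def by (rule nonneg) auto
    define \<epsilon> where "\<epsilon> = e / (K + 1)"
    have \<epsilon>: "0 < \<epsilon>" "\<epsilon> * K \<le> e" using e K by (auto simp: \<epsilon>_def field_simps)
    define f' where "f' x = max 0 (f x - \<epsilon>)" for x
    define W where "W = V \<inter> {x. f x < \<epsilon>}"
    have W: "open W" unfolding W_def by (intro open_Int V open_Collect_less continuous_intros cf)
    have f': "continuous_on UNIV f'" "0 \<le> L f'"
      unfolding f'_def by (auto intro!: continuous_intros cf nonneg)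
    have "V - U \<subseteq> W"
    proof
      fix x assume "x \<in> V - U"
      moreover then have "f x = 0" using f by (auto simp: below_def)
      ultimately show "x \<in> W" using \<epsilon> by (auto simp: W_def)
    qed
    then have "outer (V - U) \<le> content W"
      unfolding outer_def by (intro INF_lower) (use W in auto)
    moreover have "ennreal (L f') + content W \<le> content V"
      unfolding content_def[of W]
    proof (subst ennreal_SUP_add_right)
      show "(SUP g\<in>below W. ennreal (L f') + ennreal (L g)) \<le> content V"
      proof (rule SUP_least)
        fix g assume g: "g \<in> below W"
        then have cg: "continuous_on UNIV g" "0 \<le> L g" by (auto simp: below_def nonneg)
        have "(\<lambda>x. f' x + g x) \<in> below V"
          using f g \<epsilon> f' cg unfolding below_def f'_def W_def
          apply (auto intro!: continuous_intros)
          by (smt (verit, ccfv_threshold) max_def)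
        then have "ennreal (L (\<lambda>x. f' x + g x)) \<le> content V" by (rule le_content)
        then show "ennreal (L f') + ennreal (L g) \<le> content V"
          using f' cg by (simp add: add ennreal_plus)
      qed
    qed (use below_nonempty in auto)
    ultimately have *: "ennreal (L f') + outer (V - U) \<le> content V"
      by (meson add_left_mono order_trans)
    have "L f \<le> L f' + e" using cut_le[OF cf, of \<epsilon>] \<epsilon> by (simp add: f'_def[abs_def] K_def)
    then have "ennreal (L f) \<le> ennreal (L f') + ennreal e"
      using f'(2) e by (metis ennreal_leI ennreal_plus less_imp_le)
    then show "ennreal (L f) + outer (V - U) \<le> content V + ennreal e"
      using * by (smt (verit) add.assoc add.commute add_mono order_trans order_refl)
  qed
  then show ?thesis
    unfolding content_def[of "V \<inter> U"]
    by (subst ennreal_SUP_add_left[symmetric]) (use below_nonempty in \<open>auto intro!: SUP_least\<close>)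
qed

text \<open>Open supersets reduce the splitting of an arbitrary E to
  \<open>content_split\<close>.\<close>

lemma open_in_lambda_system:
  assumes U: "open U"
  shows "U \<in> lambda_system UNIV (Pow UNIV) outer"
proof -
  interpret sigma_algebra UNIV "Pow UNIV :: 'a set set" by (rule sigma_algebra_Pow)
  have "outer (E \<inter> U) + outer (E - U) = outer E" for E
  proof (rule antisym)
    show "outer (E \<inter> U) + outer (E - U) \<le> outer E"
      unfolding outer_def[of E]
    proof (rule INF_greatest)
      fix V assume "V \<in> {V. open V \<and> E \<subseteq> V}"
      then have V: "open V" "E \<subseteq> V" by auto
      have "outer (E \<inter> U) + outer (E - U) \<le> outer (V \<inter> U) + outer (V - U)"
        using V by (intro add_mono outer_mono) auto
      also have "\<dots> \<le> content V" using content_split[OF U V(1)] U V by (simp add: outer_open open_Int)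
      finally show "outer (E \<inter> U) + outer (E - U) \<le> content V" .
    qed
    show "outer E \<le> outer (E \<inter> U) + outer (E - U)"
      using outer_Un[of "E \<inter> U" "E - U"] by (simp add: Int_Diff_Un)
  qed
  then show ?thesis unfolding lambda_system_eq by auto
qed

definition riesz :: "'a measure" where
  "riesz = measure_of UNIV (sets borel) outer"

lemma sets_riesz [measurable_cong, simp]: "sets riesz = sets borel"
  unfolding riesz_def using sets.sigma_sets_eq[of borel] by (simp add: sets.space_closed[of borel, simplified])

lemma space_riesz [simp]: "space riesz = UNIV"
  using sets_eq_imp_space_eq[OF sets_riesz] by simp

lemma emeasure_riesz:
  assumes "E \<in> sets borel"
  shows "emeasure riesz E = outer E"
proof -
  interpret sigma_algebra UNIV "Pow UNIV :: 'a set set" by (rule sigma_algebra_Pow)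
  define \<Lambda> where "\<Lambda> = lambda_system UNIV (Pow UNIV) outer"
  have ms: "measure_space UNIV \<Lambda> outer"
    unfolding \<Lambda>_def by (rule caratheodory_lemma[OF outer_measure_space_outer])
  then have "sigma_algebra UNIV \<Lambda>" by (simp add: measure_space_def)
  then have "sigma_sets UNIV {U. open U} \<subseteq> \<Lambda>"
    using open_in_lambda_system by (intro sigma_algebra.sigma_sets_subset) (auto simp: \<Lambda>_def)
  then have "sets borel \<subseteq> \<Lambda>" by (simp add: sets_borel)
  then have "measure_space UNIV (sets borel) outer"
    using measure_down[OF ms] sets.sigma_algebra_axioms[of borel] by (simp add: space_borel)
  then show ?thesis
    using assms by (intro emeasure_measure_of[OF riesz_def]) (auto simp: measure_space_def)
qed

lemma emeasure_riesz_open: "open U \<Longrightarrow> emeasure riesz U = content U"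
  by (simp add: emeasure_riesz outer_open)

lemma finite_measure_riesz: "finite_measure riesz"
  by (rule finite_measureI) (simp add: emeasure_riesz_open content_UNIV)

lemma integrable_riesz:
  fixes f :: "'a \<Rightarrow> real"
  assumes "continuous_on UNIV f" shows "integrable riesz f"
proof -
  interpret finite_measure riesz by (rule finite_measure_riesz)
  have "compact (f ` UNIV)" using compact_univ assms compact_continuous_image by blast
  then obtain b where b: "\<And>x. norm (f x) \<le> b" using compact_imp_bounded bounded_iff by (metis rangeI)
  show ?thesis
    by (intro integrable_const_bound[where B=b])
      (use b borel_measurable_if_sets_borel[OF borel_measurable_continuous_onI[OF assms] sets_riesz] in auto)
qed

lemma measure_riesz_UNIV: "measure riesz UNIV = L (\<lambda>x. 1)"
  by (simp add: measure_def emeasure_riesz_open content_UNIV nonneg)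

text \<open>Cutting \<open>f\<close> into \<open>n\<close> horizontal layers of height \<open>1/n\<close> compares each layer with the
  content of a superlevel set.\<close>

lemma le_integral_riesz:
  assumes f: "continuous_on UNIV f" and f01: "\<And>x. 0 \<le> f x" "\<And>x. f x \<le> 1"
  shows "L f \<le> (\<integral>x. f x \<partial>riesz)"
proof -
  interpret finite_measure riesz by (rule finite_measure_riesz)
  have key: "L f \<le> (\<integral>x. f x \<partial>riesz) + (1 / real n) * L (\<lambda>x. 1)" if n: "0 < n" for n :: nat
  proof -
    define l where "l k x = min (max (f x - real k / real n) 0) (1 / real n)" for k x
    have lc: "continuous_on UNIV (l k)" for k
      unfolding l_def by (intro continuous_intros f)
    have telescope: "(\<Sum>k<m. l k x) = min (f x) (real m / real n)" for m x
    proof (induction m)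
      case 0 then show ?case using f01[of x] by simp
    next
      case (Suc m)
      have *: "min y a + min (max (y - a) 0) t = min y (a + t)" if "0 < t" for y a t :: real
        using that by (auto simp: min_def max_def)
      have "real (Suc m) / real n = real m / real n + 1 / real n" by (simp add: add_divide_distrib)
      then show ?case using Suc *[of "1 / real n" "f x" "real m / real n"] n by (simp add: l_def)
    qed
    have eq: "f x = (\<Sum>k<n. l k x)" for x
      using n f01[of x] by (simp add: telescope)
    define S where "S k = {x. real k / real n < f x}" for k
    have So: "open (S k)" for k unfolding S_def by (intro open_Collect_less continuous_intros f)
    have Lk: "L (l k) \<le> (1 / real n) * measure riesz (S k)" for k
    proof -
      have "(\<lambda>x. real n * l k x) \<in> below (S k)"
        using lc n by (auto simp: below_def S_def l_def min_def max_def divide_simps intro!: continuous_intros)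
      then have "ennreal (L (\<lambda>x. real n * l k x)) \<le> emeasure riesz (S k)"
        by (simp add: emeasure_riesz_open So le_content)
      also have "\<dots> = ennreal (measure riesz (S k))" by (rule emeasure_eq_measure)
      finally have "real n * L (l k) \<le> measure riesz (S k)"
        by (simp add: scale[OF lc])
      then show ?thesis using n by (simp add: field_simps)
    qed
    \<comment> \<open>At most n f(x) + 1 of the levels k / n lie below f(x); the surplus 1 becomes
      the error 1 / n of \<open>key\<close>.\<close>
    have count: "(\<Sum>k<m. indicat_real (S k) x) \<le> real n * f x + 1" for m x
    proof (induction m)
      case 0 then show ?case using f01[of x] by simp
    next
      case (Suc m)
      show ?case
      proof (cases "x \<in> S m")
        case True
        have "(\<Sum>k<Suc m. indicat_real (S k) x) \<le> real (Suc m)"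
          using sum_bounded_above[of "{..<Suc m}" "\<lambda>k. indicat_real (S k) x" 1] by (auto simp: indicator_def)
        moreover have "real m \<le> real n * f x" using True n by (auto simp: S_def field_simps)
        ultimately show ?thesis by simp
      next
        case False
        then show ?thesis using Suc by simp
      qed
    qed
    have "L f = L (\<lambda>x. \<Sum>k<n. l k x)" using eq by presburger
    also have "\<dots> = (\<Sum>k<n. L (l k))" by (rule sum) (use lc in auto)
    also have "\<dots> \<le> (\<Sum>k<n. (1 / real n) * measure riesz (S k))" by (intro sum_mono Lk)
    also have "\<dots> = (\<integral>x. (1 / real n) * (\<Sum>k<n. indicat_real (S k) x) \<partial>riesz)"
    proof -
      have "integrable riesz (indicat_real (S k))" for k
        using So by (auto simp: borel_open integrable_indicator_iff emeasure_eq_measure)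
      then show ?thesis using So by (simp add: sum_divide_distrib borel_open)
    qed
    also have "\<dots> \<le> (\<integral>x. f x + 1 / real n \<partial>riesz)"
    proof (rule integral_mono)
      show "integrable riesz (\<lambda>x. 1 / real n * (\<Sum>k<n. indicat_real (S k) x))"
        using So by (auto intro!: integrable_mult_right integrable_sum simp: borel_open integrable_indicator_iff emeasure_eq_measure simp del: integrable_mult_right_iff)
      show "integrable riesz (\<lambda>x. f x + 1 / real n)"
        by (intro integrable_riesz continuous_intros f)
      show "1 / real n * (\<Sum>k<n. indicat_real (S k) x) \<le> f x + 1 / real n" for x
        using mult_left_mono[OF count[where m=n and x=x], of "1 / real n"] n by (simp add: field_simps)
    qed
    also have "\<dots> = (\<integral>x. f x \<partial>riesz) + (1 / real n) * L (\<lambda>x. 1)"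
      using integrable_riesz[OF f] by (simp add: measure_riesz_UNIV)
    finally show ?thesis .
  qed
  have "(\<lambda>n. (\<integral>x. f x \<partial>riesz) + (1 / real n) * L (\<lambda>x. 1)) \<longlonglongrightarrow> (\<integral>x. f x \<partial>riesz) + 0 * L (\<lambda>x. 1)"
    by (intro tendsto_intros lim_1_over_n)
  then show ?thesis
    using key by (intro LIMSEQ_le_const[of _ _ "L f"]) (auto intro!: exI[of _ 1])
qed

theorem riesz_representation:
  assumes f: "continuous_on UNIV f"
  shows "(\<integral>x. f x \<partial>riesz) = L f"
proof -
  interpret finite_measure riesz by (rule finite_measure_riesz)
  have unit: "(\<integral>x. f x \<partial>riesz) = L f" if f: "continuous_on UNIV f" "\<And>x. 0 \<le> f x" "\<And>x. f x \<le> 1" for f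
  proof (rule antisym)
    show "L f \<le> (\<integral>x. f x \<partial>riesz)" by (rule le_integral_riesz[OF f])
    \<comment> \<open>The one-sided bound applied to 1 - f gives the reverse inequality.\<close>
    have "L (\<lambda>x. 1 - f x) \<le> (\<integral>x. 1 - f x \<partial>riesz)"
      by (rule le_integral_riesz) (use f in \<open>auto intro!: continuous_intros\<close>)
    then show "(\<integral>x. f x \<partial>riesz) \<le> L f"
      using f Bochner_Integration.integral_diff[of riesz "\<lambda>x. 1" f] integrable_riesz[OF f(1)]
      by (simp add: diff measure_riesz_UNIV)
  qed
  have "compact (f ` UNIV)" using compact_univ f compact_continuous_image by blast
  then obtain b where b: "\<And>x. norm (f x) \<le> b" using compact_imp_bounded bounded_iff by (metis rangeI)
  \<comment> \<open>The \<open>+ 1\<close> makes c positive, so that (f + c) / (2 c) is defined and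
    takes values in [0, 1].\<close>
  define c where "c = b + 1"
  have c: "0 < c" "\<And>x. - c \<le> f x" "\<And>x. f x \<le> c"
  proof -
    have "0 \<le> b" using b[of undefined] by (meson norm_ge_zero order_trans)
    then show "0 < c" by (simp add: c_def)
    fix x show "- c \<le> f x" "f x \<le> c" using b[of x] by (auto simp: c_def)
  qed
  define g where "g x = (1 / (2 * c)) * (f x + c)" for x
  have g: "continuous_on UNIV g" unfolding g_def by (intro continuous_intros f)
  have "(\<integral>x. g x \<partial>riesz) = L g"
  proof (rule unit[OF g])
    fix x show "0 \<le> g x" "g x \<le> 1" using c(1) c(2)[of x] c(3)[of x] by (auto simp: g_def field_simps)
  qed
  moreover have fg: "f = (\<lambda>x. (2 * c) * g x - c)" using c(1) by (auto simp: g_def)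
  moreover have "L (\<lambda>x. (2 * c) * g x - c) = 2 * c * L g - c * L (\<lambda>x. 1)"
    using g by (subst diff) (auto intro!: continuous_intros simp: scale[OF g] const[of c])
  moreover have "(\<integral>x. (2 * c) * g x - c \<partial>riesz) = 2 * c * (\<integral>x. g x \<partial>riesz) - c * L (\<lambda>x. 1)"
    using integrable_riesz[OF g] by (simp add: measure_riesz_UNIV)
  ultimately show ?thesis by metis
qed

end


section \<open>Approximation of Borel functions by continuous ones\<close>

lemma closed_indicator_approx:
  fixes F :: "'a::metric_space set"
  assumes "closed F"
  obtains u :: "nat \<Rightarrow> 'a \<Rightarrow> real" where "\<And>k. continuous_on UNIV (u k)" "\<And>k x. 0 \<le> u k x" "\<And>k x. u k x \<le> 1"
    "\<And>x. (\<lambda>k. u k x) \<longlonglongrightarrow> indicator F x"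
proof -
  obtain q :: "'a \<Rightarrow> real" where q: "continuous_on UNIV q" "\<And>x. 0 \<le> q x" "\<And>x. q x \<le> 1"
      "\<And>x. 0 < q x \<longleftrightarrow> x \<in> - F"
    using open_cozero_function[OF open_Compl[OF assms]] by blast
  have lim: "(\<lambda>k. max 0 (1 - real k * q x)) \<longlonglongrightarrow> indicator F x" for x
  proof (cases "x \<in> F")
    case True
    then have "q x = 0" using q(2)[of x] q(4)[of x] by auto
    then show ?thesis using True by simp
  next
    case False
    then have "0 < q x" using q(4) by auto
    have "eventually (\<lambda>k. max 0 (1 - real k * q x) = 0) sequentially"
      using eventually_ge_at_top[of "nat \<lceil>1 / q x\<rceil>"]
    proof eventually_elim
      case (elim k)
      then have "1 / q x \<le> real k" by linarith
      then show ?case using \<open>0 < q x\<close> by (simp add: field_simps)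
    qed
    then show ?thesis using False by (simp add: tendsto_eventually)
  qed
  show ?thesis
    by (rule that[of "\<lambda>k x. max 0 (1 - real k * q x)"])
      (use q lim in \<open>auto intro!: continuous_intros\<close>)
qed

lemma integrable_continuous_compact:
  fixes f :: "'a::metric_space \<Rightarrow> real"
  assumes "compact (UNIV :: 'a set)" "finite_measure \<mu>" "sets \<mu> = sets borel" "continuous_on UNIV f"
  shows "integrable \<mu> f"
proof -
  interpret finite_measure \<mu> by fact
  have "compact (f ` UNIV)" using assms compact_continuous_image by blast
  then obtain b where b: "\<And>x. norm (f x) \<le> b" using compact_imp_bounded bounded_iff by (metis rangeI)
  show ?thesis
    by (intro integrable_const_bound[where B=b])
      (use b borel_measurable_if_sets_borel[OF borel_measurable_continuous_onI[OF assms(4)] assms(3)] in auto)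
qed

lemma measure_closed_limit:
  fixes u :: "nat \<Rightarrow> 'a::metric_space \<Rightarrow> real"
  assumes "finite_measure \<mu>" "sets \<mu> = sets borel" "closed F"
    and u: "\<And>k. continuous_on UNIV (u k)" "\<And>k x. 0 \<le> u k x" "\<And>k x. u k x \<le> 1"
      "\<And>x. (\<lambda>k. u k x) \<longlonglongrightarrow> indicator F x"
  shows "(\<lambda>k. \<integral>x. u k x \<partial>\<mu>) \<longlonglongrightarrow> measure \<mu> F"
proof -
  interpret finite_measure \<mu> by fact
  have "(\<lambda>k. \<integral>x. u k x \<partial>\<mu>) \<longlonglongrightarrow> (\<integral>x. indicator F x \<partial>\<mu>)"
  proof (rule integral_dominated_convergence[where w="\<lambda>_. 1"])
    show "u k \<in> borel_measurable \<mu>" for k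
      by (rule borel_measurable_if_sets_borel[OF borel_measurable_continuous_onI[OF u(1)] assms(2)])
    have "F \<in> sets \<mu>" using assms by (simp add: borel_closed)
    then show "indicat_real F \<in> borel_measurable \<mu>" by simp
  qed (use assms in auto)
  then show ?thesis using assms by (simp add: borel_closed)
qed

lemma finite_measure_eqI_closed:
  fixes \<mu> \<mu>' :: "'a::metric_space measure"
  assumes "finite_measure \<mu>" "sets \<mu> = sets borel" "sets \<mu>' = sets borel"
    and eq: "\<And>F. closed F \<Longrightarrow> emeasure \<mu> F = emeasure \<mu>' F"
  shows "\<mu> = \<mu>'"
proof -
  interpret finite_measure \<mu> by fact
  have sb: "sigma_sets UNIV {F :: 'a set. closed F} = sets borel"
    by (simp add: borel_eq_closed)
  show ?thesis
    by (rule measure_eqI_generator_eq[where E="{F. closed F}" and \<Omega>=UNIV and A="\<lambda>_. UNIV"])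
      (use assms(2,3) sb eq emeasure_finite[of UNIV] in \<open>auto simp: Int_stable_def simp flip: eq\<close>)
qed

lemma finite_measure_eqI_continuous:
  fixes \<mu> \<mu>' :: "'a::metric_space measure"
  assumes "finite_measure \<mu>" "finite_measure \<mu>'" and s: "sets \<mu> = sets borel" "sets \<mu>' = sets borel"
    and eq: "\<And>f :: 'a \<Rightarrow> real. continuous_on UNIV f \<Longrightarrow> (\<integral>x. f x \<partial>\<mu>) = (\<integral>x. f x \<partial>\<mu>')"
  shows "\<mu> = \<mu>'"
proof (rule finite_measure_eqI_closed[OF assms(1) s])
  fix F :: "'a set" assume F: "closed F"
  obtain u :: "nat \<Rightarrow> 'a \<Rightarrow> real" where u: "\<And>k. continuous_on UNIV (u k)" "\<And>k x. 0 \<le> u k x" "\<And>k x. u k x \<le> 1"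
    "\<And>x. (\<lambda>k. u k x) \<longlonglongrightarrow> indicator F x"
    using closed_indicator_approx[OF F] by blast
  have "measure \<mu> F = measure \<mu>' F"
    using measure_closed_limit[OF assms(1) s(1) F u] measure_closed_limit[OF assms(2) s(2) F u]
    by (simp add: eq[OF u(1)] LIMSEQ_unique)
  then show "emeasure \<mu> F = emeasure \<mu>' F"
    using assms(1,2) by (simp add: finite_measure.emeasure_eq_measure)
qed

text \<open>The sets approximable in L1 by continuous functions with values in [0, 1] include the
  closed sets and form a Dynkin system. Closed sets are stable under intersection, so every Borel
  set is reached.\<close>

lemma indicator_L1_approx:
  fixes \<mu> :: "'a::metric_space measure"
  assumes fin: "finite_measure \<mu>" and s: "sets \<mu> = sets borel" and E: "E \<in> sets borel" and "0 < \<delta>"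
  shows "\<exists>u. continuous_on UNIV u \<and> (\<forall>x. 0 \<le> u x \<and> u x \<le> 1) \<and> (\<integral>x. \<bar>u x - indicat_real E x\<bar> \<partial>\<mu>) < \<delta>"
proof -
  interpret finite_measure \<mu> by fact
  define app where "app E u \<delta> \<longleftrightarrow> continuous_on UNIV u \<and> (\<forall>x. 0 \<le> u x \<and> u x \<le> 1) \<and> (\<integral>x. \<bar>u x - indicat_real E x\<bar> \<partial>\<mu>) < \<delta>"
    for E and u :: "'a \<Rightarrow> real" and \<delta>
  have um: "u \<in> borel_measurable \<mu>" if "continuous_on UNIV u" for u :: "'a \<Rightarrow> real"
    by (rule borel_measurable_if_sets_borel[OF borel_measurable_continuous_onI[OF that] s])
  have Em: "E \<in> sets \<mu>" if "E \<in> sets borel" for E using that s by simp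
  have int: "integrable \<mu> (\<lambda>x. \<bar>u x - indicat_real E x\<bar>)"
    if "continuous_on UNIV u" "\<forall>x. 0 \<le> u x \<and> u x \<le> 1" "E \<in> sets borel" for E and u :: "'a \<Rightarrow> real"
  proof (rule integrable_const_bound[where B=1])
    have "\<bar>u x - indicat_real E x\<bar> \<le> 1" for x using that(2)[rule_format, of x] by (auto simp: indicator_def)
    then show "AE x in \<mu>. norm \<bar>u x - indicat_real E x\<bar> \<le> 1" by auto
  qed (use um[OF that(1)] Em[OF that(3)] in auto)
  have "Int_stable {F :: 'a set. closed F}" by (auto simp: Int_stable_def)
  moreover have "{F :: 'a set. closed F} \<subseteq> Pow UNIV" by simp
  moreover have "E \<in> sigma_sets UNIV {F :: 'a set. closed F}"
    using E by (simp add: borel_eq_closed)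
  ultimately have "\<forall>\<delta>>0. \<exists>u. app E u \<delta>"
  proof (induction rule: sigma_sets_induct_disjoint)
    case (basic F)
    then have F: "closed F" by simp
    obtain u :: "nat \<Rightarrow> 'a \<Rightarrow> real" where u: "\<And>k. continuous_on UNIV (u k)" "\<And>k x. 0 \<le> u k x" "\<And>k x. u k x \<le> 1"
      "\<And>x. (\<lambda>k. u k x) \<longlonglongrightarrow> indicator F x"
      using closed_indicator_approx[OF F] by blast
    have "(\<lambda>k. \<integral>x. \<bar>u k x - indicat_real F x\<bar> \<partial>\<mu>) \<longlonglongrightarrow> (\<integral>x. 0 \<partial>\<mu>)"
    proof (rule integral_dominated_convergence[where w="\<lambda>_. 1"])
      show "AE x in \<mu>. (\<lambda>k. \<bar>u k x - indicat_real F x\<bar>) \<longlonglongrightarrow> 0"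
      proof (rule AE_I2)
        fix x
        have "(\<lambda>k. u k x - indicat_real F x) \<longlonglongrightarrow> indicat_real F x - indicat_real F x"
          by (intro tendsto_intros u(4))
        then show "(\<lambda>k. \<bar>u k x - indicat_real F x\<bar>) \<longlonglongrightarrow> 0"
          by (simp add: tendsto_rabs_zero)
      qed
      show "AE x in \<mu>. norm \<bar>u k x - indicat_real F x\<bar> \<le> 1" for k
      proof (rule AE_I2)
        fix x show "norm \<bar>u k x - indicat_real F x\<bar> \<le> 1"
          using u(2)[of k x] u(3)[of k x] by (auto simp: indicator_def)
      qed
      have "F \<in> sets \<mu>" using Em F by (simp add: borel_closed)
      then show "(\<lambda>x. \<bar>u k x - indicat_real F x\<bar>) \<in> borel_measurable \<mu>" for k
        using um[OF u(1)[of k]] by measurable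
    qed auto
    then have lim: "(\<lambda>k. \<integral>x. \<bar>u k x - indicat_real F x\<bar> \<partial>\<mu>) \<longlonglongrightarrow> 0" by simp
    show ?case
    proof (intro allI impI)
      fix \<delta> :: real assume "0 < \<delta>"
      then have "eventually (\<lambda>k. (\<integral>x. \<bar>u k x - indicat_real F x\<bar> \<partial>\<mu>) < \<delta>) sequentially"
        by (rule order_tendstoD(2)[OF lim])
      then obtain k where "(\<integral>x. \<bar>u k x - indicat_real F x\<bar> \<partial>\<mu>) < \<delta>"
        by (auto simp: eventually_sequentially)
      then have "app F (u k) \<delta>" using u by (auto simp: app_def)
      then show "\<exists>u. app F u \<delta>" by blast
    qed
  next
    case empty
    show ?case unfolding app_def by (intro allI impI exI[of _ "\<lambda>_. 0"]) auto
  next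
    case (compl E)
    show ?case
    proof (intro allI impI)
      fix \<delta> :: real assume "0 < \<delta>"
      then obtain u where u: "app E u \<delta>" using compl by blast
      have "\<bar>(1 - u x) - indicat_real (UNIV - E) x\<bar> = \<bar>u x - indicat_real E x\<bar>" for x
        by (auto simp: indicator_def)
      then have "app (UNIV - E) (\<lambda>x. 1 - u x) \<delta>"
        using u unfolding app_def by (auto intro!: continuous_intros)
      then show "\<exists>u. app (UNIV - E) u \<delta>" by blast
    qed
  next
    case (union A)
    then have Ab: "A i \<in> sets borel" for i by (auto simp: borel_eq_closed)
    show ?case
    proof (intro allI impI)
      fix \<delta> :: real assume \<delta>: "0 < \<delta>"
      have "(\<lambda>n. measure \<mu> (\<Union>i<n. A i)) \<longlonglongrightarrow> measure \<mu> (\<Union>n. \<Union>i<n. A i)"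
        by (rule finite_Lim_measure_incseq) (use Ab s in \<open>auto simp: incseq_def intro: less_le_trans\<close>)
      also have "(\<Union>n. \<Union>i<n. A i) = (\<Union>i. A i)" by auto
      finally have "eventually (\<lambda>n. measure \<mu> (\<Union>i. A i) - \<delta> / 2 < measure \<mu> (\<Union>i<n. A i)) sequentially"
        using \<delta> by (intro order_tendstoD(1)) auto
      then obtain n where n: "measure \<mu> (\<Union>i. A i) - \<delta> / 2 < measure \<mu> (\<Union>i<n. A i)"
        by (auto simp: eventually_sequentially)
      \<comment> \<open>The n approximations together use at most \<delta> / 2; the other half pays
        for the tail of the union.\<close>
      define \<eta> where "\<eta> = \<delta> / (2 * real (Suc n))"
      have \<eta>: "0 < \<eta>" "real n * \<eta> \<le> \<delta> / 2" using \<delta> by (auto simp: \<eta>_def field_simps)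
      have "\<forall>i. \<exists>u. app (A i) u \<eta>" using union \<eta> by blast
      then obtain u where u: "\<And>i. app (A i) (u i) \<eta>" by metis
      define v where "v x = min 1 (\<Sum>i<n. u i x)" for x
      have v: "continuous_on UNIV v" "\<forall>x. 0 \<le> v x \<and> v x \<le> 1"
        using u unfolding v_def app_def by (auto intro!: continuous_intros sum_nonneg)
      define B where "B = (\<Union>i<n. A i)"
      have Bb: "B \<in> sets borel" using Ab by (auto simp: B_def)
      have Bs: "indicat_real B x = (\<Sum>i<n. indicat_real (A i) x)" for x
        unfolding B_def using \<open>disjoint_family A\<close>
        by (intro indicator_UN_disjoint) (auto simp: disjoint_family_on_def)
      have vB: "\<bar>v x - indicat_real B x\<bar> \<le> (\<Sum>i<n. \<bar>u i x - indicat_real (A i) x\<bar>)" for x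
      proof -
        \<comment> \<open>Cutting a nonnegative sum at 1 does not move it away from either of the
          values 0 and 1.\<close>
        have "\<bar>v x - indicat_real B x\<bar> \<le> \<bar>(\<Sum>i<n. u i x) - indicat_real B x\<bar>"
          using u unfolding v_def app_def by (auto simp: indicator_def intro!: sum_nonneg)
        also have "\<dots> = \<bar>\<Sum>i<n. u i x - indicat_real (A i) x\<bar>" by (simp add: Bs sum_subtractf)
        also have "\<dots> \<le> (\<Sum>i<n. \<bar>u i x - indicat_real (A i) x\<bar>)" by (rule sum_abs)
        finally show ?thesis .
      qed
      have "(\<integral>x. \<bar>v x - indicat_real (\<Union>i. A i) x\<bar> \<partial>\<mu>)
          \<le> (\<integral>x. (\<Sum>i<n. \<bar>u i x - indicat_real (A i) x\<bar>) + (indicat_real (\<Union>i. A i) x - indicat_real B x) \<partial>\<mu>)"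
      proof (rule integral_mono)
        show "integrable \<mu> (\<lambda>x. \<bar>v x - indicat_real (\<Union>i. A i) x\<bar>)"
          using int[OF v] Ab by auto
        have "integrable \<mu> (indicat_real (\<Union>i. A i))" "integrable \<mu> (indicat_real B)"
          using Ab Bb s by (auto simp: integrable_indicator_iff emeasure_eq_measure)
        then show "integrable \<mu> (\<lambda>x. (\<Sum>i<n. \<bar>u i x - indicat_real (A i) x\<bar>) + (indicat_real (\<Union>i. A i) x - indicat_real B x))"
          using u int Ab by (auto simp: app_def)
        fix x
        have "indicat_real B x \<le> indicat_real (\<Union>i. A i) x"
          by (rule indicator_leI) (auto simp: B_def)
        then show "\<bar>v x - indicat_real (\<Union>i. A i) x\<bar>
          \<le> (\<Sum>i<n. \<bar>u i x - indicat_real (A i) x\<bar>) + (indicat_real (\<Union>i. A i) x - indicat_real B x)"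
          using vB[of x] by linarith
      qed
      also have "\<dots> = (\<Sum>i<n. \<integral>x. \<bar>u i x - indicat_real (A i) x\<bar> \<partial>\<mu>) + (measure \<mu> (\<Union>i. A i) - measure \<mu> B)"
      proof -
        have 1: "integrable \<mu> (\<lambda>x. \<bar>u i x - indicat_real (A i) x\<bar>)" for i
          using u[of i] int Ab by (auto simp: app_def)
        have 2: "integrable \<mu> (indicat_real (\<Union>i. A i))" "integrable \<mu> (indicat_real B)"
          using Ab Bb s by (auto simp: integrable_indicator_iff emeasure_eq_measure)
        have 3: "(\<Union>i. A i) \<in> sets \<mu>" "B \<in> sets \<mu>" using Ab Bb s by auto
        show ?thesis
          using 1 2 3 by (subst Bochner_Integration.integral_add) (auto simp del: UN_simps)
      qed
      also have "\<dots> < \<delta>"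
      proof -
        have "(\<Sum>i<n. \<integral>x. \<bar>u i x - indicat_real (A i) x\<bar> \<partial>\<mu>) \<le> (\<Sum>i<n. \<eta>)"
          using u by (intro sum_mono) (auto simp: app_def less_imp_le)
        then show ?thesis using \<eta> n by (simp add: B_def)
      qed
      finally show "\<exists>u. app (\<Union>i. A i) u \<delta>" using v unfolding app_def by blast
    qed
  qed
  then show ?thesis using \<open>0 < \<delta>\<close> unfolding app_def by blast
qed

theorem continuous_L1_approx:
  fixes g :: "'a::metric_space \<Rightarrow> real"
  assumes fin: "finite_measure \<mu>" and s: "sets \<mu> = sets borel" and "compact (UNIV :: 'a set)"
    and g: "g \<in> borel_measurable borel" "\<And>x. 0 \<le> g x" "\<And>x. g x \<le> K" and \<delta>: "0 < \<delta>"
  obtains u where "continuous_on UNIV u" "\<And>x. 0 \<le> u x" "\<And>x. u x \<le> K" "(\<integral>x. \<bar>u x - g x\<bar> \<partial>\<mu>) < \<delta>"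
proof -
  interpret finite_measure \<mu> by fact
  have cint: "integrable \<mu> u" if "continuous_on UNIV u" for u :: "'a \<Rightarrow> real"
    by (rule integrable_continuous_compact) (use that assms in auto)
  have "g \<in> borel_measurable \<mu>" by (rule borel_measurable_if_sets_borel[OF g(1) s])
  then have gi: "integrable \<mu> g"
    by (intro integrable_const_bound[where B=K]) (use g in auto)
  then have "\<forall>\<delta>>0. \<exists>u. continuous_on UNIV u \<and> (\<integral>x. \<bar>u x - g x\<bar> \<partial>\<mu>) < \<delta>"
  proof (induction rule: integrable_induct)
    case (base E c)
    show ?case
    proof (intro allI impI)
      fix \<delta> :: real assume \<delta>: "0 < \<delta>"
      then have \<delta>': "0 < \<delta> / (\<bar>c\<bar> + 1)" by (auto intro!: divide_pos_pos)
      obtain u where u: "continuous_on UNIV u" "(\<integral>x. \<bar>u x - indicat_real E x\<bar> \<partial>\<mu>) < \<delta> / (\<bar>c\<bar> + 1)"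
        using indicator_L1_approx[OF fin s _ \<delta>'] base s by blast
      have "(\<integral>x. \<bar>c * u x - indicat_real E x *\<^sub>R c\<bar> \<partial>\<mu>) = (\<integral>x. \<bar>c\<bar> * \<bar>u x - indicat_real E x\<bar> \<partial>\<mu>)"
        by (intro Bochner_Integration.integral_cong refl) (simp flip: abs_mult add: algebra_simps)
      also have "\<dots> = \<bar>c\<bar> * (\<integral>x. \<bar>u x - indicat_real E x\<bar> \<partial>\<mu>)" by simp
      also have "\<dots> \<le> \<bar>c\<bar> * (\<delta> / (\<bar>c\<bar> + 1))" using u by (intro mult_left_mono) auto
      also have "\<dots> < \<delta>" using \<delta> by (simp add: field_simps)
      finally show "\<exists>u. continuous_on UNIV u \<and> (\<integral>x. \<bar>u x - indicat_real E x *\<^sub>R c\<bar> \<partial>\<mu>) < \<delta>"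
        using u by (intro exI[of _ "\<lambda>x. c * u x"]) (auto intro!: continuous_intros)
    qed
  next
    case (add f g)
    show ?case
    proof (intro allI impI)
      fix \<delta> :: real assume "0 < \<delta>"
      then have "0 < \<delta> / 2" by simp
      then obtain u v where u: "continuous_on UNIV u" "(\<integral>x. \<bar>u x - f x\<bar> \<partial>\<mu>) < \<delta> / 2"
        and v: "continuous_on UNIV v" "(\<integral>x. \<bar>v x - g x\<bar> \<partial>\<mu>) < \<delta> / 2"
        using add by meson
      have i: "integrable \<mu> (\<lambda>x. \<bar>u x - f x\<bar>)" "integrable \<mu> (\<lambda>x. \<bar>v x - g x\<bar>)"
        using cint u v add by auto
      have "(\<integral>x. \<bar>(u x + v x) - (f x + g x)\<bar> \<partial>\<mu>) \<le> (\<integral>x. \<bar>u x - f x\<bar> + \<bar>v x - g x\<bar> \<partial>\<mu>)"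
        by (rule integral_mono) (use cint[OF u(1)] cint[OF v(1)] add i in auto)
      also have "\<dots> < \<delta>" using u v i by simp
      finally show "\<exists>u. continuous_on UNIV u \<and> (\<integral>x. \<bar>u x - (f x + g x)\<bar> \<partial>\<mu>) < \<delta>"
        using u v by (intro exI[of _ "\<lambda>x. u x + v x"]) (auto intro!: continuous_intros)
    qed
  next
    case (lim f s)
    show ?case
    proof (intro allI impI)
      fix \<delta> :: real assume "0 < \<delta>"
      then have d2: "0 < \<delta> / 2" by simp
      have "(\<lambda>i. \<integral>x. \<bar>s i x - f x\<bar> \<partial>\<mu>) \<longlonglongrightarrow> (\<integral>x. 0 \<partial>\<mu>)"
      proof (rule integral_dominated_convergence[where w="\<lambda>x. 3 * \<bar>f x\<bar>"])
        show "AE x in \<mu>. (\<lambda>i. \<bar>s i x - f x\<bar>) \<longlonglongrightarrow> 0"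
        proof (rule AE_I2)
          fix x assume "x \<in> space \<mu>"
          then have "(\<lambda>i. s i x - f x) \<longlonglongrightarrow> f x - f x" using lim by (intro tendsto_intros) auto
          then show "(\<lambda>i. \<bar>s i x - f x\<bar>) \<longlonglongrightarrow> 0" by (simp add: tendsto_rabs_zero)
        qed
        show "AE x in \<mu>. norm \<bar>s i x - f x\<bar> \<le> 3 * \<bar>f x\<bar>" for i
        proof (rule AE_I2)
          fix x assume "x \<in> space \<mu>"
          then show "norm \<bar>s i x - f x\<bar> \<le> 3 * \<bar>f x\<bar>" using lim.hyps(3)[of x i] by auto
        qed
      qed (use lim in auto)
      then have "eventually (\<lambda>i. (\<integral>x. \<bar>s i x - f x\<bar> \<partial>\<mu>) < \<delta> / 2) sequentially"
        using d2 by (intro order_tendstoD(2)) auto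
      then obtain i where i: "(\<integral>x. \<bar>s i x - f x\<bar> \<partial>\<mu>) < \<delta> / 2"
        by (auto simp: eventually_sequentially)
      obtain u where u: "continuous_on UNIV u" "(\<integral>x. \<bar>u x - s i x\<bar> \<partial>\<mu>) < \<delta> / 2"
        using lim.IH[of i] d2 by meson
      have "(\<integral>x. \<bar>u x - f x\<bar> \<partial>\<mu>) \<le> (\<integral>x. \<bar>u x - s i x\<bar> + \<bar>s i x - f x\<bar> \<partial>\<mu>)"
        by (rule integral_mono) (use cint[OF u(1)] lim in auto)
      also have "\<dots> < \<delta>" using u i cint[OF u(1)] lim by simp
      finally show "\<exists>u. continuous_on UNIV u \<and> (\<integral>x. \<bar>u x - f x\<bar> \<partial>\<mu>) < \<delta>" using u by blast
    qed
  qed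
  then obtain u where u: "continuous_on UNIV u" "(\<integral>x. \<bar>u x - g x\<bar> \<partial>\<mu>) < \<delta>" using \<delta> by blast
  \<comment> \<open>Clamping to [0, K], where g takes its values, cannot increase the distance to g.
    The lower bound is used later, when a positive constant is added and a logarithm is
    taken.\<close>
  define v where "v x = max 0 (min K (u x))" for x
  have v: "continuous_on UNIV v" unfolding v_def by (intro continuous_intros u)
  have K: "0 \<le> K" using g(2,3) order_trans by blast
  have "(\<integral>x. \<bar>v x - g x\<bar> \<partial>\<mu>) \<le> (\<integral>x. \<bar>u x - g x\<bar> \<partial>\<mu>)"
  proof (rule integral_mono)
    show "\<bar>v x - g x\<bar> \<le> \<bar>u x - g x\<bar>" for x using g(2,3)[of x] unfolding v_def by linarith
  qed (use cint[OF u(1)] cint[OF v] gi in auto)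
  then show ?thesis using that[of v] v u K unfolding v_def by fastforce
qed

section \<open>Cylinders and block entropies\<close>

text \<open>S = 1 gives the subadditivity of block entropies; the upper bound on the entropy rate
  uses S = \<open>card Z\<close>, the size of a cover by balls, at the price ln S. The proof is ln x
  \<le> x - 1 at x = s i / (m i * S).\<close>

lemma gibbs:
  fixes m s :: "'i \<Rightarrow> real"
  assumes "finite I" "\<And>i. i \<in> I \<Longrightarrow> 0 \<le> m i" "(\<Sum>i\<in>I. m i) = 1"
    and s: "\<And>i. i \<in> I \<Longrightarrow> 0 \<le> s i" "\<And>i. i \<in> I \<Longrightarrow> 0 < m i \<Longrightarrow> 0 < s i" "(\<Sum>i\<in>I. s i) \<le> S" "0 < S"
  shows "- (\<Sum>i\<in>I. m i * ln (m i)) \<le> - (\<Sum>i\<in>I. m i * ln (s i)) + ln S"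
proof -
  have "m i * ln (s i) - m i * ln (m i) - m i * ln S \<le> s i / S - m i" if i: "i \<in> I" for i
  proof (cases "m i = 0")
    case True
    then show ?thesis using s i by simp
  next
    case False
    then have mi: "0 < m i" "0 < s i" using assms i by (auto simp: less_le)
    then have "ln (s i / (m i * S)) \<le> s i / (m i * S) - 1" using \<open>0 < S\<close> by (intro ln_le_minus_one) auto
    then have "m i * ln (s i / (m i * S)) \<le> m i * (s i / (m i * S) - 1)" using mi by (intro mult_left_mono) auto
    also have "\<dots> = s i / S - m i" using mi \<open>0 < S\<close> by (simp add: field_simps)
    also have "ln (s i / (m i * S)) = ln (s i) - ln (m i) - ln S"
      using mi \<open>0 < S\<close> by (simp add: ln_div ln_mult)
    finally show ?thesis by (simp add: algebra_simps)
  qed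
  then have "(\<Sum>i\<in>I. m i * ln (s i) - m i * ln (m i) - m i * ln S) \<le> (\<Sum>i\<in>I. s i / S - m i)"
    by (rule sum_mono)
  also have "\<dots> = (\<Sum>i\<in>I. s i) / S - 1" using assms by (simp add: sum_subtractf sum_divide_distrib)
  also have "\<dots> \<le> 0" using s by simp
  also have "(\<Sum>i\<in>I. m i * ln (s i) - m i * ln (m i) - m i * ln S)
      = (\<Sum>i\<in>I. m i * ln (s i)) - (\<Sum>i\<in>I. m i * ln (m i)) - ln S"
    using assms(3) by (simp add: sum_subtractf flip: sum_distrib_right)
  finally show ?thesis by simp
qed

text \<open>Fekete's argument: divide n with remainder by an N that almost attains the infimum. The
  remainders contribute at most the constant C, which vanishes after division by n.\<close>

lemma fekete_convergent:
  fixes a :: "nat \<Rightarrow> real"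
  assumes nonneg: "\<And>n. 0 \<le> a n" and sub: "\<And>m n. a (m + n) \<le> a m + a n"
  shows "convergent (\<lambda>n. a n / real n)"
proof -
  define L where "L = (INF n\<in>{1..}. a n / real n)"
  have bdd: "bdd_below ((\<lambda>n. a n / real n) ` {1..})"
    using nonneg by (intro bdd_belowI[of _ 0]) auto
  have L_le: "L \<le> a n / real n" if "1 \<le> n" for n
    unfolding L_def by (rule cINF_lower[OF bdd]) (use that in auto)
  have mult: "a (q * N + r) \<le> real q * a N + a r" for q N r
  proof (induction q)
    case (Suc q)
    have "a (Suc q * N + r) = a (N + (q * N + r))" by (simp add: add.assoc)
    also have "\<dots> \<le> a N + a (q * N + r)" by (rule sub)
    also have "\<dots> \<le> a N + (real q * a N + a r)" using Suc by simp
    finally show ?case by (simp add: algebra_simps)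
  qed simp
  have "(\<lambda>n. a n / real n) \<longlonglongrightarrow> L"
  proof (rule LIMSEQ_I)
    fix \<epsilon> :: real assume \<epsilon>: "0 < \<epsilon>"
    have "\<exists>N\<in>{1..}. a N / real N < L + \<epsilon> / 2"
      using \<epsilon> bdd by (subst cINF_less_iff[symmetric]) (auto simp: L_def)
    then obtain N where N: "1 \<le> N" "a N / real N < L + \<epsilon> / 2" by auto
    define C where "C = (\<Sum>r<N. a r)"
    have C: "0 \<le> C" "a r \<le> C" if "r < N" for r
      using nonneg that by (auto simp: C_def intro!: sum_nonneg member_le_sum)
    obtain M where M: "2 * (C + 1) / \<epsilon> < real M" using reals_Archimedean2 by blast
    have C0: "0 \<le> C" using C[of 0] N by simp
    show "\<exists>no. \<forall>n\<ge>no. norm (a n / real n - L) < \<epsilon>"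
    proof (intro exI allI impI)
      fix n assume n: "max 1 M \<le> n"
      have "a n \<le> real (n div N) * a N + a (n mod N)"
        using mult[of "n div N" N "n mod N"] by simp
      also have "\<dots> \<le> real (n div N) * a N + C" using C[of "n mod N"] N by simp
      also have "real (n div N) * a N = (real (n div N) * real N) * (a N / real N)" using N by simp
      also have "\<dots> \<le> real n * (a N / real N)"
      proof (intro mult_right_mono)
        have "n div N * N \<le> n" by (metis div_mult_mod_eq le_add1)
        then show "real (n div N) * real N \<le> real n" by (simp flip: of_nat_mult)
      qed (use nonneg in auto)
      finally have "a n / real n \<le> a N / real N + C / real n" using n by (simp add: field_simps)
      moreover have "C / real n < \<epsilon> / 2"
      proof -
        have "2 * (C + 1) / \<epsilon> < real n" using M n by linarith
        then have "2 * (C + 1) < real n * \<epsilon>" using \<epsilon> by (simp add: pos_divide_less_eq)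
        then show ?thesis using n by (simp add: field_simps)
      qed
      ultimately have "a n / real n < L + \<epsilon>" using N(2) by linarith
      moreover have "L \<le> a n / real n" using L_le n by simp
      ultimately show "norm (a n / real n - L) < \<epsilon>" by simp
    qed
  qed
  then show ?thesis by (rule convergentI)
qed

section \<open>Words, cylinders and invariant partitions\<close>

primrec cylinder :: "('a \<Rightarrow> 'a) \<Rightarrow> 'a set list \<Rightarrow> 'a set" where
  "cylinder \<alpha> [] = UNIV"
| "cylinder \<alpha> (B # w) = B \<inter> \<alpha> -` cylinder \<alpha> w"

definition words :: "'b set \<Rightarrow> nat \<Rightarrow> 'b list set" where
  "words P n = {w. set w \<subseteq> P \<and> length w = n}"

lemma finite_words: "finite P \<Longrightarrow> finite (words P n)"
  unfolding words_def by (rule finite_lists_length_eq)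

lemma words_nth: "w \<in> words P n \<Longrightarrow> k < n \<Longrightarrow> w ! k \<in> P"
  unfolding words_def by (metis (mono_tags, lifting) mem_Collect_eq nth_mem subsetD)

lemma words_0 [simp]: "words P 0 = {[]}"
  by (auto simp: words_def)

lemma sum_words_Suc: "(\<Sum>w\<in>words P (Suc n). f w) = (\<Sum>B\<in>P. \<Sum>w\<in>words P n. f (B # w))"
proof -
  have "words P (Suc n) = (\<lambda>(B, w). B # w) ` (P \<times> words P n)"
    by (auto simp: words_def length_Suc_conv image_iff)
  moreover have "inj_on (\<lambda>(B, w). B # w) (P \<times> words P n)" by (auto simp: inj_on_def)
  ultimately show ?thesis
    by (simp add: sum.reindex sum.cartesian_product case_prod_beta')
qed

lemma sum_words_append:
  "(\<Sum>w\<in>words P (m + n). f w) = (\<Sum>u\<in>words P m. \<Sum>v\<in>words P n. f (u @ v))"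
proof (induction m arbitrary: f)
  case (Suc m)
  then show ?case by (simp add: sum_words_Suc)
qed simp

lemma in_cylinder_iff: "y \<in> cylinder \<alpha> w \<longleftrightarrow> (\<forall>k<length w. (\<alpha> ^^ k) y \<in> w ! k)"
proof (induction w arbitrary: y)
  case (Cons B w)
  have "(\<forall>k<length (B # w). (\<alpha> ^^ k) y \<in> (B # w) ! k) \<longleftrightarrow>
      y \<in> B \<and> (\<forall>k<length w. (\<alpha> ^^ Suc k) y \<in> w ! k)"
    by (auto simp: All_less_Suc2)
  then show ?case using Cons by (simp add: funpow_swap1)
qed simp

lemma cylinder_append: "cylinder \<alpha> (u @ v) = cylinder \<alpha> u \<inter> (\<alpha> ^^ length u) -` cylinder \<alpha> v"
  by (induction u) (auto simp: funpow_swap1)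

locale invariant_measure =
  fixes \<alpha> :: "'a::metric_space \<Rightarrow> 'a" and \<mu> :: "'a measure"
  assumes invariant: "\<mu> \<in> invariant_measures \<alpha>"
    and alpha_measurable [measurable]: "\<alpha> \<in> borel \<rightarrow>\<^sub>M borel"
begin

lemma sets_mu [measurable_cong, simp]: "sets \<mu> = sets borel"
  using invariant by (simp add: invariant_measures_def)

lemma space_mu [simp]: "space \<mu> = UNIV"
  using sets_eq_imp_space_eq[OF sets_mu] by simp

lemma distr_mu: "distr \<mu> borel \<alpha> = \<mu>"
  using invariant by (simp add: invariant_measures_def)

sublocale prob_space \<mu>
  using invariant by (simp add: invariant_measures_def)

lemma measure_UNIV [simp]: "measure \<mu> UNIV = 1"
  using prob_space by simp

lemma alpha_measurable_mu [measurable]: "\<alpha> \<in> \<mu> \<rightarrow>\<^sub>M borel"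
  by (rule borel_measurable_if_sets_borel) auto

lemma nn_integral_comp:
  assumes [measurable]: "f \<in> borel_measurable borel"
  shows "(\<integral>\<^sup>+x. f (\<alpha> x) \<partial>\<mu>) = (\<integral>\<^sup>+x. f x \<partial>\<mu>)"
  using nn_integral_distr[of \<alpha> \<mu> borel f] by (simp add: distr_mu)

lemma integral_comp:
  fixes f :: "'a \<Rightarrow> real"
  assumes [measurable]: "f \<in> borel_measurable borel"
  shows "(\<integral>x. f (\<alpha> x) \<partial>\<mu>) = (\<integral>x. f x \<partial>\<mu>)"
  using integral_distr[of \<alpha> \<mu> borel f] by (simp add: distr_mu)

lemma integrable_comp_iff:
  fixes f :: "'a \<Rightarrow> real"
  assumes [measurable]: "f \<in> borel_measurable borel"
  shows "integrable \<mu> (\<lambda>x. f (\<alpha> x)) \<longleftrightarrow> integrable \<mu> f"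
  using integrable_distr_eq[of \<alpha> \<mu> borel f] by (simp add: distr_mu)

lemma emeasure_vimage: "E \<in> sets borel \<Longrightarrow> emeasure \<mu> (\<alpha> -` E) = emeasure \<mu> E"
  using emeasure_distr[of \<alpha> \<mu> borel E] by (simp add: distr_mu)

lemma measure_vimage: "E \<in> sets borel \<Longrightarrow> measure \<mu> (\<alpha> -` E) = measure \<mu> E"
  by (simp add: measure_def emeasure_vimage)

lemma vimage_borel: "E \<in> sets borel \<Longrightarrow> \<alpha> -` E \<in> sets borel"
  using measurable_sets[OF alpha_measurable, of E] by simp

lemma funpow_measurable [measurable]: "(\<alpha> ^^ n) \<in> borel \<rightarrow>\<^sub>M borel"
  by (induction n) (auto simp: comp_def)

lemma measure_vimage_funpow: "E \<in> sets borel \<Longrightarrow> measure \<mu> ((\<alpha> ^^ n) -` E) = measure \<mu> E"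
proof (induction n)
  case (Suc n)
  have *: "(\<alpha> ^^ Suc n) -` E = \<alpha> -` ((\<alpha> ^^ n) -` E)" by (auto simp: funpow_swap1)
  have "(\<alpha> ^^ n) -` E \<in> sets borel"
    using measurable_sets[OF funpow_measurable Suc.prems] by simp
  then show ?case unfolding * using Suc by (simp add: measure_vimage)
qed simp

end

locale invariant_partition = invariant_measure +
  fixes P :: "'a set set"
  assumes fin: "finite P" and part: "partition_on UNIV P" and borel: "P \<subseteq> sets borel"
begin

definition cell :: "'a \<Rightarrow> 'a set" where "cell y = (THE B. B \<in> P \<and> y \<in> B)"

lemma ex1_cell: "\<exists>!B. B \<in> P \<and> y \<in> B"
proof -
  have "y \<in> \<Union>P" using part by (simp add: partition_on_def)
  then obtain B where "B \<in> P" "y \<in> B" by blast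
  moreover have "B' = B" if "B' \<in> P" "y \<in> B'" for B'
    using partition_onD2[OF part] that \<open>B \<in> P\<close> \<open>y \<in> B\<close> by (auto simp: disjoint_def)
  ultimately show ?thesis by metis
qed

lemma cell: "cell y \<in> P" "y \<in> cell y"
  using theI'[OF ex1_cell[of y]] by (auto simp: cell_def)

lemma cell_eq: "B \<in> P \<Longrightarrow> y \<in> B \<Longrightarrow> cell y = B"
  unfolding cell_def by (rule the1_equality[OF ex1_cell]) simp

lemma sum_indicator: "(\<Sum>B\<in>P. f B * indicat_real B y) = f (cell y)"
proof -
  have "(\<Sum>B\<in>P. f B * indicat_real B y) = (\<Sum>B\<in>P. if B = cell y then f B else 0)"
  proof (intro sum.cong refl)
    fix B assume "B \<in> P"
    then show "f B * indicat_real B y = (if B = cell y then f B else 0)"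
      using cell(2)[of y] cell_eq[of B y] by (cases "y \<in> B") auto
  qed
  then show ?thesis using fin cell(1)[of y] by simp
qed

lemma cylinder_borel:
  assumes "w \<in> words P n" shows "cylinder \<alpha> w \<in> sets borel"
proof -
  have "set w \<subseteq> P \<Longrightarrow> cylinder \<alpha> w \<in> sets borel"
    using borel by (induction w) (auto intro!: sets.Int vimage_borel)
  then show ?thesis using assms by (simp add: words_def)
qed

lemma cylinder_exists: "\<exists>w\<in>words P n. y \<in> cylinder \<alpha> w"
proof (induction n arbitrary: y)
  case (Suc n)
  obtain w where "w \<in> words P n" "\<alpha> y \<in> cylinder \<alpha> w" using Suc by blast
  then show ?case using cell[of y] by (intro bexI[of _ "cell y # w"]) (auto simp: words_def)
qed auto

lemma cylinder_unique:
  assumes "w \<in> words P n" "w' \<in> words P n" "y \<in> cylinder \<alpha> w" "y \<in> cylinder \<alpha> w'"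
  shows "w = w'"
proof (rule nth_equalityI)
  show "length w = length w'" using assms by (simp add: words_def)
  fix k assume k: "k < length w"
  then have "k < n" using assms by (simp add: words_def)
  then have "w ! k \<in> P" "w' ! k \<in> P" using assms by (auto intro: words_nth)
  moreover have "(\<alpha> ^^ k) y \<in> w ! k" "(\<alpha> ^^ k) y \<in> w' ! k"
    using assms k by (auto simp: in_cylinder_iff words_def)
  ultimately show "w ! k = w' ! k" using cell_eq by metis
qed

text \<open>\<open>common_refinement\<close> chooses one set from each member of a set of
  partitions, so times with the same pulled-back partition must receive the same choice, whereas a
  word may pick its letters freely. On nonempty sets the two descriptions agree.\<close>

lemma dynamical_join_eq: "dynamical_join \<alpha> n P = cylinder \<alpha> ` words P n - {{}}"
proof -
  define R where "R k = (\<lambda>B. (\<alpha> ^^ k) -` B) ` P" for k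
  have dj: "dynamical_join \<alpha> n P = (\<Union>f \<in> (\<Pi> Q\<in>R ` {..<n}. Q). {\<Inter> (f ` R ` {..<n})}) - {{}}"
    unfolding dynamical_join_def common_refinement R_def by (rule refl)
  have cyl: "cylinder \<alpha> w = (\<Inter>k<n. (\<alpha> ^^ k) -` (w ! k))" if "w \<in> words P n" for w
    using that by (auto simp: in_cylinder_iff words_def)
  show ?thesis
  proof (intro set_eqI iffI)
    fix X assume "X \<in> dynamical_join \<alpha> n P"
    then obtain f where f: "f \<in> (\<Pi> Q\<in>R ` {..<n}. Q)" "X = (\<Inter>k<n. f (R k))" "X \<noteq> {}"
      unfolding dj by auto
    have "\<exists>B. B \<in> P \<and> f (R k) = (\<alpha> ^^ k) -` B" if "k < n" for k
    proof -
      have "f (R k) \<in> R k" using f(1) that by (auto simp: Pi_iff)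
      then show ?thesis by (auto simp: R_def)
    qed
    then obtain b where b: "\<And>k. k < n \<Longrightarrow> b k \<in> P" "\<And>k. k < n \<Longrightarrow> f (R k) = (\<alpha> ^^ k) -` b k"
      by metis
    define w where "w = map b [0..<n]"
    have w: "w \<in> words P n" using b by (auto simp: w_def words_def)
    have "X = cylinder \<alpha> w" unfolding f(2) cyl[OF w] using b by (auto simp: w_def)
    then show "X \<in> cylinder \<alpha> ` words P n - {{}}" using w f(3) by blast
  next
    fix X assume "X \<in> cylinder \<alpha> ` words P n - {{}}"
    then obtain w x where w: "w \<in> words P n" "X = cylinder \<alpha> w" "x \<in> X" by blast
    \<comment> \<open>Choosing through the point x rather than through the time k makes the choice a
      function of the partition alone; disjointness of P then forces it to be the letter of
      w.\<close>
    define f where "f Q = (SOME S. S \<in> Q \<and> x \<in> S)" for Q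
    have wP: "w ! k \<in> P" if "k < n" for k
      using w(1) that by (rule words_nth)
    have fR: "f (R k) = (\<alpha> ^^ k) -` (w ! k)" if k: "k < n" for k
    proof -
      have ex: "(\<alpha> ^^ k) -` (w ! k) \<in> R k \<and> x \<in> (\<alpha> ^^ k) -` (w ! k)"
        using w wP[OF k] k by (auto simp: R_def in_cylinder_iff words_def)
      then have "f (R k) \<in> R k \<and> x \<in> f (R k)" unfolding f_def by (rule someI)
      then obtain B where B: "B \<in> P" "f (R k) = (\<alpha> ^^ k) -` B" "(\<alpha> ^^ k) x \<in> B"
        by (auto simp: R_def)
      have "(\<alpha> ^^ k) x \<in> w ! k" using ex by simp
      then have "B = w ! k" using cell_eq[OF B(1,3)] cell_eq[OF wP[OF k]] by simp
      then show ?thesis using B by simp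
    qed
    have "f \<in> (\<Pi> Q\<in>R ` {..<n}. Q)" using fR wP by (auto simp: Pi_iff) (auto simp: R_def)
    moreover have "X = \<Inter> (f ` R ` {..<n})" using w fR by (auto simp: cyl)
    ultimately show "X \<in> dynamical_join \<alpha> n P" using w(3) unfolding dj by blast
  qed
qed

definition block_entropy :: "nat \<Rightarrow> real" where
  "block_entropy n = - (\<Sum>w\<in>words P n. measure \<mu> (cylinder \<alpha> w) * ln (measure \<mu> (cylinder \<alpha> w)))"

text \<open>Distinct words have disjoint cylinders, so only empty cylinders can coincide, and these
  contribute \<open>0 * ln 0\<close>, which is 0.\<close>

lemma partition_entropy_dynamical_join: "partition_entropy \<mu> (dynamical_join \<alpha> n P) = block_entropy n"
proof -
  let ?h = "\<lambda>E. measure \<mu> E * ln (measure \<mu> E)"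
  let ?W = "{w \<in> words P n. cylinder \<alpha> w \<noteq> {}}"
  have inj: "inj_on (cylinder \<alpha>) ?W"
  proof (rule inj_onI)
    fix w w' assume w: "w \<in> ?W" "w' \<in> ?W" "cylinder \<alpha> w = cylinder \<alpha> w'"
    then obtain y where "y \<in> cylinder \<alpha> w" by blast
    then show "w = w'" using w by (intro cylinder_unique[of w n w' y]) auto
  qed
  have "cylinder \<alpha> ` words P n - {{}} = cylinder \<alpha> ` ?W" by auto
  then have "(\<Sum>E\<in>dynamical_join \<alpha> n P. ?h E) = (\<Sum>w\<in>?W. ?h (cylinder \<alpha> w))"
    unfolding dynamical_join_eq by (simp add: sum.reindex[OF inj])
  also have "\<dots> = (\<Sum>w\<in>words P n. ?h (cylinder \<alpha> w))"
    by (intro sum.mono_neutral_left) (use finite_words[OF fin] in auto)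
  finally show ?thesis by (simp add: partition_entropy_def block_entropy_def)
qed

lemma measure_eq_sum_words:
  assumes E: "E \<in> sets borel"
  shows "measure \<mu> E = (\<Sum>w\<in>words P n. measure \<mu> (E \<inter> cylinder \<alpha> w))"
proof -
  have "E = (\<Union>w\<in>words P n. E \<inter> cylinder \<alpha> w)" using cylinder_exists by blast
  then have "measure \<mu> E = measure \<mu> (\<Union>w\<in>words P n. E \<inter> cylinder \<alpha> w)" by simp
  also have "\<dots> = (\<Sum>w\<in>words P n. measure \<mu> (E \<inter> cylinder \<alpha> w))"
    by (intro finite_measure_finite_Union finite_words fin)
      (use E cylinder_borel in \<open>auto simp: disjoint_family_on_def dest: cylinder_unique\<close>)
  finally show ?thesis .
qed

lemma sum_words_measure: "(\<Sum>w\<in>words P n. measure \<mu> (cylinder \<alpha> w)) = 1"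
  using measure_eq_sum_words[of UNIV n] by simp

lemma block_entropy_nonneg: "0 \<le> block_entropy n"
proof -
  have "measure \<mu> E * ln (measure \<mu> E) \<le> 0" for E
    by (cases "measure \<mu> E = 0") (auto simp: mult_nonneg_nonpos zero_less_measure_iff)
  then show ?thesis unfolding block_entropy_def by (simp add: sum_nonpos)
qed

text \<open>The Gibbs inequality compares the law of words of length m + n with the product of the
  laws of their two parts. By invariance of \<mu>, the second part is distributed like a word that
  starts at time 0.\<close>

lemma block_entropy_add: "block_entropy (m + n) \<le> block_entropy m + block_entropy n"
proof -
  define c where "c w = measure \<mu> (cylinder \<alpha> w)" for w
  define s where "s w = c (take m w) * c (drop m w)" for w
  have c0: "0 \<le> c w" for w by (simp add: c_def)
  have left: "c u = (\<Sum>v\<in>words P n. c (u @ v))" if u: "u \<in> words P m" for u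
  proof -
    have "c u = (\<Sum>u'\<in>words P (m + n). measure \<mu> (cylinder \<alpha> u \<inter> cylinder \<alpha> u'))"
      unfolding c_def by (rule measure_eq_sum_words) (rule cylinder_borel[OF u])
    also have "\<dots> = (\<Sum>u'\<in>words P m. \<Sum>v\<in>words P n. if u' = u then c (u @ v) else 0)"
      unfolding sum_words_append
    proof (intro sum.cong refl)
      fix u' v assume u': "u' \<in> words P m" "v \<in> words P n"
      show "measure \<mu> (cylinder \<alpha> u \<inter> cylinder \<alpha> (u' @ v)) = (if u' = u then c (u @ v) else 0)"
      proof (cases "u' = u")
        case True
        then show ?thesis by (simp add: c_def cylinder_append Int_assoc[symmetric])
      next
        case False
        then have "cylinder \<alpha> u \<inter> cylinder \<alpha> (u' @ v) = {}"
          using cylinder_unique[OF u u'(1)] by (auto simp: cylinder_append)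
        then show ?thesis using False by simp
      qed
    qed
    also have "\<dots> = (\<Sum>u'\<in>words P m. if u' = u then (\<Sum>v\<in>words P n. c (u @ v)) else 0)"
      by (intro sum.cong refl) auto
    also have "\<dots> = (\<Sum>v\<in>words P n. c (u @ v))"
      using u finite_words[OF fin] by simp
    finally show ?thesis .
  qed
  have right: "c v = (\<Sum>u\<in>words P m. c (u @ v))" if v: "v \<in> words P n" for v
  proof -
    have b: "(\<alpha> ^^ m) -` cylinder \<alpha> v \<in> sets borel"
      using measurable_sets[OF funpow_measurable cylinder_borel[OF v]] by simp
    have "c v = measure \<mu> ((\<alpha> ^^ m) -` cylinder \<alpha> v)"
      unfolding c_def by (rule measure_vimage_funpow[symmetric]) (rule cylinder_borel[OF v])
    also have "\<dots> = (\<Sum>u\<in>words P m. measure \<mu> ((\<alpha> ^^ m) -` cylinder \<alpha> v \<inter> cylinder \<alpha> u))"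
      by (rule measure_eq_sum_words[OF b])
    also have "\<dots> = (\<Sum>u\<in>words P m. c (u @ v))"
      by (intro sum.cong refl) (auto simp: c_def cylinder_append words_def Int_commute)
    finally show ?thesis .
  qed
  have dec: "take m (u @ v) = u" "drop m (u @ v) = v" if "u \<in> words P m" for u v
    using that by (auto simp: words_def)
  have pos: "0 < c u" "0 < c v" if "0 < c (u @ v)" "u \<in> words P m" "v \<in> words P n" for u v
  proof -
    have "c (u @ v) \<le> c u"
      unfolding left[OF that(2)] by (rule member_le_sum) (use that c0 finite_words[OF fin] in auto)
    moreover have "c (u @ v) \<le> c v"
      unfolding right[OF that(3)] using that c0 finite_words[OF fin]
      by (intro member_le_sum[where f="\<lambda>u. c (u @ v)"]) auto
    ultimately show "0 < c u" "0 < c v" using that by auto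
  qed
  have sum1: "(\<Sum>w\<in>words P k. c w) = 1" for k unfolding c_def by (rule sum_words_measure)
  have "(\<Sum>w\<in>words P (m + n). s w) = (\<Sum>u\<in>words P m. \<Sum>v\<in>words P n. c u * c v)"
    unfolding sum_words_append by (intro sum.cong refl) (simp only: s_def dec)
  also have "\<dots> = 1" by (simp add: sum1 flip: sum_product)
  finally have s1: "(\<Sum>w\<in>words P (m + n). s w) = 1" .
  have s_nonneg: "0 \<le> s w" for w by (simp add: s_def c0)
  have "0 < s w" if "w \<in> words P (m + n)" "0 < c w" for w
  proof -
    have "take m w \<in> words P m" "drop m w \<in> words P n"
      using that by (auto simp: words_def dest: in_set_takeD in_set_dropD)
    then show ?thesis using pos[of "take m w" "drop m w"] that by (simp add: s_def)
  qed
  then have "- (\<Sum>w\<in>words P (m + n). c w * ln (c w)) \<le> - (\<Sum>w\<in>words P (m + n). c w * ln (s w)) + ln 1"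
    by (intro gibbs) (auto simp: finite_words fin c0 sum1 s_nonneg s1)
  also have "(\<Sum>w\<in>words P (m + n). c w * ln (s w))
      = (\<Sum>u\<in>words P m. \<Sum>v\<in>words P n. c (u @ v) * ln (c u) + c (u @ v) * ln (c v))"
    unfolding sum_words_append
  proof (intro sum.cong refl)
    fix u v assume uv: "u \<in> words P m" "v \<in> words P n"
    have suv: "s (u @ v) = c u * c v" by (simp only: s_def dec[OF uv(1)])
    show "c (u @ v) * ln (s (u @ v)) = c (u @ v) * ln (c u) + c (u @ v) * ln (c v)"
      using pos[OF _ uv] c0[of "u @ v"]
      by (cases "c (u @ v) = 0") (auto simp: suv ln_mult less_le algebra_simps)
  qed
  also have "\<dots> = (\<Sum>u\<in>words P m. c u * ln (c u)) + (\<Sum>v\<in>words P n. c v * ln (c v))"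
  proof -
    have "(\<Sum>u\<in>words P m. \<Sum>v\<in>words P n. c (u @ v) * ln (c v)) = (\<Sum>v\<in>words P n. c v * ln (c v))"
      by (subst sum.swap) (simp add: right flip: sum_distrib_right)
    then show ?thesis by (simp add: sum.distrib left flip: sum_distrib_right)
  qed
  finally show ?thesis by (simp add: block_entropy_def c_def)
qed

definition entropy_rate :: real where
  "entropy_rate = lim (\<lambda>n. block_entropy n / real n)"

lemma entropy_rate: "(\<lambda>n. block_entropy n / real n) \<longlonglongrightarrow> entropy_rate"
  using fekete_convergent[of block_entropy] block_entropy_nonneg block_entropy_add
  by (simp add: entropy_rate_def convergent_LIMSEQ_iff)

lemma lim_partition_entropy:
  "lim (\<lambda>n. partition_entropy \<mu> (dynamical_join \<alpha> n P) / real n) = entropy_rate"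
  by (simp add: partition_entropy_dynamical_join entropy_rate_def)

end

text \<open>Replacing each letter of a Q-word by a set of P that contains it groups the Q-cylinders
  into P-cylinders. This lets the supremum in \<open>ks_entropy\<close> be bounded through
  partitions into small sets.\<close>

lemma (in invariant_measure) entropy_rate_refine:
  assumes "invariant_partition \<alpha> \<mu> P" "invariant_partition \<alpha> \<mu> Q" and refine: "\<And>C. C \<in> Q \<Longrightarrow> \<exists>B\<in>P. C \<subseteq> B"
  shows "invariant_partition.entropy_rate \<alpha> \<mu> P \<le> invariant_partition.entropy_rate \<alpha> \<mu> Q"
proof -
  interpret P: invariant_partition \<alpha> \<mu> P by fact
  interpret Q: invariant_partition \<alpha> \<mu> Q by fact
  obtain f where f: "\<And>C. C \<in> Q \<Longrightarrow> f C \<in> P" "\<And>C. C \<in> Q \<Longrightarrow> C \<subseteq> f C" using refine by metis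
  define c where "c w = measure \<mu> (cylinder \<alpha> w)" for w
  have sub: "cylinder \<alpha> w \<subseteq> cylinder \<alpha> (map f w)" if "set w \<subseteq> Q" for w
    using that f(2) by (induction w) auto
  have "P.block_entropy n \<le> Q.block_entropy n" for n
  proof -
    have mapw: "map f w \<in> words P n" if "w \<in> words Q n" for w
      using that f(1) by (auto simp: words_def)
    have eq: "c u = (\<Sum>w\<in>{w\<in>words Q n. map f w = u}. c w)" if u: "u \<in> words P n" for u
    proof -
      have "c u = (\<Sum>w\<in>words Q n. measure \<mu> (cylinder \<alpha> u \<inter> cylinder \<alpha> w))"
        unfolding c_def by (rule Q.measure_eq_sum_words[OF P.cylinder_borel[OF u]])
      also have "\<dots> = (\<Sum>w\<in>words Q n. if map f w = u then c w else 0)"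
      proof (intro sum.cong refl)
        fix w assume w: "w \<in> words Q n"
        have sub': "cylinder \<alpha> w \<subseteq> cylinder \<alpha> (map f w)" using w sub by (auto simp: words_def)
        show "measure \<mu> (cylinder \<alpha> u \<inter> cylinder \<alpha> w) = (if map f w = u then c w else 0)"
        proof (cases "map f w = u")
          case True
          then show ?thesis using sub' by (auto simp: c_def Int_absorb1)
        next
          case False
          then have "cylinder \<alpha> u \<inter> cylinder \<alpha> w = {}"
            using sub' P.cylinder_unique[OF u mapw[OF w]] by blast
          then show ?thesis using False by simp
        qed
      qed
      also have "\<dots> = (\<Sum>w\<in>{w\<in>words Q n. map f w = u}. c w)"
        by (simp add: sum.inter_filter finite_words Q.fin)
      finally show ?thesis .
    qed
    have "(\<Sum>w\<in>words Q n. c w * ln (c w)) \<le> (\<Sum>w\<in>words Q n. c w * ln (c (map f w)))"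
    proof (rule sum_mono)
      fix w assume w: "w \<in> words Q n"
      have "c w \<le> c (map f w)"
        unfolding c_def using w sub P.cylinder_borel[OF mapw[OF w]]
        by (intro finite_measure_mono) (auto simp: words_def)
      moreover have "0 \<le> c w" by (simp add: c_def)
      ultimately show "c w * ln (c w) \<le> c w * ln (c (map f w))"
        by (cases "c w = 0") (auto intro!: mult_left_mono)
    qed
    also have "\<dots> = (\<Sum>u\<in>words P n. \<Sum>w\<in>{w\<in>words Q n. map f w = u}. c w * ln (c (map f w)))"
      by (rule sum.group[symmetric]) (use mapw finite_words P.fin Q.fin in auto)
    also have "\<dots> = (\<Sum>u\<in>words P n. c u * ln (c u))"
      by (intro sum.cong refl) (simp add: eq sum_distrib_right)
    finally show ?thesis by (simp add: P.block_entropy_def Q.block_entropy_def c_def)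
  qed
  then show ?thesis
    by (intro LIMSEQ_le[OF P.entropy_rate Q.entropy_rate] exI[of _ 0]) (auto intro!: divide_right_mono)
qed

section \<open>Conditional weights along fibres\<close>

context invariant_partition
begin

lemma P_nonempty: "P \<noteq> {}"
  using cell(1) by blast

lemma card_P: "0 < card P"
  using fin P_nonempty by (simp add: card_gt_0_iff)

lemma P_borel [measurable]: "B \<in> P \<Longrightarrow> B \<in> sets borel"
  using borel by blast

lemma nn_sum_indicator: "(\<Sum>B\<in>P. indicator B y * f B) = (f (cell y) :: ennreal)"
proof -
  have "(\<Sum>B\<in>P. indicator B y * f B) = (\<Sum>B\<in>P. if B = cell y then f B else 0)"
  proof (intro sum.cong refl)
    fix B assume "B \<in> P"
    then show "indicator B y * f B = (if B = cell y then f B else 0)"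
      using cell(2)[of y] cell_eq[of B y] by (cases "y \<in> B") auto
  qed
  then show ?thesis using fin cell(1)[of y] by simp
qed

text \<open>A disintegration of \<mu> over \<alpha>, as far as P can see it: \<open>w B x\<close> is
  the probability of B given that \<alpha> takes the value x. Nonnegativity and total weight 1 hold
  at every x and not just almost everywhere, so the weights can be handled pointwise.\<close>

definition conditional_weights :: "('a set \<Rightarrow> 'a \<Rightarrow> real) \<Rightarrow> bool" where
  "conditional_weights w \<longleftrightarrow>
     (\<forall>B\<in>P. w B \<in> borel_measurable borel) \<and> (\<forall>B\<in>P. \<forall>x. 0 \<le> w B x) \<and> (\<forall>x. (\<Sum>B\<in>P. w B x) = 1) \<and>
     (\<forall>B\<in>P. \<forall>f\<in>borel_measurable borel.
        (\<integral>\<^sup>+y. indicator B y * f (\<alpha> y) \<partial>\<mu>) = (\<integral>\<^sup>+x. ennreal (w B x) * f x \<partial>\<mu>))"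

text \<open>The part of \<mu> in B, pushed forward by \<alpha>, is absolutely continuous with
  respect to \<mu> because \<mu> is invariant. Its density is the weight.\<close>

lemma conditional_weights_exist: "\<exists>w. conditional_weights w"
proof -
  define N where "N B = distr (density \<mu> (indicator B)) borel \<alpha>" for B
  define r where "r B = RN_deriv \<mu> (N B)" for B
  have rm [measurable]: "r B \<in> borel_measurable borel" for B
    using borel_measurable_RN_deriv[of \<mu> "N B"] unfolding r_def by (simp cong: measurable_cong_sets)
  have r_int: "(\<integral>\<^sup>+y. indicator B y * f (\<alpha> y) \<partial>\<mu>) = (\<integral>\<^sup>+x. r B x * f x \<partial>\<mu>)"
    if B: "B \<in> P" and [measurable]: "f \<in> borel_measurable borel" for B f
  proof -
    have [measurable]: "B \<in> sets borel" using B by (rule P_borel)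
    have [measurable]: "\<alpha> \<in> density \<mu> (indicator B) \<rightarrow>\<^sub>M borel" by (rule borel_measurable_if_sets_borel) auto
    have "absolutely_continuous \<mu> (N B)"
      unfolding absolutely_continuous_def
    proof
      fix E assume E: "E \<in> null_sets \<mu>"
      then have Eb: "E \<in> sets borel" by (auto simp: null_sets_def)
      have vb: "\<alpha> -` E \<in> sets borel" using Eb by (rule vimage_borel)
      have "emeasure (N B) E = (\<integral>\<^sup>+x. indicator B x * indicator (\<alpha> -` E) x \<partial>\<mu>)"
        unfolding N_def using Eb vb by (simp add: emeasure_distr emeasure_density)
      also have "\<dots> \<le> (\<integral>\<^sup>+x. indicator (\<alpha> -` E) x \<partial>\<mu>)"
        by (intro nn_integral_mono) (auto simp: indicator_def)
      also have "\<dots> = 0" using vb E by (simp add: emeasure_vimage[OF Eb] null_sets_def)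
      finally show "E \<in> null_sets (N B)" using Eb by (auto simp: null_sets_def N_def)
    qed
    then have "density \<mu> (r B) = N B"
      unfolding r_def by (rule density_RN_deriv) (simp add: N_def)
    then have "(\<integral>\<^sup>+x. f x \<partial>density \<mu> (r B)) = (\<integral>\<^sup>+x. f x \<partial>N B)" by simp
    then show ?thesis by (simp add: nn_integral_density N_def nn_integral_distr)
  qed
  have "density \<mu> (\<lambda>x. \<Sum>B\<in>P. r B x) = density \<mu> (\<lambda>_. 1)"
  proof (rule measure_eqI)
    fix E assume "E \<in> sets (density \<mu> (\<lambda>x. \<Sum>B\<in>P. r B x))"
    then have E [measurable]: "E \<in> sets borel" by simp
    have "emeasure (density \<mu> (\<lambda>x. \<Sum>B\<in>P. r B x)) E = (\<integral>\<^sup>+x. (\<Sum>B\<in>P. r B x * indicator E x) \<partial>\<mu>)"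
      by (subst emeasure_density) (auto simp: sum_distrib_right)
    also have "\<dots> = (\<Sum>B\<in>P. \<integral>\<^sup>+x. r B x * indicator E x \<partial>\<mu>)" by (rule nn_integral_sum) simp
    also have "\<dots> = (\<Sum>B\<in>P. \<integral>\<^sup>+y. indicator B y * indicator E (\<alpha> y) \<partial>\<mu>)"
      by (intro sum.cong refl r_int[symmetric]) auto
    also have "\<dots> = (\<integral>\<^sup>+y. (\<Sum>B\<in>P. indicator B y * indicator E (\<alpha> y)) \<partial>\<mu>)"
      by (rule nn_integral_sum[symmetric]) measurable
    also have "\<dots> = (\<integral>\<^sup>+y. indicator E y \<partial>\<mu>)"
      by (simp add: nn_sum_indicator nn_integral_comp)
    finally show "emeasure (density \<mu> (\<lambda>x. \<Sum>B\<in>P. r B x)) E = emeasure (density \<mu> (\<lambda>_. 1)) E"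
      by (simp add: density_1)
  qed simp
  then have ae: "AE x in \<mu>. (\<Sum>B\<in>P. r B x) = 1"
    by (intro density_unique) auto
  define S where "S = {x. (\<Sum>B\<in>P. r B x) = 1}"
  have [measurable]: "S \<in> sets borel" unfolding S_def by measurable
  \<comment> \<open>On the null set where the densities do not add up to 1, uniform weights take
    their place.\<close>
  define w where "w B x = (if x \<in> S then enn2real (r B x) else 1 / real (card P))" for B x
  have fin_r: "r B x < top" if "x \<in> S" "B \<in> P" for x B
  proof -
    have "r B x \<le> (\<Sum>B\<in>P. r B x)" using fin that by (intro member_le_sum) auto
    then show ?thesis using that by (simp add: S_def order_le_less_trans)
  qed
  have "(\<Sum>B\<in>P. w B x) = 1" for x
  proof (cases "x \<in> S")
    case True
    then have "ennreal (\<Sum>B\<in>P. w B x) = (\<Sum>B\<in>P. r B x)"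
      using fin_r by (simp add: w_def less_top flip: sum_ennreal)
    then have "ennreal (\<Sum>B\<in>P. w B x) = ennreal 1" using True by (simp add: S_def)
    then show ?thesis using True by (subst (asm) ennreal_inj) (auto simp: w_def intro!: sum_nonneg)
  next
    case False
    then show ?thesis using card_P by (simp add: w_def)
  qed
  moreover have "(\<integral>\<^sup>+y. indicator B y * f (\<alpha> y) \<partial>\<mu>) = (\<integral>\<^sup>+x. ennreal (w B x) * f x \<partial>\<mu>)"
    if "B \<in> P" "f \<in> borel_measurable borel" for B f
    unfolding r_int[OF that]
    by (rule nn_integral_cong_AE) (use ae fin_r that in \<open>auto simp: w_def S_def less_top\<close>)
  moreover have "w B \<in> borel_measurable borel" for B unfolding w_def by measurable
  moreover have "0 \<le> w B x" for B x by (simp add: w_def)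
  ultimately show ?thesis
    unfolding conditional_weights_def by (intro exI[of _ w]) blast
qed

definition weight :: "'a set \<Rightarrow> 'a \<Rightarrow> real" where
  "weight = (SOME w. conditional_weights w)"

lemma conditional_weights_weight: "conditional_weights weight"
  unfolding weight_def by (rule someI_ex[OF conditional_weights_exist])

lemma weight_measurable [measurable]: "B \<in> P \<Longrightarrow> weight B \<in> borel_measurable borel"
  and weight_nonneg: "B \<in> P \<Longrightarrow> 0 \<le> weight B x"
  and weight_sum: "(\<Sum>B\<in>P. weight B x) = 1"
  and nn_integral_weight: "B \<in> P \<Longrightarrow> f \<in> borel_measurable borel \<Longrightarrow>
        (\<integral>\<^sup>+y. indicator B y * f (\<alpha> y) \<partial>\<mu>) = (\<integral>\<^sup>+x. ennreal (weight B x) * f x \<partial>\<mu>)"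
  using conditional_weights_weight unfolding conditional_weights_def by auto

lemma weight_le_1: "B \<in> P \<Longrightarrow> weight B x \<le> 1"
  unfolding weight_sum[of x, symmetric] by (rule member_le_sum) (use fin weight_nonneg in auto)

text \<open>Conditional expectation given \<alpha>, for functions that know y only through its cell
  and its image.\<close>

lemma nn_integral_cell:
  assumes [measurable]: "\<And>B. B \<in> P \<Longrightarrow> f B \<in> borel_measurable borel"
  shows "(\<integral>\<^sup>+y. f (cell y) (\<alpha> y) \<partial>\<mu>) = (\<integral>\<^sup>+x. (\<Sum>B\<in>P. ennreal (weight B x) * f B x) \<partial>\<mu>)"
proof -
  have "(\<integral>\<^sup>+y. f (cell y) (\<alpha> y) \<partial>\<mu>) = (\<integral>\<^sup>+y. (\<Sum>B\<in>P. indicator B y * f B (\<alpha> y)) \<partial>\<mu>)"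
    by (simp add: nn_sum_indicator)
  also have "\<dots> = (\<Sum>B\<in>P. \<integral>\<^sup>+y. indicator B y * f B (\<alpha> y) \<partial>\<mu>)"
    by (rule nn_integral_sum) measurable
  also have "\<dots> = (\<Sum>B\<in>P. \<integral>\<^sup>+x. ennreal (weight B x) * f B x \<partial>\<mu>)"
    by (intro sum.cong refl nn_integral_weight) auto
  also have "\<dots> = (\<integral>\<^sup>+x. (\<Sum>B\<in>P. ennreal (weight B x) * f B x) \<partial>\<mu>)"
    by (rule nn_integral_sum[symmetric]) measurable
  finally show ?thesis .
qed

lemma cell_measurable:
  assumes [measurable]: "\<And>B. B \<in> P \<Longrightarrow> f B \<in> borel_measurable borel"
  shows "(\<lambda>y. f (cell y) y :: real) \<in> borel_measurable borel"
proof -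
  have "(\<lambda>y. f (cell y) y) = (\<lambda>y. \<Sum>B\<in>P. f B y * indicat_real B y)"
    by (rule ext, rule sum_indicator[symmetric])
  then show ?thesis by simp
qed

text \<open>Division by \<open>fibre_prob\<close> must be harmless, so it is 1 where the conditional weight vanishes, a null set.\<close>

definition positive_weight :: "'a set \<Rightarrow> 'a \<Rightarrow> real" where
  "positive_weight B x = (if weight B x = 0 then 1 else weight B x)"

definition fibre_prob :: "'a \<Rightarrow> real" where
  "fibre_prob y = positive_weight (cell y) (\<alpha> y)"

lemma positive_weight_measurable [measurable]: "B \<in> P \<Longrightarrow> positive_weight B \<in> borel_measurable borel"
  unfolding positive_weight_def by measurable

lemma positive_weight_pos: "B \<in> P \<Longrightarrow> 0 < positive_weight B x"
  using weight_nonneg[of B x] by (auto simp: positive_weight_def)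

lemma positive_weight_le_1: "B \<in> P \<Longrightarrow> positive_weight B x \<le> 1"
  using weight_le_1[of B x] by (auto simp: positive_weight_def)

lemma fibre_prob_measurable [measurable]: "fibre_prob \<in> borel_measurable borel"
  unfolding fibre_prob_def by (rule cell_measurable) measurable

lemma fibre_prob_pos: "0 < fibre_prob y"
  unfolding fibre_prob_def by (rule positive_weight_pos) (rule cell)

lemma fibre_prob_le_1: "fibre_prob y \<le> 1"
  unfolding fibre_prob_def by (rule positive_weight_le_1) (rule cell)

text \<open>Given the image x, a cell of weight 0 is hit with probability 0, so the substitute value
  1 in \<open>positive_weight\<close> almost never occurs.\<close>

lemma AE_fibre_prob: "AE y in \<mu>. fibre_prob y = weight (cell y) (\<alpha> y)"
proof -
  have [measurable]: "(\<lambda>y. weight (cell y) (\<alpha> y)) \<in> borel_measurable borel"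
    by (rule cell_measurable) measurable
  have "(\<integral>\<^sup>+y. indicator {x. weight (cell y) x = 0} (\<alpha> y) \<partial>\<mu>)
      = (\<integral>\<^sup>+x. (\<Sum>B\<in>P. ennreal (weight B x) * indicator {x. weight B x = 0} x) \<partial>\<mu>)"
    by (rule nn_integral_cell) measurable
  also have "\<dots> = (\<integral>\<^sup>+x. 0 \<partial>\<mu>)"
    by (intro nn_integral_cong sum.neutral) (auto simp: indicator_def)
  finally have "(\<integral>\<^sup>+y. indicator {y. weight (cell y) (\<alpha> y) = 0} y \<partial>\<mu>) = 0"
    by (simp add: indicator_def)
  then have "AE y in \<mu>. indicator {y. weight (cell y) (\<alpha> y) = 0} y = (0 :: ennreal)"
    by (subst (asm) nn_integral_0_iff_AE) auto
  then show ?thesis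
    by eventually_elim (auto simp: fibre_prob_def positive_weight_def indicator_def split: if_splits)
qed

text \<open>Division by \<open>fibre_prob\<close> cancels the weights of the disintegration and
  leaves a plain sum over the cells. Cells of weight 0 are lost on the left, hence the inequality.
  The lower bound on block entropies and the bound on transfers both rest on this.\<close>

lemma nn_integral_div_fibre_prob:
  assumes [measurable]: "\<And>B. B \<in> P \<Longrightarrow> f B \<in> borel_measurable borel"
  shows "(\<integral>\<^sup>+y. f (cell y) (\<alpha> y) * ennreal (1 / fibre_prob y) \<partial>\<mu>) \<le> (\<integral>\<^sup>+x. (\<Sum>B\<in>P. f B x) \<partial>\<mu>)"
proof -
  have "(\<integral>\<^sup>+y. f (cell y) (\<alpha> y) * ennreal (1 / fibre_prob y) \<partial>\<mu>)
      = (\<integral>\<^sup>+x. (\<Sum>B\<in>P. ennreal (weight B x) * (f B x * ennreal (1 / positive_weight B x))) \<partial>\<mu>)"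
    unfolding fibre_prob_def
    by (rule nn_integral_cell[where f="\<lambda>B x. f B x * ennreal (1 / positive_weight B x)"]) measurable
  also have "\<dots> \<le> (\<integral>\<^sup>+x. (\<Sum>B\<in>P. f B x) \<partial>\<mu>)"
  proof (intro nn_integral_mono sum_mono)
    fix x B assume B: "B \<in> P"
    have "weight B x * (1 / positive_weight B x) \<le> 1" by (simp add: positive_weight_def)
    then have "ennreal (weight B x) * ennreal (1 / positive_weight B x) \<le> 1"
      using weight_nonneg[OF B] positive_weight_pos[OF B, of x]
      by (simp add: ennreal_le_1 flip: ennreal_mult)
    then have "f B x * (ennreal (weight B x) * ennreal (1 / positive_weight B x)) \<le> f B x * 1"
      by (rule mult_left_mono) simp
    then show "ennreal (weight B x) * (f B x * ennreal (1 / positive_weight B x)) \<le> f B x"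
      by (simp add: ac_simps)
  qed
  finally show ?thesis .
qed

lemma neg_ln_mult_le: "0 \<le> t \<Longrightarrow> t * - ln t \<le> 1" for t :: real
proof (cases "t = 0")
  case False
  assume "0 \<le> t"
  then have t: "0 < t" using False by simp
  then have "- ln t \<le> 1 / t - 1" using ln_le_minus_one[of "1 / t"] by (simp add: ln_div)
  then have "t * - ln t \<le> t * (1 / t - 1)" using t by (intro mult_left_mono) auto
  then show ?thesis using t by (simp add: algebra_simps)
qed auto

text \<open>Averaged over a fibre, - ln p becomes a sum of terms t * - ln t over the weights t, each
  at most 1; so its integral is at most \<open>card P\<close>.\<close>

lemma integrable_ln_fibre_prob: "integrable \<mu> (\<lambda>y. ln (fibre_prob y))"
proof (rule integrableI_bounded)
  have "(\<integral>\<^sup>+y. ennreal (norm (ln (fibre_prob y))) \<partial>\<mu>)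
      = (\<integral>\<^sup>+y. ennreal (- ln (positive_weight (cell y) (\<alpha> y))) \<partial>\<mu>)"
    using fibre_prob_le_1 fibre_prob_pos by (intro nn_integral_cong) (auto simp: fibre_prob_def)
  also have "\<dots> = (\<integral>\<^sup>+x. (\<Sum>B\<in>P. ennreal (weight B x) * ennreal (- ln (positive_weight B x))) \<partial>\<mu>)"
    by (rule nn_integral_cell[where f="\<lambda>B x. ennreal (- ln (positive_weight B x))"]) measurable
  also have "\<dots> \<le> (\<integral>\<^sup>+x. (\<Sum>B\<in>P. 1) \<partial>\<mu>)"
  proof (intro nn_integral_mono sum_mono)
    fix x B assume B: "B \<in> P"
    have "weight B x * - ln (positive_weight B x) \<le> 1"
      using neg_ln_mult_le[OF weight_nonneg[OF B, of x]] by (auto simp: positive_weight_def)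
    moreover have "0 \<le> - ln (positive_weight B x)"
      using positive_weight_le_1[OF B, of x] positive_weight_pos[OF B, of x] by auto
    ultimately show "ennreal (weight B x) * ennreal (- ln (positive_weight B x)) \<le> 1"
      using weight_nonneg[OF B] by (simp add: ennreal_le_1 flip: ennreal_mult)
  qed
  also have "\<dots> < \<infinity>" using emeasure_space_1 by (simp add: ennreal_of_nat_eq_real_of_nat ennreal_mult_less_top)
  finally show "(\<integral>\<^sup>+y. ennreal (norm (ln (fibre_prob y))) \<partial>\<mu>) < \<infinity>" .
qed measurable

text \<open>The conditional entropy of P given \<alpha>, since p(y) is the conditional probability
  of the cell of y.\<close>

definition fibre_entropy :: real where
  "fibre_entropy = - (\<integral>y. ln (fibre_prob y) \<partial>\<mu>)"

lemma integral_birkhoff: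
  fixes g :: "'a \<Rightarrow> real"
  assumes [measurable]: "g \<in> borel_measurable borel" and "integrable \<mu> g"
  shows "integrable \<mu> (\<lambda>y. \<Sum>k<n. g ((\<alpha> ^^ k) y))" "(\<integral>y. (\<Sum>k<n. g ((\<alpha> ^^ k) y)) \<partial>\<mu>) = real n * (\<integral>y. g y \<partial>\<mu>)"
proof -
  have "integrable \<mu> (\<lambda>y. g ((\<alpha> ^^ k) y)) \<and> (\<integral>y. g ((\<alpha> ^^ k) y) \<partial>\<mu>) = (\<integral>y. g y \<partial>\<mu>)" for k
  proof (induction k)
    case (Suc k)
    have m: "(\<lambda>y. g ((\<alpha> ^^ k) y)) \<in> borel_measurable borel" by measurable
    show ?case using integral_comp[OF m] integrable_comp_iff[OF m] Suc by (simp add: funpow_swap1)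
  qed (use assms in simp)
  then show "integrable \<mu> (\<lambda>y. \<Sum>k<n. g ((\<alpha> ^^ k) y))" "(\<integral>y. (\<Sum>k<n. g ((\<alpha> ^^ k) y)) \<partial>\<mu>) = real n * (\<integral>y. g y \<partial>\<mu>)"
    by auto
qed

section \<open>Lower bound for block entropies\<close>

lemma sum_funpow_Suc: "(\<Sum>k<Suc n. g ((\<alpha> ^^ k) y)) = g y + (\<Sum>k<n. g ((\<alpha> ^^ k) (\<alpha> y)))"
  for g :: "'a \<Rightarrow> real"
  by (simp add: sum.lessThan_Suc_shift funpow_swap1 del: sum.lessThan_Suc)

definition log_fibre_prob_sum :: "nat \<Rightarrow> 'a \<Rightarrow> real" where
  "log_fibre_prob_sum n y = (\<Sum>k<n. ln (fibre_prob ((\<alpha> ^^ k) y)))"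

lemma log_fibre_prob_sum_measurable [measurable]: "log_fibre_prob_sum n \<in> borel_measurable borel"
  unfolding log_fibre_prob_sum_def by measurable

text \<open>The exponential is the reciprocal of the product of p along the word. Peeling off the
  first letter with \<open>nn_integral_div_fibre_prob\<close> removes one factor and one
  letter.\<close>

lemma nn_integral_cylinder_fibre_prob:
  "set w \<subseteq> P \<Longrightarrow> (\<integral>\<^sup>+y. indicator (cylinder \<alpha> w) y * ennreal (exp (- log_fibre_prob_sum (length w) y)) \<partial>\<mu>) \<le> 1"
proof (induction w)
  case Nil
  then show ?case using emeasure_space_1 by (simp add: log_fibre_prob_sum_def)
next
  case (Cons B w)
  have B: "B \<in> P" and wP: "set w \<subseteq> P" using Cons.prems by auto
  have [measurable]: "cylinder \<alpha> w \<in> sets borel" using cylinder_borel[of w "length w"] wP by (simp add: words_def)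
  \<comment> \<open>This vanishes at every cell but B, so the sum over P keeps only the term of the
    first letter.\<close>
  define f where "f C x = (if C = B then indicator (cylinder \<alpha> w) x * ennreal (exp (- log_fibre_prob_sum (length w) x)) else 0)" for C x
  have [measurable]: "f C \<in> borel_measurable borel" for C unfolding f_def by measurable
  have "(\<integral>\<^sup>+y. indicator (cylinder \<alpha> (B # w)) y * ennreal (exp (- log_fibre_prob_sum (length (B # w)) y)) \<partial>\<mu>)
      = (\<integral>\<^sup>+y. f (cell y) (\<alpha> y) * ennreal (1 / fibre_prob y) \<partial>\<mu>)"
  proof (rule nn_integral_cong)
    fix y
    have e1: "exp (- log_fibre_prob_sum (length (B # w)) y) = exp (- log_fibre_prob_sum (length w) (\<alpha> y)) * (1 / fibre_prob y)"
      using fibre_prob_pos[of y]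
      by (simp add: log_fibre_prob_sum_def sum_funpow_Suc[of "\<lambda>z. ln (fibre_prob z)"] exp_diff exp_minus field_simps exp_add
          del: sum.lessThan_Suc)
    have *: "ennreal (exp (- log_fibre_prob_sum (length (B # w)) y)) =
        ennreal (exp (- log_fibre_prob_sum (length w) (\<alpha> y))) * ennreal (1 / fibre_prob y)"
      unfolding e1 by (rule ennreal_mult) (use fibre_prob_pos[of y] in auto)
    have "cell y = B \<longleftrightarrow> y \<in> B" using cell_eq[OF B, of y] cell(2)[of y] by auto
    then show "indicator (cylinder \<alpha> (B # w)) y * ennreal (exp (- log_fibre_prob_sum (length (B # w)) y))
        = f (cell y) (\<alpha> y) * ennreal (1 / fibre_prob y)"
      unfolding * f_def by (auto simp: indicator_def)
  qed
  also have "\<dots> \<le> (\<integral>\<^sup>+x. (\<Sum>C\<in>P. f C x) \<partial>\<mu>)" by (rule nn_integral_div_fibre_prob) measurable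
  also have "\<dots> = (\<integral>\<^sup>+x. indicator (cylinder \<alpha> w) x * ennreal (exp (- log_fibre_prob_sum (length w) x)) \<partial>\<mu>)"
    using B fin by (simp add: f_def)
  also have "\<dots> \<le> 1" by (rule Cons.IH[OF wP])
  finally show ?case .
qed

lemma sum_words_indicator:
  assumes "u \<in> words P n" "y \<in> cylinder \<alpha> u"
  shows "(\<Sum>w\<in>words P n. indicat_real (cylinder \<alpha> w) y * f w) = f u"
proof -
  have "(\<Sum>w\<in>words P n. indicat_real (cylinder \<alpha> w) y * f w) = (\<Sum>w\<in>words P n. if w = u then f w else 0)"
  proof (intro sum.cong refl)
    fix w assume w: "w \<in> words P n"
    show "indicat_real (cylinder \<alpha> w) y * f w = (if w = u then f w else 0)"
    proof (cases "w = u")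
      case False
      then have "y \<notin> cylinder \<alpha> w" using cylinder_unique[OF w assms(1) _ assms(2)] by metis
      then show ?thesis using False by simp
    qed (use assms in simp)
  qed
  then show ?thesis using assms finite_words[OF fin] by simp
qed

lemma integral_words:
  "(\<integral>y. (\<Sum>w\<in>words P n. indicat_real (cylinder \<alpha> w) y * f w) \<partial>\<mu>) = (\<Sum>w\<in>words P n. measure \<mu> (cylinder \<alpha> w) * f w)"
  "integrable \<mu> (\<lambda>y. \<Sum>w\<in>words P n. indicat_real (cylinder \<alpha> w) y * f w)"
proof -
  have 1: "integrable \<mu> (\<lambda>y. indicat_real (cylinder \<alpha> w) y * f w)" if "w \<in> words P n" for w
    using cylinder_borel[OF that] by (intro integrable_mult_left integrable_real_indicator) (auto simp: emeasure_eq_measure)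
  then show "integrable \<mu> (\<lambda>y. \<Sum>w\<in>words P n. indicat_real (cylinder \<alpha> w) y * f w)"
    by (rule Bochner_Integration.integrable_sum)
  show "(\<integral>y. (\<Sum>w\<in>words P n. indicat_real (cylinder \<alpha> w) y * f w) \<partial>\<mu>) = (\<Sum>w\<in>words P n. measure \<mu> (cylinder \<alpha> w) * f w)"
    using 1 by (subst Bochner_Integration.integral_sum) (auto intro!: sum.cong simp: cylinder_borel)
qed

text \<open>ln t \<le> t - 1 is applied to the measure of the cylinder of y divided by the product
  of p along its orbit. By \<open>nn_integral_cylinder_fibre_prob\<close> this quotient has integral
  at most 1, so the integral of its logarithm is at most 0.\<close>

lemma fibre_entropy_le_block_entropy: "real n * fibre_entropy \<le> block_entropy n"
proof -
  define c where "c w = measure \<mu> (cylinder \<alpha> w)" for w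
  define D where "D y = exp (- log_fibre_prob_sum n y)" for y
  have [measurable]: "D \<in> borel_measurable borel" unfolding D_def by measurable
  have iJ: "integrable \<mu> (log_fibre_prob_sum n)" "(\<integral>y. log_fibre_prob_sum n y \<partial>\<mu>) = - real n * fibre_entropy"
    using integral_birkhoff[OF _ integrable_ln_fibre_prob, of n] by (simp_all add: log_fibre_prob_sum_def[abs_def] fibre_entropy_def)
  have iD: "integrable \<mu> (\<lambda>y. indicat_real (cylinder \<alpha> w) y * D y)"
    "(\<integral>y. indicat_real (cylinder \<alpha> w) y * D y \<partial>\<mu>) \<le> 1" if w: "w \<in> words P n" for w
  proof -
    have [measurable]: "cylinder \<alpha> w \<in> sets borel" by (rule cylinder_borel[OF w])
    have *: "(\<integral>\<^sup>+y. ennreal (indicat_real (cylinder \<alpha> w) y * D y) \<partial>\<mu>) \<le> 1"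
      using nn_integral_cylinder_fibre_prob[of w] w
      by (simp add: words_def D_def ennreal_mult ennreal_indicator)
    show i: "integrable \<mu> (\<lambda>y. indicat_real (cylinder \<alpha> w) y * D y)"
    proof (rule integrableI_bounded)
      have "(\<integral>\<^sup>+y. ennreal (norm (indicat_real (cylinder \<alpha> w) y * D y)) \<partial>\<mu>) \<le> 1"
        using * by (simp add: D_def)
      then show "(\<integral>\<^sup>+y. ennreal (norm (indicat_real (cylinder \<alpha> w) y * D y)) \<partial>\<mu>) < \<infinity>"
        by (rule order_le_less_trans) simp
    qed measurable
    have "ennreal (\<integral>y. indicat_real (cylinder \<alpha> w) y * D y \<partial>\<mu>) \<le> ennreal 1"
      using * by (subst nn_integral_eq_integral[OF i, symmetric]) (auto simp: D_def)
    then show "(\<integral>y. indicat_real (cylinder \<alpha> w) y * D y \<partial>\<mu>) \<le> 1" by (simp add: ennreal_le_iff2)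
  qed
  \<comment> \<open>Null cylinders are discarded, so that the logarithm gets a positive
    argument.\<close>
  have pos: "AE y in \<mu>. \<forall>w\<in>words P n. y \<in> cylinder \<alpha> w \<longrightarrow> 0 < c w"
  proof (rule AE_finite_allI[OF finite_words[OF fin]])
    fix w assume w: "w \<in> words P n"
    show "AE y in \<mu>. y \<in> cylinder \<alpha> w \<longrightarrow> 0 < c w"
    proof (cases "c w = 0")
      case True
      then have "cylinder \<alpha> w \<in> null_sets \<mu>"
        using cylinder_borel[OF w] by (auto simp: c_def null_sets_def emeasure_eq_measure)
      then show ?thesis by (rule AE_I') auto
    next
      case False
      then show ?thesis by (auto simp: c_def zero_less_measure_iff)
    qed
  qed
  have "(\<integral>y. (\<Sum>w\<in>words P n. indicat_real (cylinder \<alpha> w) y * ln (c w)) - log_fibre_prob_sum n y \<partial>\<mu>)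
      \<le> (\<integral>y. (\<Sum>w\<in>words P n. c w * (indicat_real (cylinder \<alpha> w) y * D y)) - 1 \<partial>\<mu>)"
  proof (rule integral_mono_AE)
    show "AE y in \<mu>. (\<Sum>w\<in>words P n. indicat_real (cylinder \<alpha> w) y * ln (c w)) - log_fibre_prob_sum n y
        \<le> (\<Sum>w\<in>words P n. c w * (indicat_real (cylinder \<alpha> w) y * D y)) - 1"
      using pos
    proof eventually_elim
      case (elim y)
      obtain u where u: "u \<in> words P n" "y \<in> cylinder \<alpha> u" using cylinder_exists by blast
      then have cu: "0 < c u" using elim by blast
      have "ln (c u * D y) \<le> c u * D y - 1"
        using cu by (intro ln_le_minus_one) (simp add: D_def)
      moreover have "ln (c u * D y) = ln (c u) - log_fibre_prob_sum n y"
        using cu by (simp add: D_def ln_mult)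
      moreover have "(\<Sum>w\<in>words P n. c w * (indicat_real (cylinder \<alpha> w) y * D y)) = c u * D y"
        using sum_words_indicator[OF u, of "\<lambda>w. c w * D y"] by (simp add: ac_simps)
      ultimately show ?case using sum_words_indicator[OF u, of "\<lambda>w. ln (c w)"] by simp
    qed
  qed (use iJ integral_words(2) iD in \<open>auto intro!: Bochner_Integration.integrable_diff\<close>)
  also have "(\<integral>y. (\<Sum>w\<in>words P n. c w * (indicat_real (cylinder \<alpha> w) y * D y)) - 1 \<partial>\<mu>)
      = (\<Sum>w\<in>words P n. c w * (\<integral>y. indicat_real (cylinder \<alpha> w) y * D y \<partial>\<mu>)) - 1"
    using iD by simp
  also have "\<dots> \<le> (\<Sum>w\<in>words P n. c w * 1) - 1"
    using iD by (intro diff_right_mono sum_mono mult_left_mono) (auto simp: c_def)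
  also have "\<dots> = 0" using sum_words_measure[of n] by (simp add: c_def)
  also have "(\<integral>y. (\<Sum>w\<in>words P n. indicat_real (cylinder \<alpha> w) y * ln (c w)) - log_fibre_prob_sum n y \<partial>\<mu>)
      = - block_entropy n + real n * fibre_entropy"
    using integral_words(1)[where n=n and f="\<lambda>w. ln (c w)"] iJ(2)
    by (subst Bochner_Integration.integral_diff[OF integral_words(2) iJ(1)]) (simp add: block_entropy_def c_def)
  finally show ?thesis by simp
qed

lemma fibre_entropy_le_entropy_rate: "fibre_entropy \<le> entropy_rate"
proof (rule LIMSEQ_le_const[OF entropy_rate], intro exI allI impI)
  fix n :: nat assume "1 \<le> n"
  then show "fibre_entropy \<le> block_entropy n / real n"
    using fibre_entropy_le_block_entropy[of n] by (simp add: field_simps)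
qed

text \<open>Conditional weights are merely measurable, but evaluating them at a nearby point instead
  of the true one requires continuity. The price \<epsilon> is the excess of the cross entropy over
  \<open>fibre_entropy\<close>.\<close>

lemma continuous_weights_approx:
  assumes "compact (UNIV :: 'a set)" and "0 < \<epsilon>"
  obtains v :: "'a set \<Rightarrow> 'a \<Rightarrow> real" where "\<And>B. B \<in> P \<Longrightarrow> continuous_on UNIV (v B)" "\<And>B x. B \<in> P \<Longrightarrow> 0 < v B x"
    "\<And>x. (\<Sum>B\<in>P. v B x) = 1" "integrable \<mu> (\<lambda>y. ln (v (cell y) (\<alpha> y)))"
    "- (\<integral>y. ln (v (cell y) (\<alpha> y)) \<partial>\<mu>) \<le> fibre_entropy + \<epsilon>"
proof -
  define m where "m = real (card P)"
  have m: "0 < m" using card_P by (simp add: m_def)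
  \<comment> \<open>\<eta> is a floor added to the approximations u, and \<eta>^2 is their L1 error,
    so the error divided by the floor is \<eta> per cell. Three errors of at most m * \<eta> arise
    below, whence \<epsilon> / (3 * m); \<eta> \<le> 1 gives \<eta>^2 \<le> \<eta>.\<close>
  define \<eta> where "\<eta> = min 1 (\<epsilon> / (3 * m))"
  have \<eta>: "0 < \<eta>" "\<eta> \<le> 1" "3 * m * \<eta> \<le> \<epsilon>"
    using m \<open>0 < \<epsilon>\<close> by (auto simp: \<eta>_def min_def field_simps)
  have "\<exists>u. B \<in> P \<longrightarrow> continuous_on UNIV u \<and> (\<forall>x. 0 \<le> u x) \<and> (\<forall>x. u x \<le> 1) \<and> (\<integral>x. \<bar>u x - weight B x\<bar> \<partial>\<mu>) < \<eta> ^ 2" for B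
  proof (cases "B \<in> P")
    case True
    have e2: "0 < \<eta> ^ 2" using \<eta> by simp
    obtain u where "continuous_on UNIV u" "\<And>x. 0 \<le> u x" "\<And>x. u x \<le> 1" "(\<integral>x. \<bar>u x - weight B x\<bar> \<partial>\<mu>) < \<eta> ^ 2"
      by (rule continuous_L1_approx[OF finite_measure_axioms sets_mu assms(1) weight_measurable[OF True] weight_nonneg[OF True] weight_le_1[OF True] e2]) blast
    then show ?thesis by blast
  qed simp
  then obtain u where u: "\<And>B. B \<in> P \<Longrightarrow> continuous_on UNIV (u B)" "\<And>B x. B \<in> P \<Longrightarrow> 0 \<le> u B x"
    "\<And>B x. B \<in> P \<Longrightarrow> u B x \<le> 1" "\<And>B. B \<in> P \<Longrightarrow> (\<integral>x. \<bar>u B x - weight B x\<bar> \<partial>\<mu>) < \<eta> ^ 2" by metis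
  define S where "S x = (\<Sum>B\<in>P. u B x + \<eta>)" for x
  have Sc: "continuous_on UNIV S" unfolding S_def by (intro continuous_intros u)
  have Spos: "0 < S x" for x
    unfolding S_def using fin P_nonempty u \<eta> by (intro sum_pos add_nonneg_pos) auto
  define v where "v B x = (u B x + \<eta>) / S x" for B x
  have vc: "continuous_on UNIV (v B)" if "B \<in> P" for B
    unfolding v_def using Spos u that Sc by (intro continuous_intros) (auto simp: less_imp_neq[symmetric])
  have vpos: "0 < v B x" if "B \<in> P" for B x
    unfolding v_def using Spos[of x] u(2)[OF that, of x] \<eta> by auto
  have vsum: "(\<Sum>B\<in>P. v B x) = 1" for x
    unfolding v_def using Spos[of x] by (simp add: S_def flip: sum_divide_distrib)
  have um [measurable]: "u B \<in> borel_measurable borel" if "B \<in> P" for B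
    using u(1)[OF that] by (rule borel_measurable_continuous_onI)
  have Sm [measurable]: "S \<in> borel_measurable borel" unfolding S_def by measurable
  have iw: "integrable \<mu> (\<lambda>x. \<bar>u B x - weight B x\<bar>)" "integrable \<mu> (weight B)" "integrable \<mu> (u B)" if B: "B \<in> P" for B
  proof -
    have [measurable]: "u B \<in> borel_measurable borel" "weight B \<in> borel_measurable borel" using B by auto
    show 1: "integrable \<mu> (weight B)"
      by (rule integrable_const_bound[where B=1]) (use weight_le_1[OF B] weight_nonneg[OF B] in auto)
    show 2: "integrable \<mu> (u B)"
      by (rule integrable_const_bound[where B=1]) (use u(2,3)[OF B] in auto)
    show "integrable \<mu> (\<lambda>x. \<bar>u B x - weight B x\<bar>)" using 1 2 by simp
  qed
  have iS: "integrable \<mu> S" unfolding S_def using iw by simp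
  define g where "g x = (\<Sum>B\<in>P. \<bar>u B x - weight B x\<bar>)" for x
  have gm [measurable]: "g \<in> borel_measurable borel" unfolding g_def by measurable
  have ig: "integrable \<mu> g" unfolding g_def using iw by simp
  have g_le: "(\<integral>x. g x \<partial>\<mu>) \<le> m * \<eta> ^ 2"
  proof -
    have "(\<integral>x. g x \<partial>\<mu>) = (\<Sum>B\<in>P. \<integral>x. \<bar>u B x - weight B x\<bar> \<partial>\<mu>)"
      unfolding g_def using iw by simp
    also have "\<dots> \<le> (\<Sum>B\<in>P. \<eta> ^ 2)" using u by (intro sum_mono) (auto intro: less_imp_le)
    finally show ?thesis by (simp add: m_def)
  qed
  have S_le: "S x \<le> 1 + g x + m * \<eta>" for x
  proof -
    have "S x = (\<Sum>B\<in>P. u B x) + m * \<eta>" by (simp add: S_def sum.distrib m_def)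
    also have "(\<Sum>B\<in>P. u B x) \<le> (\<Sum>B\<in>P. weight B x + \<bar>u B x - weight B x\<bar>)" by (intro sum_mono) auto
    also have "\<dots> = 1 + g x" by (simp add: sum.distrib weight_sum g_def)
    finally show ?thesis by simp
  qed
  \<comment> \<open>The quotient by \<eta> comes from replacing the weight by u above the floor, the
    last bracket from the normalisation, as ln S \<le> S - 1.\<close>
  have pt: "AE y in \<mu>. - ln (v (cell y) (\<alpha> y)) \<le> - ln (fibre_prob y) + g (\<alpha> y) / \<eta> + (g (\<alpha> y) + m * \<eta>)"
    using AE_fibre_prob
  proof eventually_elim
    case (elim y)
    let ?B = "cell y" and ?x = "\<alpha> y"
    have B: "?B \<in> P" by (rule cell)
    have "\<bar>u ?B ?x - weight ?B ?x\<bar> \<le> g ?x"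
      unfolding g_def by (rule member_le_sum[OF B]) (use fin in auto)
    then have *: "weight ?B ?x \<le> u ?B ?x + g ?x" by linarith
    let ?a = "u ?B ?x + \<eta>" and ?b = "weight ?B ?x + \<eta>"
    have pos: "0 < ?a" "0 < ?b" "\<eta> \<le> ?a" using u(2)[OF B, of ?x] weight_nonneg[OF B, of ?x] \<eta> by auto
    have "ln (?b / ?a) \<le> ?b / ?a - 1" using pos by (intro ln_le_minus_one) auto
    also have "?b / ?a - 1 = (weight ?B ?x - u ?B ?x) / ?a" using pos by (simp add: field_simps)
    also have "\<dots> \<le> g ?x / ?a" using * pos by (intro divide_right_mono) auto
    also have "\<dots> \<le> g ?x / \<eta>" using pos \<eta> by (intro divide_left_mono) (auto simp: g_def intro!: sum_nonneg)
    finally have 1: "- ln ?a \<le> - ln ?b + g ?x / \<eta>" using pos by (simp add: ln_div)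
    have 2: "ln (fibre_prob y) \<le> ln ?b" using elim fibre_prob_pos[of y] \<eta> by (intro ln_mono) auto
    have 3: "ln (S ?x) \<le> g ?x + m * \<eta>" using ln_le_minus_one[OF Spos, of ?x] S_le[of ?x] by simp
    have "- ln (v ?B ?x) = - ln ?a + ln (S ?x)" using pos Spos[of ?x] by (simp add: v_def ln_div)
    then show ?case using 1 2 3 by linarith
  qed
  have vm [measurable]: "(\<lambda>y. ln (v (cell y) (\<alpha> y))) \<in> borel_measurable borel"
    by (rule cell_measurable) (unfold v_def, measurable)
  have rhs: "integrable \<mu> (\<lambda>y. - ln (fibre_prob y) + g (\<alpha> y) / \<eta> + (g (\<alpha> y) + m * \<eta>))"
    using integrable_ln_fibre_prob ig by (auto simp: integrable_comp_iff)
  have v_le_1: "v B x \<le> 1" if "B \<in> P" for B x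
    unfolding vsum[of x, symmetric] by (rule member_le_sum) (use that fin vpos in \<open>auto intro: less_imp_le\<close>)
  have iv: "integrable \<mu> (\<lambda>y. ln (v (cell y) (\<alpha> y)))"
  proof (rule Bochner_Integration.integrable_bound[OF rhs])
    show "AE y in \<mu>. norm (ln (v (cell y) (\<alpha> y))) \<le> norm (- ln (fibre_prob y) + g (\<alpha> y) / \<eta> + (g (\<alpha> y) + m * \<eta>))"
      using pt
    proof eventually_elim
      case (elim y)
      have "ln (v (cell y) (\<alpha> y)) \<le> 0" using v_le_1 vpos cell by auto
      then show ?case using elim by simp
    qed
  qed (rule borel_measurable_if_sets_borel, auto)
  have "- (\<integral>y. ln (v (cell y) (\<alpha> y)) \<partial>\<mu>) = (\<integral>y. - ln (v (cell y) (\<alpha> y)) \<partial>\<mu>)" by simp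
  also have "\<dots> \<le> (\<integral>y. - ln (fibre_prob y) + g (\<alpha> y) / \<eta> + (g (\<alpha> y) + m * \<eta>) \<partial>\<mu>)"
    using pt rhs iv by (intro integral_mono_AE) auto
  also have "\<dots> = fibre_entropy + (\<integral>x. g x \<partial>\<mu>) / \<eta> + ((\<integral>x. g x \<partial>\<mu>) + m * \<eta>)"
    using integrable_ln_fibre_prob ig by (simp add: integrable_comp_iff integral_comp fibre_entropy_def)
  also have "\<dots> \<le> fibre_entropy + m * \<eta> + (m * \<eta> + m * \<eta>)"
  proof -
    have "(\<integral>x. g x \<partial>\<mu>) / \<eta> \<le> m * \<eta> ^ 2 / \<eta>" using g_le \<eta> by (intro divide_right_mono) auto
    also have "\<dots> = m * \<eta>" using \<eta> by (simp add: power2_eq_square)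
    finally have "(\<integral>x. g x \<partial>\<mu>) / \<eta> \<le> m * \<eta>" .
    moreover have "m * \<eta> ^ 2 \<le> m * \<eta>" using \<eta> m by (simp add: power2_eq_square)
    ultimately show ?thesis using g_le by linarith
  qed
  also have "\<dots> \<le> fibre_entropy + \<epsilon>" using \<eta>(3) by linarith
  finally show ?thesis using that[of v] vc vpos vsum iv by blast
qed

end

section \<open>Non-contracting systems\<close>

lemma compact_ball_cover:
  assumes "compact (UNIV :: 'a::metric_space set)" "0 < e"
  shows "\<exists>Z. finite Z \<and> UNIV \<subseteq> (\<Union>z\<in>Z. ball (z :: 'a) e)"
proof -
  have "\<forall>e>0. \<exists>Z :: 'a set. finite Z \<and> UNIV \<subseteq> (\<Union>z\<in>Z. ball z e)"
    using assms(1) unfolding compact_eq_totally_bounded by (rule conjunct2)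
  then show ?thesis using assms(2) by simp
qed

locale non_contracting_system = invariant_measure +
  fixes Y :: "'a::metric_space set" and r :: real
  assumes compact_univ: "compact (UNIV :: 'a set)" and closed_Y: "closed Y" and image_Y: "\<alpha> ` Y \<subseteq> Y"
    and null_compl_Y: "emeasure \<mu> (- Y) = 0"
    and r_pos: "0 < r" and non_contracting: "\<And>x y. x \<in> Y \<Longrightarrow> y \<in> Y \<Longrightarrow> dist x y \<le> r \<Longrightarrow> dist x y \<le> dist (\<alpha> x) (\<alpha> y)"
begin

lemma Y_borel [measurable]: "Y \<in> sets borel"
  using closed_Y by (rule borel_closed)

lemma AE_Y: "AE y in \<mu>. y \<in> Y"
  by (rule AE_I'[of "- Y"]) (use null_compl_Y in \<open>auto simp: null_sets_def\<close>)

lemma alpha_in_Y: "y \<in> Y \<Longrightarrow> \<alpha> y \<in> Y"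
  using image_Y by blast

end

locale fine_partition = invariant_partition \<alpha> \<mu> P + non_contracting_system \<alpha> \<mu> Y r
  for \<alpha> :: "'a::metric_space \<Rightarrow> 'a" and \<mu> P Y r +
  assumes fine: "\<And>B y y'. B \<in> P \<Longrightarrow> y \<in> B \<inter> Y \<Longrightarrow> y' \<in> B \<inter> Y \<Longrightarrow> dist y y' \<le> r"
begin

lemma fibre_inj: "B \<in> P \<Longrightarrow> y \<in> B \<inter> Y \<Longrightarrow> y' \<in> B \<inter> Y \<Longrightarrow> \<alpha> y = \<alpha> y' \<Longrightarrow> y = y'"
  using non_contracting[of y y'] fine[of B y y'] by simp

lemma cylinder_shrink:
  assumes "set w \<subseteq> P" "y \<in> cylinder \<alpha> w \<inter> Y" "y' \<in> cylinder \<alpha> w \<inter> Y"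
  shows "dist y y' \<le> dist ((\<alpha> ^^ length w) y) ((\<alpha> ^^ length w) y')"
  using assms
proof (induction w arbitrary: y y')
  case (Cons B w)
  have "dist y y' \<le> dist (\<alpha> y) (\<alpha> y')"
    using Cons.prems by (intro non_contracting fine[of B]) auto
  also have "\<dots> \<le> dist ((\<alpha> ^^ length w) (\<alpha> y)) ((\<alpha> ^^ length w) (\<alpha> y'))"
    using Cons.prems by (intro Cons.IH) (auto intro: alpha_in_Y)
  finally show ?case by (simp add: funpow_swap1)
qed simp

text \<open>Inverse branches only shrink, so all the conditional weights along a word can be evaluated at points
  that are chosen once for each word and each small ball \<open>q\<close>.\<close>

primrec word_weight :: "('a set \<Rightarrow> 'a \<Rightarrow> real) \<Rightarrow> 'a set \<Rightarrow> 'a set list \<Rightarrow> real" where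
  "word_weight v q [] = 1"
| "word_weight v q (B # w) =
     v B (SOME y. y \<in> cylinder \<alpha> w \<inter> Y \<and> (\<alpha> ^^ length w) y \<in> q) * word_weight v q w"

text \<open>The evaluation point in \<open>word_weight\<close> depends on the tail w and on q but
  not on the letter B, so summing over B first gives 1. If no point of the required kind exists,
  \<open>SOME\<close> yields an arbitrary one, which is harmless as v sums to 1 at every
  point.\<close>

lemma sum_word_weight:
  assumes "\<And>x. (\<Sum>B\<in>P. v B x) = 1"
  shows "(\<Sum>w\<in>words P n. word_weight v q w) = 1"
proof (induction n)
  case (Suc n)
  have "(\<Sum>w\<in>words P (Suc n). word_weight v q w)
      = (\<Sum>w\<in>words P n. \<Sum>B\<in>P. v B (SOME y. y \<in> cylinder \<alpha> w \<inter> Y \<and> (\<alpha> ^^ length w) y \<in> q) * word_weight v q w)"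
    unfolding sum_words_Suc by (subst sum.swap) simp
  also have "\<dots> = (\<Sum>w\<in>words P n. word_weight v q w)"
    by (simp add: assms flip: sum_distrib_right)
  finally show ?case using Suc by simp
qed simp

lemma word_weight_pos:
  assumes "\<And>B x. B \<in> P \<Longrightarrow> 0 < v B x" "set w \<subseteq> P"
  shows "0 < word_weight v q w"
  using assms(2) by (induction w) (auto intro!: mult_pos_pos assms(1))

text \<open>\<alpha> y and the evaluation point lie in the same cylinder and both end in q, so by
  \<open>cylinder_shrink\<close> they are closer than \<delta>. Each letter therefore costs at most
  \<epsilon>.\<close>

lemma word_weight_ge:
  assumes v: "\<And>B x. B \<in> P \<Longrightarrow> 0 < v B x"
    and osc: "\<And>B x x'. B \<in> P \<Longrightarrow> dist x x' < \<delta> \<Longrightarrow> ln (v B x) \<le> ln (v B x') + \<epsilon>"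
    and q: "\<And>x x'. x \<in> q \<Longrightarrow> x' \<in> q \<Longrightarrow> dist x x' < \<delta>"
  shows "set w \<subseteq> P \<Longrightarrow> y \<in> cylinder \<alpha> w \<inter> Y \<Longrightarrow> (\<alpha> ^^ length w) y \<in> q \<Longrightarrow>
    (\<Sum>k<length w. ln (v (cell ((\<alpha> ^^ k) y)) (\<alpha> ((\<alpha> ^^ k) y)))) \<le> ln (word_weight v q w) + real (length w) * \<epsilon>"
proof (induction w arbitrary: y)
  case (Cons B w)
  define x where "x = (SOME y. y \<in> cylinder \<alpha> w \<inter> Y \<and> (\<alpha> ^^ length w) y \<in> q)"
  have B: "B \<in> P" "set w \<subseteq> P" using Cons.prems by auto
  have \<alpha>y: "\<alpha> y \<in> cylinder \<alpha> w \<inter> Y" "(\<alpha> ^^ length w) (\<alpha> y) \<in> q"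
    using Cons.prems by (auto simp: funpow_swap1 intro: alpha_in_Y)
  then have "\<alpha> y \<in> cylinder \<alpha> w \<inter> Y \<and> (\<alpha> ^^ length w) (\<alpha> y) \<in> q" by simp
  then have x: "x \<in> cylinder \<alpha> w \<inter> Y \<and> (\<alpha> ^^ length w) x \<in> q"
    unfolding x_def by (rule someI)
  have "dist (\<alpha> y) x \<le> dist ((\<alpha> ^^ length w) (\<alpha> y)) ((\<alpha> ^^ length w) x)"
    using B \<alpha>y x by (intro cylinder_shrink) auto
  also have "\<dots> < \<delta>" using \<alpha>y x by (intro q) auto
  finally have 1: "ln (v B (\<alpha> y)) \<le> ln (v B x) + \<epsilon>" using B by (intro osc)
  have 2: "(\<Sum>k<length w. ln (v (cell ((\<alpha> ^^ k) (\<alpha> y))) (\<alpha> ((\<alpha> ^^ k) (\<alpha> y)))))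
      \<le> ln (word_weight v q w) + real (length w) * \<epsilon>"
    by (rule Cons.IH[OF B(2) \<alpha>y])
  have "y \<in> B" using Cons.prems by auto
  then have "cell y = B" by (rule cell_eq[OF B(1)])
  then have "(\<Sum>k<length (B # w). ln (v (cell ((\<alpha> ^^ k) y)) (\<alpha> ((\<alpha> ^^ k) y))))
      = ln (v B (\<alpha> y)) + (\<Sum>k<length w. ln (v (cell ((\<alpha> ^^ k) (\<alpha> y))) (\<alpha> ((\<alpha> ^^ k) (\<alpha> y)))))"
    using sum_funpow_Suc[where g="\<lambda>z. ln (v (cell z) (\<alpha> z))" and n="length w" and y=y] by simp
  moreover have "word_weight v q (B # w) = v B x * word_weight v q w" by (simp add: x_def)
  then have "ln (word_weight v q (B # w)) = ln (v B x) + ln (word_weight v q w)"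
    using v[OF B(1), of x] word_weight_pos[of v w q, OF v B(2)] by (simp add: ln_mult)
  ultimately show ?case using 1 2 by (simp add: algebra_simps)
qed simp

lemma entropy_rate_le_fibre_entropy: "entropy_rate \<le> fibre_entropy"
proof (rule field_le_epsilon)
  fix e :: real assume "0 < e"
  \<comment> \<open>One half pays for the continuous weights, the other for their oscillation along
    the word.\<close>
  define \<epsilon> where "\<epsilon> = e / 2"
  have \<epsilon>: "0 < \<epsilon>" using \<open>0 < e\<close> by (simp add: \<epsilon>_def)
  obtain v where v: "\<And>B. B \<in> P \<Longrightarrow> continuous_on UNIV (v B)" "\<And>B x. B \<in> P \<Longrightarrow> 0 < v B x"
    "\<And>x. (\<Sum>B\<in>P. v B x) = 1" "integrable \<mu> (\<lambda>y. ln (v (cell y) (\<alpha> y)))"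
    "- (\<integral>y. ln (v (cell y) (\<alpha> y)) \<partial>\<mu>) \<le> fibre_entropy + \<epsilon>"
    using continuous_weights_approx[OF compact_univ \<epsilon>] by blast
  define V where "V y = ln (v (cell y) (\<alpha> y))" for y
  have vm [measurable]: "v B \<in> borel_measurable borel" if "B \<in> P" for B
    using v(1)[OF that] by (rule borel_measurable_continuous_onI)
  have Vm [measurable]: "V \<in> borel_measurable borel"
    unfolding V_def by (rule cell_measurable) measurable
  have "\<exists>d>0. \<forall>x x'. dist x x' < d \<longrightarrow> ln (v B x) \<le> ln (v B x') + \<epsilon>" if B: "B \<in> P" for B
  proof -
    have "continuous_on UNIV (\<lambda>x. ln (v B x))"
      using v(1,2)[OF B] by (intro continuous_intros) (auto simp: less_imp_neq[symmetric])
    then have "uniformly_continuous_on UNIV (\<lambda>x. ln (v B x))"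
      using compact_univ by (intro compact_uniformly_continuous)
    then obtain d where d: "0 < d" "\<And>x x'. dist x x' < d \<Longrightarrow> dist (ln (v B x)) (ln (v B x')) < \<epsilon>"
      unfolding uniformly_continuous_on_def using \<epsilon> by (metis UNIV_I)
    have "ln (v B x) \<le> ln (v B x') + \<epsilon>" if "dist x x' < d" for x x'
      using d(2)[OF that] by (simp add: dist_real_def)
    then show ?thesis using d(1) by blast
  qed
  then obtain d where d: "\<And>B. B \<in> P \<Longrightarrow> 0 < d B" "\<And>B x x'. B \<in> P \<Longrightarrow> dist x x' < d B \<Longrightarrow> ln (v B x) \<le> ln (v B x') + \<epsilon>"
    by metis
  define \<delta> where "\<delta> = Min (d ` P)"
  have \<delta>: "0 < \<delta>" "\<And>B x x'. B \<in> P \<Longrightarrow> dist x x' < \<delta> \<Longrightarrow> ln (v B x) \<le> ln (v B x') + \<epsilon>"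
    using d fin P_nonempty by (auto simp: \<delta>_def)
  obtain Z :: "'a set" where "finite Z \<and> UNIV \<subseteq> (\<Union>z\<in>Z. ball z (\<delta> / 2))"
    using compact_ball_cover[OF compact_univ half_gt_zero[OF \<delta>(1)]] by blast
  then have Z: "finite Z" "UNIV \<subseteq> (\<Union>z\<in>Z. ball z (\<delta> / 2))" by simp_all
  have "Z \<noteq> {}"
  proof
    assume "Z = {}"
    then show False using Z(2) by simp
  qed
  then have Zne: "0 < card Z" using Z(1) by (simp add: card_gt_0_iff)
  have q: "dist x x' < \<delta>" if "x \<in> ball z (\<delta> / 2)" "x' \<in> ball z (\<delta> / 2)" for z x x' :: 'a
    by (rule dist_triangle_half_r[of z]) (use that in auto)
  \<comment> \<open>Summing over all balls frees the weight of a word from the end point of the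
    orbit. The total mass becomes \<open>card Z\<close>, which adds one term ln (card Z), the same
    for every n.\<close>
  define s where "s w = (\<Sum>z\<in>Z. word_weight v (ball z (\<delta> / 2)) w)" for w
  have bound: "block_entropy n \<le> real n * (fibre_entropy + 2 * \<epsilon>) + ln (real (card Z))" for n
  proof -
    define c where "c w = measure \<mu> (cylinder \<alpha> w)" for w
    have ww: "0 < word_weight v q w" if "w \<in> words P n" for q w
      using that by (intro word_weight_pos v(2)) (auto simp: words_def)
    have spos: "0 < s w" if "w \<in> words P n" for w
      unfolding s_def using ww[OF that] Z Zne by (intro sum_pos) auto
    have "(\<Sum>w\<in>words P n. s w) = (\<Sum>z\<in>Z. \<Sum>w\<in>words P n. word_weight v (ball z (\<delta> / 2)) w)"
      unfolding s_def by (rule sum.swap)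
    then have ssum: "(\<Sum>w\<in>words P n. s w) \<le> real (card Z)" by (simp add: sum_word_weight[OF v(3)])
    have "block_entropy n \<le> - (\<Sum>w\<in>words P n. c w * ln (s w)) + ln (real (card Z))"
      unfolding block_entropy_def c_def
      by (rule gibbs) (use finite_words[OF fin] sum_words_measure spos ssum Zne in \<open>auto intro: less_imp_le\<close>)
    also have "(\<Sum>w\<in>words P n. c w * ln (s w)) = (\<integral>y. (\<Sum>w\<in>words P n. indicat_real (cylinder \<alpha> w) y * ln (s w)) \<partial>\<mu>)"
      unfolding c_def by (rule integral_words(1)[symmetric])
    also have "- \<dots> \<le> - (\<integral>y. (\<Sum>k<n. V ((\<alpha> ^^ k) y)) - real n * \<epsilon> \<partial>\<mu>)"
    proof (rule le_imp_neg_le, rule integral_mono_AE)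
      have iV: "integrable \<mu> V" using v(4) by (simp add: V_def[abs_def])
      show "integrable \<mu> (\<lambda>y. (\<Sum>k<n. V ((\<alpha> ^^ k) y)) - real n * \<epsilon>)"
        using integral_birkhoff(1)[OF Vm iV, of n] by simp
      show "integrable \<mu> (\<lambda>y. \<Sum>w\<in>words P n. indicat_real (cylinder \<alpha> w) y * ln (s w))"
        by (rule integral_words(2))
      show "AE y in \<mu>. (\<Sum>k<n. V ((\<alpha> ^^ k) y)) - real n * \<epsilon> \<le> (\<Sum>w\<in>words P n. indicat_real (cylinder \<alpha> w) y * ln (s w))"
        using AE_Y
      proof eventually_elim
        case (elim y)
        obtain u where u: "u \<in> words P n" "y \<in> cylinder \<alpha> u" using cylinder_exists by blast
        obtain z where z: "z \<in> Z" "(\<alpha> ^^ n) y \<in> ball z (\<delta> / 2)" using Z by blast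
        have un: "set u \<subseteq> P" "length u = n" using u by (auto simp: words_def)
        have "(\<Sum>k<length u. ln (v (cell ((\<alpha> ^^ k) y)) (\<alpha> ((\<alpha> ^^ k) y))))
            \<le> ln (word_weight v (ball z (\<delta> / 2)) u) + real (length u) * \<epsilon>"
          by (rule word_weight_ge[OF v(2) \<delta>(2) q]) (use un u elim z in auto)
        moreover have "ln (word_weight v (ball z (\<delta> / 2)) u) \<le> ln (s u)"
        proof (rule ln_mono)
          show "word_weight v (ball z (\<delta> / 2)) u \<le> s u"
            unfolding s_def by (rule member_le_sum) (use z Z ww[OF u(1)] in \<open>auto intro: less_imp_le\<close>)
        qed (use ww[OF u(1)] spos[OF u(1)] in auto)
        ultimately show ?case
          using sum_words_indicator[OF u, of "\<lambda>w. ln (s w)"] un by (simp add: V_def)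
      qed
    qed
    also have "- (\<integral>y. (\<Sum>k<n. V ((\<alpha> ^^ k) y)) - real n * \<epsilon> \<partial>\<mu>) = real n * (- (\<integral>y. V y \<partial>\<mu>)) + real n * \<epsilon>"
    proof -
      have iV: "integrable \<mu> V" using v(4) by (simp add: V_def[abs_def])
      show ?thesis using integral_birkhoff[OF Vm iV, of n] by simp
    qed
    also have "real n * (- (\<integral>y. V y \<partial>\<mu>)) \<le> real n * (fibre_entropy + \<epsilon>)"
      using v(5) by (intro mult_left_mono) (auto simp: V_def)
    finally show ?thesis by (simp add: algebra_simps)
  qed
  have "(\<lambda>n. (fibre_entropy + 2 * \<epsilon>) + ln (real (card Z)) * (1 / real n)) \<longlonglongrightarrow> (fibre_entropy + 2 * \<epsilon>) + ln (real (card Z)) * 0"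
    by (intro tendsto_intros lim_1_over_n)
  then have "entropy_rate \<le> (fibre_entropy + 2 * \<epsilon>) + ln (real (card Z)) * 0"
  proof (rule LIMSEQ_le[OF entropy_rate], intro exI allI impI)
    fix n :: nat assume "1 \<le> n"
    then show "block_entropy n / real n \<le> (fibre_entropy + 2 * \<epsilon>) + ln (real (card Z)) * (1 / real n)"
      using bound[of n] by (simp add: field_simps)
  qed
  then show "entropy_rate \<le> fibre_entropy + e" by (simp add: \<epsilon>_def)
qed

lemma entropy_rate_eq_fibre_entropy: "entropy_rate = fibre_entropy"
  using fibre_entropy_le_entropy_rate entropy_rate_le_fibre_entropy by (rule antisym[rotated])

end

text \<open>There are two instances: the measures that represent a transfer operator, and the
  counting measures on fibres within the essential set. The latter vary continuously only on that
  set, so only measurability in x is asked for.\<close>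

locale fibre_kernel =
  fixes \<alpha> :: "'a::metric_space \<Rightarrow> 'a" and \<nu> :: "'a \<Rightarrow> 'a measure" and M :: real
  assumes compact_space: "compact (UNIV :: 'a set)" and alpha_meas: "\<alpha> \<in> borel \<rightarrow>\<^sub>M borel"
    and sets_nu [measurable_cong, simp]: "\<And>x. sets (\<nu> x) = sets borel"
    and mass_nu: "\<And>x. emeasure (\<nu> x) UNIV \<le> ennreal M" and M_nonneg: "0 \<le> M"
    and AE_nu: "\<And>x. AE z in \<nu> x. \<alpha> z = x"
    and continuous_nu: "\<And>f :: 'a \<Rightarrow> real. continuous_on UNIV f \<Longrightarrow> (\<lambda>x. \<integral>z. f z \<partial>\<nu> x) \<in> borel_measurable borel"
begin

lemma space_nu [simp]: "space (\<nu> x) = UNIV"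
  using sets_eq_imp_space_eq[OF sets_nu] by simp

lemma finite_nu: "finite_measure (\<nu> x)"
  using mass_nu[of x] by (intro finite_measureI) (auto simp: top_unique)

lemma borel_nu: "f \<in> borel_measurable borel \<Longrightarrow> f \<in> borel_measurable (\<nu> x)"
  by (rule borel_measurable_if_sets_borel) auto

lemma emeasure_nu_measurable:
  assumes "E \<in> sets borel"
  shows "(\<lambda>x. emeasure (\<nu> x) E) \<in> borel_measurable borel"
proof -
  have cl: "(\<lambda>x. emeasure (\<nu> x) F) \<in> borel_measurable borel" if F: "closed F" for F
  proof -
    obtain u :: "nat \<Rightarrow> 'a \<Rightarrow> real" where u: "\<And>k. continuous_on UNIV (u k)" "\<And>k x. 0 \<le> u k x" "\<And>k x. u k x \<le> 1"
      "\<And>x. (\<lambda>k. u k x) \<longlonglongrightarrow> indicator F x"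
      using closed_indicator_approx[OF F] by blast
    have "(\<lambda>x. measure (\<nu> x) F) \<in> borel_measurable borel"
      by (rule borel_measurable_LIMSEQ_real[of borel "\<lambda>k x. \<integral>z. u k z \<partial>\<nu> x"])
        (use measure_closed_limit[OF finite_nu sets_nu F u] continuous_nu[OF u(1)] in auto)
    then show ?thesis by (simp add: finite_measure.emeasure_eq_measure[OF finite_nu])
  qed
  have "Int_stable {F :: 'a set. closed F}" by (auto simp: Int_stable_def)
  moreover have "{F :: 'a set. closed F} \<subseteq> Pow UNIV" by simp
  moreover have "E \<in> sigma_sets UNIV {F :: 'a set. closed F}"
    using assms by (simp add: borel_eq_closed)
  ultimately show ?thesis
  proof (induction rule: sigma_sets_induct_disjoint)
    case (basic F)
    then show ?case using cl by simp
  next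
    case (compl E)
    then have "E \<in> sets borel" by (simp add: borel_eq_closed)
    then have "emeasure (\<nu> x) (UNIV - E) = emeasure (\<nu> x) UNIV - emeasure (\<nu> x) E" for x
      using finite_measure.emeasure_finite[OF finite_nu]
        emeasure_compl[of E "\<nu> x"] by simp
    then show ?case using compl cl[of UNIV] by simp
  next
    case (union A)
    then have "range A \<subseteq> sets borel" by (auto simp: borel_eq_closed)
    then have "emeasure (\<nu> x) (\<Union>i. A i) = (\<Sum>i. emeasure (\<nu> x) (A i))" for x
      using \<open>disjoint_family A\<close> by (intro suminf_emeasure[symmetric]) auto
    then show ?case using union by simp
  qed simp
qed

lemma nn_integral_nu_measurable [measurable]:
  assumes "f \<in> borel_measurable borel"
  shows "(\<lambda>x. \<integral>\<^sup>+z. f z \<partial>\<nu> x) \<in> borel_measurable borel"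
  using assms
proof (induction rule: borel_measurable_induct)
  case (cong f g)
  then have "f = g" by auto
  then show ?case using cong by simp
next
  case (set E)
  then show ?case by (simp add: emeasure_nu_measurable)
next
  case (mult u c)
  then show ?case by (simp add: nn_integral_cmult borel_nu)
next
  case (add u v)
  then show ?case by (simp add: nn_integral_add borel_nu)
next
  case (seq U)
  have "(\<integral>\<^sup>+z. (SUP i. U i) z \<partial>\<nu> x) = (SUP i. \<integral>\<^sup>+z. U i z \<partial>\<nu> x)" for x
    unfolding SUP_apply using seq by (intro nn_integral_monotone_convergence_SUP borel_nu) auto
  then show ?case using seq by simp
qed

end

section \<open>Transfer along the branches of a fine partition\<close>

locale kernel_partition = fine_partition \<alpha> \<mu> P Y r + fibre_kernel \<alpha> \<nu> M
  for \<alpha> :: "'a::metric_space \<Rightarrow> 'a" and \<mu> P Y r \<nu> M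
begin

definition transfer :: "('a \<Rightarrow> ennreal) \<Rightarrow> 'a \<Rightarrow> ennreal" where
  "transfer f x = (\<integral>\<^sup>+z. f z \<partial>\<nu> x)"

lemma transfer_measurable [measurable]: "f \<in> borel_measurable borel \<Longrightarrow> transfer f \<in> borel_measurable borel"
  unfolding transfer_def by (rule nn_integral_nu_measurable)

lemma transfer_iterate_measurable [measurable]:
  "f \<in> borel_measurable borel \<Longrightarrow> (transfer ^^ n) f \<in> borel_measurable borel"
  by (induction n) auto

lemma transfer_comp:
  assumes [measurable]: "f \<in> borel_measurable borel" "g \<in> borel_measurable borel"
  shows "transfer (\<lambda>z. f z * g (\<alpha> z)) x = transfer f x * g x"
proof -
  have "transfer (\<lambda>z. f z * g (\<alpha> z)) x = (\<integral>\<^sup>+z. f z * g x \<partial>\<nu> x)"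
    unfolding transfer_def by (rule nn_integral_cong_AE) (use AE_nu[of x] in auto)
  then show ?thesis by (simp add: transfer_def nn_integral_multc borel_nu)
qed

text \<open>On \<open>Y\<close> this is the cocycle; in this form its measurability is visible.\<close>

definition branch_mass :: "'a \<Rightarrow> real" where
  "branch_mass y = measure (\<nu> (\<alpha> y)) (cell y \<inter> Y)"

lemma branch_mass_measurable [measurable]: "branch_mass \<in> borel_measurable borel"
  unfolding branch_mass_def
proof (rule cell_measurable)
  fix B assume B [measurable]: "B \<in> P"
  have "(\<lambda>x. emeasure (\<nu> x) (B \<inter> Y)) \<in> borel_measurable borel"
    by (rule emeasure_nu_measurable) measurable
  then show "(\<lambda>y. measure (\<nu> (\<alpha> y)) (B \<inter> Y)) \<in> borel_measurable borel"
    unfolding measure_def by measurable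
qed

text \<open>The measure at \<alpha> y charges only the fibre through y, and within Y the cell of y
  meets this fibre in y alone.\<close>

lemma AE_nu_cell:
  assumes "y \<in> Y" shows "AE z in \<nu> (\<alpha> y). z \<in> cell y \<inter> Y \<longleftrightarrow> z = y"
  using AE_nu[of "\<alpha> y"]
proof eventually_elim
  case (elim z)
  then show ?case using assms cell[of y] fibre_inj[of "cell y" z y] by auto
qed

lemma branch_mass_eq:
  assumes "y \<in> Y" shows "branch_mass y = measure (\<nu> (\<alpha> y)) {y}"
proof -
  have "cell y \<inter> Y \<in> sets (\<nu> (\<alpha> y))" using cell(1) by auto
  then show ?thesis
    unfolding branch_mass_def
    by (intro finite_measure.finite_measure_eq_AE[OF finite_nu]) (use AE_nu_cell[OF assms] in auto)
qed

lemma branch_mass_nonneg: "0 \<le> branch_mass y" and branch_mass_le: "branch_mass y \<le> M"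
proof -
  have "emeasure (\<nu> (\<alpha> y)) (cell y \<inter> Y) \<le> emeasure (\<nu> (\<alpha> y)) UNIV"
    by (rule emeasure_mono) auto
  also have "\<dots> \<le> ennreal M" by (rule mass_nu)
  finally show "branch_mass y \<le> M" "0 \<le> branch_mass y"
    using M_nonneg by (auto simp: branch_mass_def finite_measure.emeasure_eq_measure[OF finite_nu])
qed

lemma transfer_cell:
  assumes y: "y \<in> Y"
  shows "transfer (\<lambda>z. indicator (cell y \<inter> Y) z * f z) (\<alpha> y) = ennreal (branch_mass y) * f y"
proof -
  have "transfer (\<lambda>z. indicator (cell y \<inter> Y) z * f z) (\<alpha> y) = (\<integral>\<^sup>+z. f y * indicator {y} z \<partial>\<nu> (\<alpha> y))"
    unfolding transfer_def
  proof (rule nn_integral_cong_AE)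
    show "AE z in \<nu> (\<alpha> y). indicator (cell y \<inter> Y) z * f z = f y * indicator {y} z"
      using AE_nu_cell[OF y] by eventually_elim (use y cell(2)[of y] in \<open>auto simp: indicator_def\<close>)
  qed
  also have "\<dots> = f y * emeasure (\<nu> (\<alpha> y)) {y}" by (simp add: nn_integral_cmult_indicator)
  finally show ?thesis
    by (simp add: branch_mass_eq[OF y] finite_measure.emeasure_eq_measure[OF finite_nu] mult.commute)
qed

definition ratio :: "'a \<Rightarrow> ennreal" where
  "ratio y = ennreal (branch_mass y / fibre_prob y)"

lemma ratio_measurable [measurable]: "ratio \<in> borel_measurable borel"
  unfolding ratio_def by measurable

text \<open>In each cell the kernel sees at most one point of Y over x, with mass
  \<open>branch_mass\<close>; dividing by p turns the integral over \<mu> into a sum over cells.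
  Mass outside Y and on branches of weight 0 is dropped, hence the inequality.\<close>

lemma nn_integral_ratio_le:
  assumes [measurable]: "f \<in> borel_measurable borel"
  shows "(\<integral>\<^sup>+y. f y * ratio y \<partial>\<mu>) \<le> (\<integral>\<^sup>+x. transfer f x \<partial>\<mu>)"
proof -
  define g where "g B x = transfer (\<lambda>z. indicator (B \<inter> Y) z * f z) x" for B x
  have [measurable]: "g B \<in> borel_measurable borel" if "B \<in> P" for B
    unfolding g_def using that by (intro transfer_measurable) measurable
  have "(\<integral>\<^sup>+y. f y * ratio y \<partial>\<mu>) = (\<integral>\<^sup>+y. g (cell y) (\<alpha> y) * ennreal (1 / fibre_prob y) \<partial>\<mu>)"
  proof (rule nn_integral_cong_AE)
    show "AE y in \<mu>. f y * ratio y = g (cell y) (\<alpha> y) * ennreal (1 / fibre_prob y)"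
      using AE_Y
    proof eventually_elim
      case (elim y)
      have "ratio y = ennreal (branch_mass y) * ennreal (1 / fibre_prob y)"
        using branch_mass_nonneg[of y] fibre_prob_pos[of y] by (simp add: ratio_def flip: ennreal_mult)
      then show ?case unfolding g_def transfer_cell[OF elim] by (simp add: ac_simps)
    qed
  qed
  also have "\<dots> \<le> (\<integral>\<^sup>+x. (\<Sum>B\<in>P. g B x) \<partial>\<mu>)" by (rule nn_integral_div_fibre_prob) measurable
  also have "\<dots> \<le> (\<integral>\<^sup>+x. transfer f x \<partial>\<mu>)"
  proof (rule nn_integral_mono)
    fix x
    have "(\<Sum>B\<in>P. g B x) = (\<integral>\<^sup>+z. (\<Sum>B\<in>P. indicator (B \<inter> Y) z * f z) \<partial>\<nu> x)"
      unfolding g_def transfer_def by (rule nn_integral_sum[symmetric]) measurable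
    also have "\<dots> \<le> transfer f x"
      unfolding transfer_def
    proof (rule nn_integral_mono)
      fix z
      have "(\<Sum>B\<in>P. indicator (B \<inter> Y) z * f z) \<le> (\<Sum>B\<in>P. indicator B z * f z)"
        by (intro sum_mono mult_right_mono) (auto simp: indicator_def)
      then show "(\<Sum>B\<in>P. indicator (B \<inter> Y) z * f z) \<le> f z" by (simp add: nn_sum_indicator)
    qed
    finally show "(\<Sum>B\<in>P. g B x) \<le> transfer f x" .
  qed
  finally show ?thesis .
qed

text \<open>The products of ratios form a multiplicative cocycle, and \<open>transfer\<close> pulls
  out functions of \<alpha>, so one step can be peeled off at a time. The powers of the operator
  never need a disintegration of their own.\<close>

lemma nn_integral_ratio_iterate_le:
  "f \<in> borel_measurable borel \<Longrightarrow>
    (\<integral>\<^sup>+y. f y * (\<Prod>k<n. ratio ((\<alpha> ^^ k) y)) \<partial>\<mu>) \<le> (\<integral>\<^sup>+x. (transfer ^^ n) f x \<partial>\<mu>)"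
proof (induction n arbitrary: f)
  case (Suc n)
  have [measurable]: "f \<in> borel_measurable borel" by fact
  define R where "R y = (\<Prod>k<n. ratio ((\<alpha> ^^ k) y))" for y
  have [measurable]: "R \<in> borel_measurable borel" unfolding R_def by measurable
  have "(\<Prod>k<Suc n. ratio ((\<alpha> ^^ k) y)) = ratio y * R (\<alpha> y)" for y
    by (simp add: prod.lessThan_Suc_shift funpow_swap1 R_def del: prod.lessThan_Suc)
  then have "(\<integral>\<^sup>+y. f y * (\<Prod>k<Suc n. ratio ((\<alpha> ^^ k) y)) \<partial>\<mu>) = (\<integral>\<^sup>+y. (f y * R (\<alpha> y)) * ratio y \<partial>\<mu>)"
    by (simp add: ac_simps del: prod.lessThan_Suc)
  also have "\<dots> \<le> (\<integral>\<^sup>+x. transfer (\<lambda>y. f y * R (\<alpha> y)) x \<partial>\<mu>)" by (rule nn_integral_ratio_le) measurable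
  also have "\<dots> = (\<integral>\<^sup>+x. transfer f x * R x \<partial>\<mu>)" by (simp add: transfer_comp)
  also have "\<dots> \<le> (\<integral>\<^sup>+x. (transfer ^^ n) (transfer f) x \<partial>\<mu>)"
    unfolding R_def by (rule Suc.IH) measurable
  finally show ?case by (simp add: funpow_swap1)
qed simp

end

section \<open>Test functions and partitions of unity\<close>

text \<open>The tangent inequality ln x \<le> x - 1 at x = b * t / a. It makes a term of the
  t-entropy linear in a and b for a free parameter t, the best choice being t = a / b. For b = 0 and
  a > 0 the left side is -\<infinity>.\<close>

lemma a_eln_le:
  assumes "0 \<le> a" "0 \<le> b" "0 < t"
  shows "(if a = 0 then 0 else ereal a * eln (b / a)) \<le> ereal (- a * ln t + b * t - a)"
proof (cases "a = 0 \<or> b = 0")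
  case True
  then show ?thesis using assms by (auto simp: eln_def)
next
  case False
  then have ab: "0 < a" "0 < b" using assms by auto
  have "ln (b * t / a) \<le> b * t / a - 1" using ab assms by (intro ln_le_minus_one) auto
  then have "a * ln (b * t / a) \<le> a * (b * t / a - 1)" using ab by (intro mult_left_mono) auto
  then have "a * ln (b * t / a) \<le> b * t - a" using ab by (simp add: algebra_simps)
  moreover have "ln (b * t / a) = ln (b / a) + ln t"
    using ab assms by (simp add: ln_mult ln_div)
  ultimately have "a * ln (b / a) \<le> - a * ln t + b * t - a" by (simp add: algebra_simps)
  then show ?thesis using ab by (simp add: eln_def)
qed

text \<open>With t equal to T at a centre of each g, the bounds of \<open>a_eln_le\<close> add up to
  a Riemann sum of - m (ln T) + b T - 1, the variational expression of relative entropy with test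
  function T. A partition of unity fine enough for the moduli of continuity of T and ln T loses at
  most \<epsilon>.\<close>

lemma partition_of_unity_bound:
  fixes m b :: "('a::metric_space \<Rightarrow> real) \<Rightarrow> real"
  assumes "positive_functional m" "positive_functional b" and m1: "m (\<lambda>x. 1) = 1"
    and T: "continuous_on UNIV T" "\<And>x. 0 < T x" and "0 < \<epsilon>"
  shows "\<exists>G\<in>partitions_of_unity. (\<Sum>g\<in>G. if m g = 0 then 0 else ereal (m g) * eln (b g / m g))
     \<le> ereal (- m (\<lambda>x. ln (T x)) + b T - 1 + \<epsilon>)"
proof -
  interpret m: positive_functional m by fact
  interpret b: positive_functional b by fact
  define K where "K = b (\<lambda>x. 1)"
  have K: "0 \<le> K" unfolding K_def by (rule b.nonneg) auto
  \<comment> \<open>m has mass 1 and b has mass K, so errors \<epsilon>' in ln T and in T add up to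
    \<epsilon>.\<close>
  define \<epsilon>' where "\<epsilon>' = \<epsilon> / (1 + K)"
  have "\<epsilon>' * (1 + K) = \<epsilon>" using K by (simp add: \<epsilon>'_def)
  then have \<epsilon>': "0 < \<epsilon>'" "\<epsilon>' + \<epsilon>' * K = \<epsilon>"
    using \<open>0 < \<epsilon>\<close> K by (simp_all add: \<epsilon>'_def distrib_left)
  have lnT: "continuous_on UNIV (\<lambda>x. ln (T x))"
    using T by (intro continuous_intros) (auto simp: less_imp_neq[symmetric])
  have uc: "\<exists>d>0. \<forall>x x'. dist x x' < d \<longrightarrow> dist (f x) (f x') < \<epsilon>'" if f: "continuous_on UNIV f" for f :: "'a \<Rightarrow> real"
    using compact_uniformly_continuous[OF f m.compact_univ] \<epsilon>'(1) unfolding uniformly_continuous_on_def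
    by (metis UNIV_I dist_commute)
  obtain d1 where d1: "0 < d1" "\<And>x x'. dist x x' < d1 \<Longrightarrow> dist (T x) (T x') < \<epsilon>'"
    using uc[OF T(1)] by auto
  obtain d2 where d2: "0 < d2" "\<And>x x'. dist x x' < d2 \<Longrightarrow> dist (ln (T x)) (ln (T x')) < \<epsilon>'"
    using uc[OF lnT] by auto
  define \<delta> where "\<delta> = min d1 d2"
  have \<delta>: "0 < \<delta>" using d1 d2 by (simp add: \<delta>_def)
  obtain Z :: "'a set" where Z: "finite Z" "UNIV \<subseteq> (\<Union>z\<in>Z. ball z \<delta>)"
    using compact_ball_cover[OF m.compact_univ \<delta>] by auto
  \<comment> \<open>Partitions of unity are sets of functions. Taking the image merges equal bumps
    at once, before the normalising sum s is formed, so that division by s is injective on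
    H.\<close>
  define H where "H = (\<lambda>z x. max 0 (\<delta> - dist z x)) ` Z"
  have H: "finite H" "\<And>h. h \<in> H \<Longrightarrow> continuous_on UNIV h" "\<And>h x. h \<in> H \<Longrightarrow> 0 \<le> h x"
    using Z by (auto simp: H_def intro!: continuous_intros)
  define s where "s x = (\<Sum>h\<in>H. h x)" for x
  have s_cont: "continuous_on UNIV s" unfolding s_def by (intro continuous_intros H)
  have s_pos: "0 < s x" for x
  proof -
    have "x \<in> (\<Union>z\<in>Z. ball z \<delta>)" using Z(2) by (rule subsetD) simp
    then obtain z where z: "z \<in> Z" "dist z x < \<delta>" by auto
    define h where "h = (\<lambda>x. max 0 (\<delta> - dist z x))"
    have "h \<in> H" using z by (auto simp: H_def h_def)
    have "0 < h x" using z by (simp add: h_def)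
    also have "h x \<le> s x" unfolding s_def by (rule member_le_sum) (use \<open>h \<in> H\<close> H in auto)
    finally show ?thesis .
  qed
  define G where "G = (\<lambda>h x. h x / s x) ` H"
  have inj: "inj_on (\<lambda>h x. h x / s x) H"
  proof (rule inj_onI)
    fix h h' assume eq: "(\<lambda>x. h x / s x) = (\<lambda>x. h' x / s x)"
    show "h = h'"
    proof
      fix x show "h x = h' x" using fun_cong[OF eq, of x] s_pos[of x] by simp
    qed
  qed
  have G: "finite G" "\<And>g. g \<in> G \<Longrightarrow> continuous_on UNIV g" "\<And>g x. g \<in> G \<Longrightarrow> 0 \<le> g x"
    using H s_cont s_pos by (auto simp: G_def less_imp_neq[symmetric] intro!: continuous_intros divide_nonneg_pos)
  have G_sum: "(\<Sum>g\<in>G. g x) = 1" for x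
  proof -
    have "(\<Sum>g\<in>G. g x) = (\<Sum>h\<in>H. h x / s x)" unfolding G_def by (simp add: sum.reindex[OF inj])
    also have "\<dots> = 1" using s_pos[of x] by (simp add: s_def flip: sum_divide_distrib)
    finally show ?thesis .
  qed
  have "\<exists>z. \<forall>x. g x \<noteq> 0 \<longrightarrow> dist z x < \<delta>" if g: "g \<in> G" for g
  proof -
    obtain z where "g = (\<lambda>x. max 0 (\<delta> - dist z x) / s x)" using g by (auto simp: G_def H_def)
    then show ?thesis by (intro exI[of _ z]) (auto simp: max_def split: if_splits)
  qed
  then obtain z where z: "\<And>g x. g \<in> G \<Longrightarrow> g x \<noteq> 0 \<Longrightarrow> dist (z g) x < \<delta>" by metis
  have "(\<Sum>g\<in>G. if m g = 0 then 0 else ereal (m g) * eln (b g / m g))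
      \<le> (\<Sum>g\<in>G. ereal (- m g * ln (T (z g)) + b g * T (z g) - m g))"
    by (intro sum_mono a_eln_le m.nonneg b.nonneg G T)
  also have "\<dots> = ereal (\<Sum>g\<in>G. - m g * ln (T (z g)) + b g * T (z g) - m g)" by simp
  also have "\<dots> \<le> ereal (- m (\<lambda>x. ln (T x)) + b T - 1 + \<epsilon>)"
  proof -
    have "(\<Sum>g\<in>G. - m g * ln (T (z g))) \<le> (\<Sum>g\<in>G. m (\<lambda>x. (\<epsilon>' - ln (T x)) * g x))"
    proof (rule sum_mono)
      fix g assume g: "g \<in> G"
      have "- m g * ln (T (z g)) = m (\<lambda>x. - ln (T (z g)) * g x)"
        using m.scale[OF G(2)[OF g], of "- ln (T (z g))"] by simp
      also have "\<dots> \<le> m (\<lambda>x. (\<epsilon>' - ln (T x)) * g x)"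
      proof (rule m.mono)
        fix x
        show "- ln (T (z g)) * g x \<le> (\<epsilon>' - ln (T x)) * g x"
        proof (cases "g x = 0")
          case False
          then have "dist (z g) x < d2" using z[OF g] by (auto simp: \<delta>_def)
          then show ?thesis using d2(2) G(3)[OF g] by (intro mult_right_mono) (force simp: dist_real_def)+
        qed simp
      qed (use G g lnT in \<open>auto intro!: continuous_intros\<close>)
      finally show "- m g * ln (T (z g)) \<le> m (\<lambda>x. (\<epsilon>' - ln (T x)) * g x)" .
    qed
    also have "\<dots> = m (\<lambda>x. \<Sum>g\<in>G. (\<epsilon>' - ln (T x)) * g x)"
      by (rule m.sum[symmetric]) (use G lnT in \<open>auto intro!: continuous_intros\<close>)
    also have "\<dots> = m (\<lambda>x. \<epsilon>' - ln (T x))" by (simp add: G_sum flip: sum_distrib_left)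
    also have "\<dots> = \<epsilon>' - m (\<lambda>x. ln (T x))"
      using m.diff[OF _ lnT, of "\<lambda>_. \<epsilon>'"] m.const[of \<epsilon>'] m1 by simp
    finally have 1: "(\<Sum>g\<in>G. - m g * ln (T (z g))) \<le> \<epsilon>' - m (\<lambda>x. ln (T x))" .
    have "(\<Sum>g\<in>G. b g * T (z g)) \<le> (\<Sum>g\<in>G. b (\<lambda>x. (T x + \<epsilon>') * g x))"
    proof (rule sum_mono)
      fix g assume g: "g \<in> G"
      have "b g * T (z g) = b (\<lambda>x. T (z g) * g x)"
        using b.scale[OF G(2)[OF g], of "T (z g)"] by simp
      also have "\<dots> \<le> b (\<lambda>x. (T x + \<epsilon>') * g x)"
      proof (rule b.mono)
        fix x
        show "T (z g) * g x \<le> (T x + \<epsilon>') * g x"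
        proof (cases "g x = 0")
          case False
          then have "dist (z g) x < d1" using z[OF g] by (auto simp: \<delta>_def)
          then show ?thesis using d1(2) G(3)[OF g] by (intro mult_right_mono) (force simp: dist_real_def)+
        qed simp
      qed (use G g T in \<open>auto intro!: continuous_intros\<close>)
      finally show "b g * T (z g) \<le> b (\<lambda>x. (T x + \<epsilon>') * g x)" .
    qed
    also have "\<dots> = b (\<lambda>x. \<Sum>g\<in>G. (T x + \<epsilon>') * g x)"
      by (rule b.sum[symmetric]) (use G T in \<open>auto intro!: continuous_intros\<close>)
    also have "\<dots> = b (\<lambda>x. T x + \<epsilon>')" by (simp add: G_sum flip: sum_distrib_left)
    also have "\<dots> = b T + \<epsilon>' * K"
      using b.add[OF T(1), of "\<lambda>_. \<epsilon>'"] b.const[of \<epsilon>'] by (simp add: K_def)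
    finally have 2: "(\<Sum>g\<in>G. b g * T (z g)) \<le> b T + \<epsilon>' * K" .
    have "(\<Sum>g\<in>G. m g) = m (\<lambda>x. \<Sum>g\<in>G. g x)" by (rule m.sum[symmetric]) (rule G(2))
    then have 3: "(\<Sum>g\<in>G. m g) = 1" by (simp add: G_sum m1)
    show ?thesis using 1 2 3 \<epsilon>'(2) by (simp add: sum.distrib sum_subtractf sum_negf)
  qed
  finally show ?thesis using G G_sum by (intro bexI[of _ G]) (auto simp: partitions_of_unity_def)
qed

section \<open>Lower bound for the terms of the t-entropy\<close>

context kernel_partition
begin

lemma continuous_borel [measurable_dest]: "continuous_on UNIV f \<Longrightarrow> f \<in> borel_measurable borel" for f :: "'a \<Rightarrow> real"
  by (rule borel_measurable_continuous_onI)

lemma integrable_nu: "continuous_on UNIV f \<Longrightarrow> integrable (\<nu> x) f" for f :: "'a \<Rightarrow> real"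
  by (rule integrable_continuous_compact[OF compact_univ finite_nu sets_nu])

lemma integrable_mu: "continuous_on UNIV f \<Longrightarrow> integrable \<mu> f" for f :: "'a \<Rightarrow> real"
  by (rule integrable_continuous_compact[OF compact_univ finite_measure_axioms sets_mu])

lemma ennreal_integral_nu:
  assumes "continuous_on UNIV f" "\<And>x. 0 \<le> f x"
  shows "ennreal (\<integral>z. f z \<partial>\<nu> x) = transfer (\<lambda>z. ennreal (f z)) x"
  unfolding transfer_def using assms by (intro nn_integral_eq_integral[symmetric] integrable_nu) auto

lemma integrable_mu_nu:
  fixes f :: "'a \<Rightarrow> real"
  assumes f: "continuous_on UNIV f"
  shows "integrable \<mu> (\<lambda>x. \<integral>z. f z \<partial>\<nu> x)"
proof -
  have "compact (f ` UNIV)" using compact_univ f compact_continuous_image by blast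
  then obtain c where c: "\<And>x. norm (f x) \<le> c" using compact_imp_bounded bounded_iff by (metis rangeI)
  have c0: "0 \<le> c" using c[of undefined] by (meson norm_ge_zero order_trans)
  have "norm (\<integral>z. f z \<partial>\<nu> x) \<le> c * M" for x
  proof -
    interpret nu: finite_measure "\<nu> x" by (rule finite_nu)
    have "norm (\<integral>z. f z \<partial>\<nu> x) \<le> (\<integral>z. norm (f z) \<partial>\<nu> x)" by (rule integral_norm_bound)
    also have "\<dots> \<le> (\<integral>z. c \<partial>\<nu> x)"
      by (rule integral_mono) (use integrable_nu[OF f] c in auto)
    also have "\<dots> = c * measure (\<nu> x) UNIV" by simp
    also have "\<dots> \<le> c * M"
      using mass_nu[of x] c0 M_nonneg by (intro mult_left_mono) (auto simp: nu.emeasure_eq_measure)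
    finally show ?thesis .
  qed
  then show ?thesis
    by (intro integrable_const_bound[where B="c * M"])
      (use borel_measurable_if_sets_borel[OF continuous_nu[OF f] sets_mu] in auto)
qed

definition mean :: "('a \<Rightarrow> real) \<Rightarrow> real" where
  "mean f = (\<integral>x. (\<integral>z. f z \<partial>\<nu> x) \<partial>\<mu>)"

lemma positive_functional_mean: "positive_functional mean"
proof
  fix f g :: "'a \<Rightarrow> real" assume fg: "continuous_on UNIV f" "continuous_on UNIV g"
  show "mean (\<lambda>x. f x + g x) = mean f + mean g"
    using fg by (simp add: mean_def integrable_nu integrable_mu_nu)
next
  fix f :: "'a \<Rightarrow> real" and c assume "continuous_on UNIV f"
  then show "mean (\<lambda>x. c * f x) = c * mean f" by (simp add: mean_def)
next
  fix f :: "'a \<Rightarrow> real" assume "continuous_on UNIV f" "\<And>x. 0 \<le> f x"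
  then show "0 \<le> mean f" by (simp add: mean_def)
qed (rule compact_univ)

lemma positive_functional_mu: "positive_functional (\<lambda>f. \<integral>x. f x \<partial>\<mu>)"
  by unfold_locales (use compact_univ integrable_mu in auto)

lemma ennreal_mean:
  assumes "continuous_on UNIV f" "\<And>x. 0 \<le> f x"
  shows "ennreal (mean f) = (\<integral>\<^sup>+x. transfer (\<lambda>z. ennreal (f z)) x \<partial>\<mu>)"
  unfolding mean_def ennreal_integral_nu[OF assms, symmetric]
  using assms by (intro nn_integral_eq_integral[symmetric] integrable_mu_nu) auto

definition log_ratio :: "'a \<Rightarrow> real" where
  "log_ratio y = ln (branch_mass y) - ln (fibre_prob y)"

lemma log_ratio_measurable [measurable]: "log_ratio \<in> borel_measurable borel"
  unfolding log_ratio_def by measurable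

lemma AE_comp: "AE y in \<mu>. Q y \<Longrightarrow> AE y in \<mu>. Q (\<alpha> y)"
  by (rule AE_distrD[OF alpha_measurable_mu]) (simp only: distr_mu)

lemma AE_funpow: "AE y in \<mu>. Q y \<Longrightarrow> AE y in \<mu>. Q ((\<alpha> ^^ k) y)"
proof (induction k)
  case (Suc k)
  then show ?case using AE_comp[of "\<lambda>y. Q ((\<alpha> ^^ k) y)"] by (simp add: funpow_swap1)
qed simp

text \<open>exp of the sum of \<open>log_ratio\<close> is the product of the ratios, whose integral
  against g is at most b by \<open>nn_integral_ratio_iterate_le\<close>. Jensen's inequality for the
  probability measure g d\<mu> / a is used in tangent form, at s = b / a.\<close>

lemma jensen_term:
  fixes g :: "'a \<Rightarrow> real"
  assumes g: "g \<in> borel_measurable borel" "\<And>x. 0 \<le> g x" "\<And>x. g x \<le> 1"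
    and pos: "AE y in \<mu>. 0 < branch_mass y" and int: "integrable \<mu> (\<lambda>y. ln (branch_mass y))"
    and b: "0 \<le> b" "(\<integral>\<^sup>+x. (transfer ^^ n) (\<lambda>z. ennreal (g z)) x \<partial>\<mu>) = ennreal b"
  defines "a \<equiv> (\<integral>x. g x \<partial>\<mu>)"
  shows "integrable \<mu> (\<lambda>y. g y * (\<Sum>k<n. log_ratio ((\<alpha> ^^ k) y)))"
    "ereal (\<integral>y. g y * (\<Sum>k<n. log_ratio ((\<alpha> ^^ k) y)) \<partial>\<mu>) \<le> (if a = 0 then 0 else ereal a * eln (b / a))"
proof -
  note [measurable] = g(1)
  define L where "L y = (\<Sum>k<n. log_ratio ((\<alpha> ^^ k) y))" for y
  have [measurable]: "L \<in> borel_measurable borel" unfolding L_def by measurable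
  have ir: "integrable \<mu> log_ratio"
    unfolding log_ratio_def using int integrable_ln_fibre_prob by (rule Bochner_Integration.integrable_diff)
  have iL: "integrable \<mu> L"
    unfolding L_def by (rule integral_birkhoff(1)[OF log_ratio_measurable ir])
  have ig: "integrable \<mu> g" by (rule integrable_const_bound[where B=1]) (use g in auto)
  have a0: "0 \<le> a" unfolding a_def using g by simp
  show igL: "integrable \<mu> (\<lambda>y. g y * (\<Sum>k<n. log_ratio ((\<alpha> ^^ k) y)))"
    unfolding L_def[symmetric]
  proof (rule Bochner_Integration.integrable_bound[OF iL])
    show "AE y in \<mu>. norm (g y * L y) \<le> norm (L y)"
      using g by (intro AE_I2) (auto simp: abs_mult intro!: mult_left_le_one_le)
  qed measurable
  show "ereal (\<integral>y. g y * (\<Sum>k<n. log_ratio ((\<alpha> ^^ k) y)) \<partial>\<mu>) \<le> (if a = 0 then 0 else ereal a * eln (b / a))"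
    unfolding L_def[symmetric]
  proof (cases "a = 0")
    case True
    then have "AE y in \<mu>. g y = 0"
      unfolding a_def using g by (subst (asm) integral_nonneg_eq_0_iff_AE[OF ig]) auto
    then have "(\<integral>y. g y * L y \<partial>\<mu>) = (\<integral>y. 0 \<partial>\<mu>)"
      by (intro integral_cong_AE) (auto elim!: eventually_mono)
    then show "ereal (\<integral>y. g y * L y \<partial>\<mu>) \<le> (if a = 0 then 0 else ereal a * eln (b / a))" using True by simp
  next
    case False
    then have a: "0 < a" using a0 by simp
    have "AE y in \<mu>. \<forall>k\<in>{..<n}. 0 < branch_mass ((\<alpha> ^^ k) y)"
      by (rule AE_finite_allI) (auto intro: AE_funpow[OF pos])
    then have eq: "AE y in \<mu>. ennreal (g y * exp (L y)) = ennreal (g y) * (\<Prod>k<n. ratio ((\<alpha> ^^ k) y))"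
    proof eventually_elim
      case (elim y)
      have "exp (L y) = (\<Prod>k<n. branch_mass ((\<alpha> ^^ k) y) / fibre_prob ((\<alpha> ^^ k) y))"
        unfolding L_def exp_sum[OF finite_lessThan]
        by (intro prod.cong refl) (use elim fibre_prob_pos in \<open>simp add: log_ratio_def exp_diff\<close>)
      then have "ennreal (exp (L y)) = (\<Prod>k<n. ratio ((\<alpha> ^^ k) y))"
        using branch_mass_nonneg fibre_prob_pos by (simp add: ratio_def prod_ennreal divide_nonneg_pos)
      then show ?case using g by (simp add: ennreal_mult)
    qed
    have le: "(\<integral>\<^sup>+y. ennreal (g y * exp (L y)) \<partial>\<mu>) \<le> ennreal b"
      unfolding b(2)[symmetric] nn_integral_cong_AE[OF eq] by (rule nn_integral_ratio_iterate_le) measurable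
    have ie: "integrable \<mu> (\<lambda>y. g y * exp (L y))"
    proof (rule integrableI_bounded)
      have "(\<integral>\<^sup>+y. ennreal (norm (g y * exp (L y))) \<partial>\<mu>) \<le> ennreal b" using le g by (simp add: abs_mult)
      then show "(\<integral>\<^sup>+y. ennreal (norm (g y * exp (L y))) \<partial>\<mu>) < \<infinity>" by (rule order_le_less_trans) simp
    qed measurable
    have "ennreal (\<integral>y. g y * exp (L y) \<partial>\<mu>) \<le> ennreal b"
      using le g by (subst nn_integral_eq_integral[OF ie, symmetric]) auto
    then have ie_le: "(\<integral>y. g y * exp (L y) \<partial>\<mu>) \<le> b" using b by simp
    \<comment> \<open>exp is positive, so b = 0 would force g = 0 almost everywhere.\<close>
    have "b \<noteq> 0"
    proof
      assume "b = 0"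
      then have "(\<integral>y. g y * exp (L y) \<partial>\<mu>) = 0"
        using ie_le g by (intro antisym) auto
      then have "AE y in \<mu>. g y * exp (L y) = 0"
        using g by (subst (asm) integral_nonneg_eq_0_iff_AE[OF ie]) auto
      then have "AE y in \<mu>. g y = 0" by simp
      then have "a = 0" unfolding a_def using g by (subst integral_nonneg_eq_0_iff_AE[OF ig]) auto
      then show False using a by simp
    qed
    then have bpos: "0 < b" using b by simp
    define s where "s = b / a"
    have s: "0 < s" using a bpos by (simp add: s_def)
    have "(\<integral>y. g y * L y \<partial>\<mu>) - a * ln s = (\<integral>y. g y * L y - g y * ln s \<partial>\<mu>)"
      using igL ig unfolding L_def[symmetric] by (simp add: a_def)
    also have "\<dots> \<le> (\<integral>y. g y * exp (L y) / s - g y \<partial>\<mu>)"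
    proof (rule integral_mono)
      fix y
      have "ln (exp (L y) / s) \<le> exp (L y) / s - 1" using s by (intro ln_le_minus_one) auto
      then have "L y - ln s \<le> exp (L y) / s - 1" using s by (simp add: ln_div)
      then have "g y * (L y - ln s) \<le> g y * (exp (L y) / s - 1)" using g by (intro mult_left_mono) auto
      then show "g y * L y - g y * ln s \<le> g y * exp (L y) / s - g y" by (simp add: algebra_simps)
    qed (use igL ig ie in \<open>auto simp: L_def\<close>)
    also have "\<dots> = (\<integral>y. g y * exp (L y) \<partial>\<mu>) / s - a" using ie ig by (simp add: a_def)
    also have "\<dots> \<le> b / s - a" using ie_le s by (simp add: divide_right_mono)
    also have "\<dots> = 0" using bpos a by (simp add: s_def)
    finally show "ereal (\<integral>y. g y * L y \<partial>\<mu>) \<le> (if a = 0 then 0 else ereal a * eln (b / a))"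
      using False bpos a by (simp add: eln_def s_def)
  qed
qed

lemma lower_bound:
  assumes pos: "AE y in \<mu>. 0 < branch_mass y" and int: "integrable \<mu> (\<lambda>y. ln (branch_mass y))"
    and G: "G \<in> partitions_of_unity"
    and b: "\<And>g. g \<in> G \<Longrightarrow> 0 \<le> b g" "\<And>g. g \<in> G \<Longrightarrow> (\<integral>\<^sup>+x. (transfer ^^ n) (\<lambda>z. ennreal (g z)) x \<partial>\<mu>) = ennreal (b g)"
  shows "ereal (real n * ((\<integral>y. ln (branch_mass y) \<partial>\<mu>) + fibre_entropy))
    \<le> (\<Sum>g\<in>G. if (\<integral>x. g x \<partial>\<mu>) = 0 then 0 else ereal (\<integral>x. g x \<partial>\<mu>) * eln (b g / (\<integral>x. g x \<partial>\<mu>)))"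
proof -
  have G': "finite G" "\<And>g. g \<in> G \<Longrightarrow> continuous_on UNIV g" "\<And>g x. g \<in> G \<Longrightarrow> 0 \<le> g x" "\<And>x. (\<Sum>g\<in>G. g x) = 1"
    using G by (auto simp: partitions_of_unity_def)
  have le1: "g x \<le> 1" if "g \<in> G" for g x
    unfolding G'(4)[of x, symmetric] by (rule member_le_sum) (use that G' in auto)
  define L where "L y = (\<Sum>k<n. log_ratio ((\<alpha> ^^ k) y))" for y
  have ir: "integrable \<mu> log_ratio"
    unfolding log_ratio_def using int integrable_ln_fibre_prob by (rule Bochner_Integration.integrable_diff)
  have summand: "integrable \<mu> (\<lambda>y. g y * L y)"
    "ereal (\<integral>y. g y * L y \<partial>\<mu>) \<le> (if (\<integral>x. g x \<partial>\<mu>) = 0 then 0 else ereal (\<integral>x. g x \<partial>\<mu>) * eln (b g / (\<integral>x. g x \<partial>\<mu>)))"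
    if g: "g \<in> G" for g
    unfolding L_def
    by (rule jensen_term[OF continuous_borel[OF G'(2)[OF g]] G'(3)[OF g] le1[OF g] pos int b[OF g]])+
  have "real n * ((\<integral>y. ln (branch_mass y) \<partial>\<mu>) + fibre_entropy) = (\<integral>y. L y \<partial>\<mu>)"
    unfolding L_def integral_birkhoff(2)[OF log_ratio_measurable ir]
    using int integrable_ln_fibre_prob by (simp add: log_ratio_def[abs_def] fibre_entropy_def)
  also have "\<dots> = (\<integral>y. (\<Sum>g\<in>G. g y * L y) \<partial>\<mu>)" by (simp add: G'(4) flip: sum_distrib_right)
  also have "\<dots> = (\<Sum>g\<in>G. \<integral>y. g y * L y \<partial>\<mu>)" using summand(1) by simp
  finally have "ereal (real n * ((\<integral>y. ln (branch_mass y) \<partial>\<mu>) + fibre_entropy)) = (\<Sum>g\<in>G. ereal (\<integral>y. g y * L y \<partial>\<mu>))"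
    by simp
  also have "\<dots> \<le> (\<Sum>g\<in>G. if (\<integral>x. g x \<partial>\<mu>) = 0 then 0 else ereal (\<integral>x. g x \<partial>\<mu>) * eln (b g / (\<integral>x. g x \<partial>\<mu>)))"
    by (rule sum_mono) (rule summand(2))
  finally show ?thesis .
qed

text \<open>\<mu> plus the mean of the kernel. A single L1 approximation with respect to this sum
  controls both the integral of ln T against \<mu> and \<open>mean T\<close>.\<close>

definition joint :: "'a measure" where
  "joint = measure_of UNIV (sets borel) (\<lambda>E. emeasure \<mu> E + (\<integral>\<^sup>+x. emeasure (\<nu> x) E \<partial>\<mu>))"

lemma sets_joint [measurable_cong, simp]: "sets joint = sets borel"
  unfolding joint_def using sets.sigma_sets_eq[of borel] by (simp add: sets.space_closed[of borel, simplified])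

lemma emeasure_joint:
  assumes "E \<in> sets borel"
  shows "emeasure joint E = emeasure \<mu> E + (\<integral>\<^sup>+x. emeasure (\<nu> x) E \<partial>\<mu>)"
proof (rule emeasure_measure_of[OF joint_def])
  show "positive (sets joint) (\<lambda>E. emeasure \<mu> E + (\<integral>\<^sup>+x. emeasure (\<nu> x) E \<partial>\<mu>))"
    unfolding positive_def by simp
  show "E \<in> sets joint" using assms by simp
  show "sets borel \<subseteq> Pow UNIV" by simp
  show "countably_additive (sets joint) (\<lambda>E. emeasure \<mu> E + (\<integral>\<^sup>+x. emeasure (\<nu> x) E \<partial>\<mu>))"
  proof (rule countably_additiveI)
    fix A :: "nat \<Rightarrow> 'a set" assume A: "range A \<subseteq> sets joint" "disjoint_family A"
    then have Ab: "range A \<subseteq> sets borel" by simp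
    then have Ai: "A i \<in> sets borel" for i by blast
    have m: "(\<lambda>x. emeasure (\<nu> x) (A i)) \<in> borel_measurable \<mu>" for i
      using emeasure_nu_measurable[OF Ai] by simp
    have "(\<Sum>i. emeasure \<mu> (A i) + (\<integral>\<^sup>+x. emeasure (\<nu> x) (A i) \<partial>\<mu>))
        = (\<Sum>i. emeasure \<mu> (A i)) + (\<Sum>i. \<integral>\<^sup>+x. emeasure (\<nu> x) (A i) \<partial>\<mu>)"
      by (rule suminf_add[symmetric]) auto
    also have "(\<Sum>i. emeasure \<mu> (A i)) = emeasure \<mu> (\<Union>i. A i)"
      using Ab A(2) by (intro suminf_emeasure) auto
    also have "(\<Sum>i. \<integral>\<^sup>+x. emeasure (\<nu> x) (A i) \<partial>\<mu>) = (\<integral>\<^sup>+x. (\<Sum>i. emeasure (\<nu> x) (A i)) \<partial>\<mu>)"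
      by (rule nn_integral_suminf[symmetric]) (rule m)
    also have "\<dots> = (\<integral>\<^sup>+x. emeasure (\<nu> x) (\<Union>i. A i) \<partial>\<mu>)"
      using Ab A(2) by (intro nn_integral_cong suminf_emeasure) auto
    finally show "(\<Sum>i. emeasure \<mu> (A i) + (\<integral>\<^sup>+x. emeasure (\<nu> x) (A i) \<partial>\<mu>))
        = emeasure \<mu> (\<Union>i. A i) + (\<integral>\<^sup>+x. emeasure (\<nu> x) (\<Union>i. A i) \<partial>\<mu>)" .
  qed
qed

lemma nn_integral_joint:
  assumes "f \<in> borel_measurable borel"
  shows "(\<integral>\<^sup>+x. f x \<partial>joint) = (\<integral>\<^sup>+x. f x \<partial>\<mu>) + (\<integral>\<^sup>+x. transfer f x \<partial>\<mu>)"
  using assms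
proof (induction rule: borel_measurable_induct)
  case (cong f g)
  then have "f = g" by auto
  then show ?case using cong by simp
next
  case (set E)
  then show ?case by (simp add: emeasure_joint transfer_def)
next
  case (mult u c)
  have "transfer (\<lambda>x. c * u x) = (\<lambda>x. c * transfer u x)"
    unfolding transfer_def using mult by (simp add: nn_integral_cmult borel_nu)
  then show ?case using mult
    by (simp add: nn_integral_cmult distrib_left borel_measurable_if_sets_borel)
next
  case (add u v)
  have "transfer (\<lambda>x. v x + u x) = (\<lambda>x. transfer v x + transfer u x)"
    unfolding transfer_def using add by (simp add: nn_integral_add borel_nu)
  then show ?case using add
    by (simp add: nn_integral_add borel_measurable_if_sets_borel ac_simps)
next
  case (seq U)
  have Um: "U i \<in> borel_measurable N" if "sets N = sets borel" for N i
    by (rule borel_measurable_if_sets_borel[OF seq(1) that])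
  have 1: "transfer (SUP i. U i) x = (SUP i. transfer (U i) x)" for x
    unfolding transfer_def SUP_apply using seq by (intro nn_integral_monotone_convergence_SUP Um) auto
  have inc: "incseq (\<lambda>i. transfer (U i))"
    using seq(3) unfolding incseq_def le_fun_def transfer_def by (auto intro!: nn_integral_mono)
  have "(\<integral>\<^sup>+x. (SUP i. U i) x \<partial>joint) = (SUP i. \<integral>\<^sup>+x. U i x \<partial>joint)"
    unfolding SUP_apply using seq by (intro nn_integral_monotone_convergence_SUP Um) auto
  also have "\<dots> = (SUP i. (\<integral>\<^sup>+x. U i x \<partial>\<mu>) + (\<integral>\<^sup>+x. transfer (U i) x \<partial>\<mu>))" using seq by simp
  also have "\<dots> = (SUP i. \<integral>\<^sup>+x. U i x \<partial>\<mu>) + (SUP i. \<integral>\<^sup>+x. transfer (U i) x \<partial>\<mu>)"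
    using seq(3) inc by (intro ennreal_SUP_add) (auto simp: incseq_def le_fun_def intro!: nn_integral_mono)
  also have "(SUP i. \<integral>\<^sup>+x. U i x \<partial>\<mu>) = (\<integral>\<^sup>+x. (SUP i. U i) x \<partial>\<mu>)"
    unfolding SUP_apply using seq by (intro nn_integral_monotone_convergence_SUP[symmetric] Um) auto
  also have "(SUP i. \<integral>\<^sup>+x. transfer (U i) x \<partial>\<mu>) = (\<integral>\<^sup>+x. (SUP i. transfer (U i) x) \<partial>\<mu>)"
    using seq(1) inc by (intro nn_integral_monotone_convergence_SUP[symmetric]) auto
  finally show ?case by (simp only: 1)
qed

lemma finite_measure_joint: "finite_measure joint"
proof (rule finite_measureI)
  have "emeasure joint UNIV \<le> 1 + ennreal M"
  proof -
    have "(\<integral>\<^sup>+x. emeasure (\<nu> x) UNIV \<partial>\<mu>) \<le> (\<integral>\<^sup>+x. ennreal M \<partial>\<mu>)"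
      by (rule nn_integral_mono) (rule mass_nu)
    also have "\<dots> = ennreal M" using emeasure_space_1 by simp
    finally show ?thesis using emeasure_space_1 by (simp add: emeasure_joint add_mono)
  qed
  also have "\<dots> < \<infinity>" by simp
  finally show "emeasure joint (space joint) \<noteq> \<infinity>"
    using sets_eq_imp_space_eq[OF sets_joint] by simp
qed

end

section \<open>Test functions for the upper bound\<close>

context kernel_partition
begin

lemma integrable_ln_branch_mass_plus:
  assumes "0 < \<epsilon>" shows "integrable \<mu> (\<lambda>y. ln (branch_mass y + \<epsilon>))"
proof (rule integrable_const_bound[where B="\<bar>ln \<epsilon>\<bar> + \<bar>ln (M + \<epsilon>)\<bar>"])
  show "AE y in \<mu>. norm (ln (branch_mass y + \<epsilon>)) \<le> \<bar>ln \<epsilon>\<bar> + \<bar>ln (M + \<epsilon>)\<bar>"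
  proof (rule AE_I2)
    fix y
    have "ln \<epsilon> \<le> ln (branch_mass y + \<epsilon>)" "ln (branch_mass y + \<epsilon>) \<le> ln (M + \<epsilon>)"
      using branch_mass_nonneg[of y] branch_mass_le[of y] M_nonneg assms by (auto intro!: ln_mono)
    then show "norm (ln (branch_mass y + \<epsilon>)) \<le> \<bar>ln \<epsilon>\<bar> + \<bar>ln (M + \<epsilon>)\<bar>" by simp
  qed
qed measurable

text \<open>The ideal test function is the density of \<open>\<mu>\<close> with respect to the mean of the kernel, which is
  \<open>fibre_prob / branch_mass\<close> on \<open>Y\<close> and 0 elsewhere; \<open>\<epsilon>\<close> and a final positive constant keep logarithms finite.\<close>

lemma test_function_exists:
  assumes \<epsilon>: "0 < \<epsilon>" and e: "0 < e"
  obtains T :: "'a \<Rightarrow> real" where "continuous_on UNIV T" "\<And>x. 0 < T x"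
    "- (\<integral>x. ln (T x) \<partial>\<mu>) + mean T - 1 \<le> (\<integral>y. ln (branch_mass y + \<epsilon>) \<partial>\<mu>) + fibre_entropy + e"
proof -
  have wm [measurable]: "(\<lambda>y. weight (cell y) (\<alpha> y)) \<in> borel_measurable borel"
    by (rule cell_measurable) measurable
  \<comment> \<open>The numerator is the weight and not \<open>fibre_prob\<close>: the two agree
    almost everywhere, but the weights sum to 1 over the cells, which bounds the transfer of T0 by
    1.\<close>
  define T0 where "T0 y = (if y \<in> Y then weight (cell y) (\<alpha> y) / (branch_mass y + \<epsilon>) else 0)" for y
  have T0m [measurable]: "T0 \<in> borel_measurable borel" unfolding T0_def by measurable
  have T0_nonneg: "0 \<le> T0 y" for y
    using weight_nonneg[OF cell(1)] branch_mass_nonneg[of y] \<epsilon> by (simp add: T0_def)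
  have T0_le: "T0 y \<le> 1 / \<epsilon>" for y
    using weight_le_1[OF cell(1)] weight_nonneg[OF cell(1)] branch_mass_nonneg[of y] \<epsilon>
    by (auto simp: T0_def intro!: frac_le)
  \<comment> \<open>A cell contains at most one point of Y over x, and its mass
    \<open>branch_mass\<close> is cancelled by the denominator.\<close>
  have one_le: "transfer (\<lambda>z. indicator (B \<inter> Y) z * ennreal (1 / (branch_mass z + \<epsilon>))) x \<le> 1" if B: "B \<in> P" for B x
  proof (cases "\<exists>y\<in>B \<inter> Y. \<alpha> y = x")
    case True
    then obtain y where y: "y \<in> B" "y \<in> Y" "\<alpha> y = x" by blast
    have "cell y = B" using B y(1) by (rule cell_eq)
    then have "transfer (\<lambda>z. indicator (B \<inter> Y) z * ennreal (1 / (branch_mass z + \<epsilon>))) x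
        = ennreal (branch_mass y) * ennreal (1 / (branch_mass y + \<epsilon>))"
      using transfer_cell[OF y(2), of "\<lambda>z. ennreal (1 / (branch_mass z + \<epsilon>))"] y(3) by simp
    also have "\<dots> \<le> 1"
      using branch_mass_nonneg[of y] \<epsilon> by (simp add: ennreal_le_1 flip: ennreal_mult)
    finally show ?thesis .
  next
    case False
    have "transfer (\<lambda>z. indicator (B \<inter> Y) z * ennreal (1 / (branch_mass z + \<epsilon>))) x = (\<integral>\<^sup>+z. 0 \<partial>\<nu> x)"
      unfolding transfer_def
    proof (rule nn_integral_cong_AE)
      show "AE z in \<nu> x. indicator (B \<inter> Y) z * ennreal (1 / (branch_mass z + \<epsilon>)) = 0"
        using AE_nu[of x] by eventually_elim (use False in \<open>auto simp: indicator_def\<close>)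
    qed
    then show ?thesis by simp
  qed
  have T0_transfer: "transfer (\<lambda>z. ennreal (T0 z)) x \<le> 1" for x
  proof -
    have "transfer (\<lambda>z. ennreal (T0 z)) x
        = (\<integral>\<^sup>+z. (\<Sum>B\<in>P. ennreal (weight B x) * (indicator (B \<inter> Y) z * ennreal (1 / (branch_mass z + \<epsilon>)))) \<partial>\<nu> x)"
      unfolding transfer_def
    proof (rule nn_integral_cong_AE)
      show "AE z in \<nu> x. ennreal (T0 z) = (\<Sum>B\<in>P. ennreal (weight B x) * (indicator (B \<inter> Y) z * ennreal (1 / (branch_mass z + \<epsilon>))))"
        using AE_nu[of x]
      proof eventually_elim
        case (elim z)
        have "(\<Sum>B\<in>P. ennreal (weight B x) * (indicator (B \<inter> Y) z * ennreal (1 / (branch_mass z + \<epsilon>))))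
            = (\<Sum>B\<in>P. indicator B z * (ennreal (weight B x) * (indicator Y z * ennreal (1 / (branch_mass z + \<epsilon>)))))"
          by (intro sum.cong refl) (auto simp: indicator_def)
        also have "\<dots> = ennreal (weight (cell z) x) * (indicator Y z * ennreal (1 / (branch_mass z + \<epsilon>)))"
          by (rule nn_sum_indicator)
        also have "\<dots> = ennreal (T0 z)"
          using elim weight_nonneg[OF cell(1), of z x] branch_mass_nonneg[of z] \<epsilon>
          by (auto simp: T0_def indicator_def simp flip: ennreal_mult)
        finally show ?case by simp
      qed
    qed
    also have "\<dots> = (\<Sum>B\<in>P. ennreal (weight B x) * transfer (\<lambda>z. indicator (B \<inter> Y) z * ennreal (1 / (branch_mass z + \<epsilon>))) x)"
      unfolding transfer_def by (subst nn_integral_sum) (auto intro!: sum.cong nn_integral_cmult)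
    also have "\<dots> \<le> (\<Sum>B\<in>P. ennreal (weight B x) * 1)"
      by (intro sum_mono mult_left_mono one_le) auto
    also have "\<dots> = ennreal (\<Sum>B\<in>P. weight B x)" using weight_nonneg by (simp add: sum_ennreal)
    finally show ?thesis by (simp add: weight_sum)
  qed
  \<comment> \<open>e is spent in thirds: \<eta> * M and \<delta> are the errors in
    \<open>mean T\<close>, and \<delta> / \<eta> is the error in the integral of ln T.\<close>
  define \<eta> where "\<eta> = e / (3 * (M + 1))"
  have \<eta>: "0 < \<eta>" "\<eta> * M \<le> e / 3"
    using e M_nonneg by (auto simp: \<eta>_def field_simps)
  define \<delta> where "\<delta> = min (e / 3) (\<eta> * (e / 3))"
  have \<delta>: "0 < \<delta>" "\<delta> \<le> e / 3" "\<delta> / \<eta> \<le> e / 3"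
    using e \<eta> by (auto simp: \<delta>_def min_def field_simps)
  obtain u where u: "continuous_on UNIV u" "\<And>x. 0 \<le> u x" "\<And>x. u x \<le> 1 / \<epsilon>" "(\<integral>x. \<bar>u x - T0 x\<bar> \<partial>joint) < \<delta>"
    by (rule continuous_L1_approx[OF finite_measure_joint sets_joint compact_univ T0m T0_nonneg T0_le \<delta>(1)]) blast
  have [measurable]: "u \<in> borel_measurable borel" using u(1) by (rule borel_measurable_continuous_onI)
  define D where "D y = \<bar>u y - T0 y\<bar>" for y
  have Dm [measurable]: "D \<in> borel_measurable borel" unfolding D_def by measurable
  have D0: "0 \<le> D y" for y by (simp add: D_def)
  have D_le: "D y \<le> 1 / \<epsilon>" for y
    using u(2,3)[of y] T0_nonneg[of y] T0_le[of y] by (simp add: D_def abs_le_iff)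
  have "integrable joint D"
  proof -
    interpret j: finite_measure joint by (rule finite_measure_joint)
    show ?thesis by (rule j.integrable_const_bound[where B="1 / \<epsilon>"]) (use D0 D_le in auto)
  qed
  then have "(\<integral>\<^sup>+x. ennreal (D x) \<partial>joint) \<le> ennreal \<delta>"
    using u(4) D0 by (subst nn_integral_eq_integral) (auto simp: D_def[abs_def] intro!: ennreal_leI)
  then have D_sum: "(\<integral>\<^sup>+x. ennreal (D x) \<partial>\<mu>) + (\<integral>\<^sup>+x. transfer (\<lambda>z. ennreal (D z)) x \<partial>\<mu>) \<le> ennreal \<delta>"
    by (subst (asm) nn_integral_joint) auto
  have D_mu: "(\<integral>\<^sup>+x. ennreal (D x) \<partial>\<mu>) \<le> ennreal \<delta>"
    using D_sum le_iff_add order_trans by (metis (no_types, lifting))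
  have D_transfer: "(\<integral>\<^sup>+x. transfer (\<lambda>z. ennreal (D z)) x \<partial>\<mu>) \<le> ennreal \<delta>"
    using D_sum le_iff_add order_trans add.commute by (metis (no_types, lifting))
  have iD: "integrable \<mu> D"
    by (rule integrable_const_bound[where B="1 / \<epsilon>"]) (use D0 D_le in auto)
  have D_int: "(\<integral>x. D x \<partial>\<mu>) \<le> \<delta>"
    using D_mu D0 \<delta> by (subst (asm) nn_integral_eq_integral[OF iD]) auto
  define T where "T x = u x + \<eta>" for x
  have T: "continuous_on UNIV T" "\<And>x. 0 < T x"
    using u \<eta> by (auto simp: T_def intro!: continuous_intros add_nonneg_pos)
  have "ennreal (mean T) = (\<integral>\<^sup>+x. transfer (\<lambda>z. ennreal (T z)) x \<partial>\<mu>)"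
    using T by (intro ennreal_mean) (auto intro: less_imp_le)
  also have "\<dots> \<le> (\<integral>\<^sup>+x. 1 + transfer (\<lambda>z. ennreal (D z)) x + ennreal (\<eta> * M) \<partial>\<mu>)"
  proof (rule nn_integral_mono)
    fix x
    have "transfer (\<lambda>z. ennreal (T z)) x \<le> (\<integral>\<^sup>+z. ennreal (T0 z) + ennreal (D z) + ennreal \<eta> \<partial>\<nu> x)"
      unfolding transfer_def
    proof (rule nn_integral_mono)
      fix z
      have "T z \<le> T0 z + D z + \<eta>" by (simp add: T_def D_def)
      then show "ennreal (T z) \<le> ennreal (T0 z) + ennreal (D z) + ennreal \<eta>"
        using T0_nonneg[of z] D0[of z] \<eta> by (simp add: ennreal_leI flip: ennreal_plus)
    qed
    also have "\<dots> = transfer (\<lambda>z. ennreal (T0 z)) x + transfer (\<lambda>z. ennreal (D z)) x + ennreal \<eta> * emeasure (\<nu> x) UNIV"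
      unfolding transfer_def by (simp add: nn_integral_add)
    also have "\<dots> \<le> 1 + transfer (\<lambda>z. ennreal (D z)) x + ennreal \<eta> * ennreal M"
      by (intro add_mono mult_left_mono T0_transfer mass_nu) auto
    finally show "transfer (\<lambda>z. ennreal (T z)) x \<le> 1 + transfer (\<lambda>z. ennreal (D z)) x + ennreal (\<eta> * M)"
      using \<eta> M_nonneg by (simp add: ennreal_mult)
  qed
  also have "\<dots> = 1 + (\<integral>\<^sup>+x. transfer (\<lambda>z. ennreal (D z)) x \<partial>\<mu>) + ennreal (\<eta> * M)"
    using emeasure_space_1 by (simp add: nn_integral_add)
  also have "\<dots> \<le> ennreal 1 + ennreal \<delta> + ennreal (\<eta> * M)"
    by (intro add_mono D_transfer) auto
  also have "\<dots> = ennreal (1 + \<delta> + \<eta> * M)"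
    using \<delta> \<eta> M_nonneg by (simp add: ennreal_plus)
  finally have mean_le: "mean T \<le> 1 + \<delta> + \<eta> * M"
    using \<delta> \<eta> M_nonneg by (subst (asm) ennreal_le_iff) auto
  have lnT: "integrable \<mu> (\<lambda>x. ln (T x))"
    using T by (intro integrable_mu continuous_intros) (auto simp: less_imp_neq[symmetric])
  have "- (\<integral>x. ln (T x) \<partial>\<mu>) = (\<integral>x. - ln (T x) \<partial>\<mu>)" by simp
  also have "\<dots> \<le> (\<integral>y. ln (branch_mass y + \<epsilon>) - ln (fibre_prob y) + D y / \<eta> \<partial>\<mu>)"
  proof (rule integral_mono_AE)
    show "AE y in \<mu>. - ln (T y) \<le> ln (branch_mass y + \<epsilon>) - ln (fibre_prob y) + D y / \<eta>"
      using AE_Y AE_fibre_prob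
    proof eventually_elim
      case (elim y)
      have d: "0 < branch_mass y + \<epsilon>" using branch_mass_nonneg[of y] \<epsilon> by simp
      have T0: "T0 y = fibre_prob y / (branch_mass y + \<epsilon>)" using elim by (simp add: T0_def)
      have T0p: "0 < T0 y" using T0 d fibre_prob_pos[of y] by simp
      have pos: "0 < T y" "\<eta> \<le> T y" using T(2) u(2)[of y] by (auto simp: T_def)
      have "ln (T0 y / T y) \<le> T0 y / T y - 1" using T0p pos by (intro ln_le_minus_one) auto
      also have "\<dots> = (T0 y - T y) / T y" using pos by (simp add: diff_divide_distrib)
      also have "\<dots> \<le> D y / T y" using pos \<eta> by (intro divide_right_mono) (auto simp: T_def D_def)
      also have "\<dots> \<le> D y / \<eta>" using pos \<eta> D0[of y] by (intro divide_left_mono) auto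
      finally have "- ln (T y) \<le> - ln (T0 y) + D y / \<eta>" using T0p pos by (simp add: ln_div)
      moreover have "- ln (T0 y) = ln (branch_mass y + \<epsilon>) - ln (fibre_prob y)"
        using d fibre_prob_pos[of y] by (simp add: T0 ln_div)
      ultimately show ?case by simp
    qed
  qed (use lnT integrable_ln_branch_mass_plus[OF \<epsilon>] integrable_ln_fibre_prob iD in auto)
  also have "\<dots> = (\<integral>y. ln (branch_mass y + \<epsilon>) \<partial>\<mu>) + fibre_entropy + (\<integral>y. D y \<partial>\<mu>) / \<eta>"
    using integrable_ln_branch_mass_plus[OF \<epsilon>] integrable_ln_fibre_prob iD by (simp add: fibre_entropy_def)
  also have "(\<integral>y. D y \<partial>\<mu>) / \<eta> \<le> \<delta> / \<eta>" using D_int \<eta> by (intro divide_right_mono) auto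
  finally have "- (\<integral>x. ln (T x) \<partial>\<mu>) + mean T - 1 \<le> (\<integral>y. ln (branch_mass y + \<epsilon>) \<partial>\<mu>) + fibre_entropy + e"
    using mean_le \<delta> \<eta> by linarith
  then show ?thesis using that T by blast
qed

text \<open>The tangent form of Jensen's inequality for T / p. Together with
  \<open>test_function_exists\<close> it makes \<open>fibre_entropy\<close> an infimum over T for
  kernels that give each point of Y mass 1 over its image.\<close>

lemma fibre_entropy_le_test:
  assumes one: "\<And>y. y \<in> Y \<Longrightarrow> branch_mass y = 1" and T: "continuous_on UNIV T" "\<And>x. 0 < T x"
  shows "fibre_entropy \<le> - (\<integral>x. ln (T x) \<partial>\<mu>) + mean T - 1"
proof -
  have [measurable]: "T \<in> borel_measurable borel" using T(1) by (rule borel_measurable_continuous_onI)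
  have lnT: "integrable \<mu> (\<lambda>x. ln (T x))"
    using T by (intro integrable_mu continuous_intros) (auto simp: less_imp_neq[symmetric])
  have T0: "0 \<le> T x" for x using T(2)[of x] by simp
  have "(\<integral>\<^sup>+y. ennreal (T y / fibre_prob y) \<partial>\<mu>) = (\<integral>\<^sup>+y. ennreal (T y) * ratio y \<partial>\<mu>)"
  proof (rule nn_integral_cong_AE)
    show "AE y in \<mu>. ennreal (T y / fibre_prob y) = ennreal (T y) * ratio y"
      using AE_Y
    proof eventually_elim
      case (elim y)
      then show ?case using T0[of y] fibre_prob_pos[of y] one by (simp add: ratio_def flip: ennreal_mult)
    qed
  qed
  also have "\<dots> \<le> (\<integral>\<^sup>+x. transfer (\<lambda>z. ennreal (T z)) x \<partial>\<mu>)" by (rule nn_integral_ratio_le) measurable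
  also have "\<dots> = ennreal (mean T)" using T T0 by (intro ennreal_mean[symmetric])
  finally have le: "(\<integral>\<^sup>+y. ennreal (T y / fibre_prob y) \<partial>\<mu>) \<le> ennreal (mean T)" .
  have nn: "0 \<le> T y / fibre_prob y" for y using T0[of y] fibre_prob_pos[of y] by simp
  have i: "integrable \<mu> (\<lambda>y. T y / fibre_prob y)"
  proof (rule integrableI_bounded)
    have "(\<integral>\<^sup>+y. ennreal (norm (T y / fibre_prob y)) \<partial>\<mu>) \<le> ennreal (mean T)"
      using le by (simp only: real_norm_def abs_of_nonneg[OF nn])
    then show "(\<integral>\<^sup>+y. ennreal (norm (T y / fibre_prob y)) \<partial>\<mu>) < \<infinity>" by (rule order_le_less_trans) simp
  qed measurable
  have "0 \<le> mean T" using positive_functional.nonneg[OF positive_functional_mean T(1) T0] .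
  then have i_le: "(\<integral>y. T y / fibre_prob y \<partial>\<mu>) \<le> mean T"
    using le nn by (subst (asm) nn_integral_eq_integral[OF i]) auto
  have "(\<integral>x. ln (T x) \<partial>\<mu>) + fibre_entropy = (\<integral>y. ln (T y) - ln (fibre_prob y) \<partial>\<mu>)"
    using lnT integrable_ln_fibre_prob by (simp add: fibre_entropy_def)
  also have "\<dots> \<le> (\<integral>y. T y / fibre_prob y - 1 \<partial>\<mu>)"
  proof (rule integral_mono)
    fix y
    have "ln (T y / fibre_prob y) \<le> T y / fibre_prob y - 1"
      using T(2)[of y] fibre_prob_pos[of y] by (intro ln_le_minus_one) auto
    then show "ln (T y) - ln (fibre_prob y) \<le> T y / fibre_prob y - 1"
      using T(2)[of y] fibre_prob_pos[of y] by (simp add: ln_div)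
  qed (use lnT integrable_ln_fibre_prob i in auto)
  also have "\<dots> = (\<integral>y. T y / fibre_prob y \<partial>\<mu>) - 1" using i by simp
  finally show ?thesis using i_le by simp
qed

section \<open>The integral of the logarithm of the cocycle\<close>

definition log_integral :: ereal where
  "log_integral = set_ereal_integral \<mu> Y (\<lambda>y. eln (branch_mass y))"

lemma log_integral_eq:
  "log_integral = enn2ereal (\<integral>\<^sup>+y. ennreal (ln (branch_mass y)) \<partial>\<mu>)
     - enn2ereal (\<integral>\<^sup>+y. (if branch_mass y = 0 then \<infinity> else ennreal (- ln (branch_mass y))) \<partial>\<mu>)"
proof -
  have "(\<integral>\<^sup>+y\<in>Y. e2ennreal (eln (branch_mass y)) \<partial>\<mu>) = (\<integral>\<^sup>+y. ennreal (ln (branch_mass y)) \<partial>\<mu>)"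
  proof (rule nn_integral_cong_AE)
    \<comment> \<open>At zeros of \<open>branch_mass\<close> both sides are 0:
      \<open>e2ennreal\<close> sends -\<infinity> to 0, and the real \<open>ln 0\<close> is
      0.\<close>
    show "AE y in \<mu>. e2ennreal (eln (branch_mass y)) * indicator Y y = ennreal (ln (branch_mass y))"
      using AE_Y by eventually_elim (simp add: eln_def e2ennreal_neg)
  qed
  moreover have "(\<integral>\<^sup>+y\<in>Y. e2ennreal (- eln (branch_mass y)) \<partial>\<mu>)
      = (\<integral>\<^sup>+y. (if branch_mass y = 0 then \<infinity> else ennreal (- ln (branch_mass y))) \<partial>\<mu>)"
  proof (rule nn_integral_cong_AE)
    show "AE y in \<mu>. e2ennreal (- eln (branch_mass y)) * indicator Y y = (if branch_mass y = 0 then \<infinity> else ennreal (- ln (branch_mass y)))"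
      using AE_Y by eventually_elim (simp add: eln_def)
  qed
  ultimately show ?thesis by (simp add: log_integral_def set_ereal_integral_def)
qed

lemma positive_log_finite: "(\<integral>\<^sup>+y. ennreal (ln (branch_mass y)) \<partial>\<mu>) < \<infinity>"
proof -
  have "ln (branch_mass y) \<le> M" for y
  proof (cases "branch_mass y = 0")
    case False
    then show ?thesis using ln_le_minus_one[of "branch_mass y"] branch_mass_nonneg[of y] branch_mass_le[of y] by simp
  qed (use M_nonneg in simp)
  then have "(\<integral>\<^sup>+y. ennreal (ln (branch_mass y)) \<partial>\<mu>) \<le> (\<integral>\<^sup>+y. ennreal M \<partial>\<mu>)"
    by (intro nn_integral_mono ennreal_leI)
  also have "\<dots> = ennreal M" using emeasure_space_1 by simp
  finally show ?thesis by (rule order_le_less_trans) simp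
qed

text \<open>\<open>branch_mass\<close> is bounded, so only the negative part can be infinite and
  \<infinity> - \<infinity> does not arise.\<close>

lemma log_integral_cases:
  obtains "log_integral = -\<infinity>" "(\<integral>\<^sup>+y. (if branch_mass y = 0 then \<infinity> else ennreal (- ln (branch_mass y))) \<partial>\<mu>) = \<infinity>"
  | "log_integral = ereal (\<integral>y. ln (branch_mass y) \<partial>\<mu>)" "AE y in \<mu>. 0 < branch_mass y" "integrable \<mu> (\<lambda>y. ln (branch_mass y))"
proof -
  define N where "N = (\<integral>\<^sup>+y. (if branch_mass y = 0 then \<infinity> else ennreal (- ln (branch_mass y))) \<partial>\<mu>)"
  define Q where "Q = (\<integral>\<^sup>+y. ennreal (ln (branch_mass y)) \<partial>\<mu>)"
  have Qfin: "Q < \<infinity>" unfolding Q_def by (rule positive_log_finite)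
  have L: "log_integral = enn2ereal Q - enn2ereal N" unfolding Q_def N_def by (rule log_integral_eq)
  show ?thesis
  proof (cases "N = \<infinity>")
    case True
    have "enn2ereal Q \<noteq> \<infinity>" using Qfin by (simp add: less_top)
    then have "log_integral = -\<infinity>" unfolding L using True by (cases "enn2ereal Q") auto
    then show ?thesis using True that(1) by (simp add: N_def)
  next
    case False
    have "AE y in \<mu>. (if branch_mass y = 0 then \<infinity> else ennreal (- ln (branch_mass y))) \<noteq> \<infinity>"
      by (rule nn_integral_PInf_AE) (use False in \<open>auto simp: N_def\<close>)
    then have pos: "AE y in \<mu>. 0 < branch_mass y"
      by eventually_elim (use branch_mass_nonneg in \<open>auto simp: less_le split: if_splits\<close>)
    then have N: "N = (\<integral>\<^sup>+y. ennreal (- ln (branch_mass y)) \<partial>\<mu>)"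
      unfolding N_def by (intro nn_integral_cong_AE) (auto elim!: eventually_mono)
    have int: "integrable \<mu> (\<lambda>y. ln (branch_mass y))"
      using Qfin False unfolding real_integrable_def by (auto simp: N Q_def)
    have "ereal (\<integral>y. ln (branch_mass y) \<partial>\<mu>) = ereal (enn2real Q) - ereal (enn2real N)"
      unfolding real_lebesgue_integral_def[OF int] by (simp add: Q_def N)
    also have "\<dots> = enn2ereal Q - enn2ereal N"
      using Qfin False by (cases Q; cases N) auto
    finally show ?thesis using that(2) pos int L by simp
  qed
qed

text \<open>Removes the \<epsilon> of \<open>test_function_exists\<close>: by Fatou's lemma if the
  integral is -\<infinity>, by dominated convergence if it is finite.\<close>

lemma log_integral_approx:
  assumes "log_integral < ereal c"
  shows "\<exists>\<epsilon>>0. (\<integral>y. ln (branch_mass y + \<epsilon>) \<partial>\<mu>) < c"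
proof -
  define \<epsilon> where "\<epsilon> k = 1 / real (Suc k)" for k
  have \<epsilon>: "0 < \<epsilon> k" "\<epsilon> k \<le> 1" for k by (auto simp: \<epsilon>_def)
  have \<epsilon>_lim: "\<epsilon> \<longlonglongrightarrow> 0"
    unfolding \<epsilon>_def using LIMSEQ_inverse_real_of_nat by (simp add: inverse_eq_divide)
  define C where "C = ln (M + 1)"
  have C0: "0 \<le> C" using M_nonneg by (simp add: C_def)
  have le_C: "ln (branch_mass y + \<epsilon> k) \<le> C" for y k
    unfolding C_def using branch_mass_nonneg[of y] branch_mass_le[of y] \<epsilon>[of k] by (intro ln_mono) auto
  have lim: "(\<lambda>k. ln (branch_mass y + \<epsilon> k)) \<longlonglongrightarrow> ln (branch_mass y)" if "0 < branch_mass y" for y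
  proof -
    have "(\<lambda>k. branch_mass y + \<epsilon> k) \<longlonglongrightarrow> branch_mass y + 0" by (intro tendsto_intros \<epsilon>_lim)
    then show ?thesis using that by (intro tendsto_ln) auto
  qed
  show ?thesis
  proof (cases rule: log_integral_cases)
    case 1
    show ?thesis
    proof (rule ccontr)
      assume "\<not> ?thesis"
      then have ge: "c \<le> (\<integral>y. ln (branch_mass y + \<epsilon> k) \<partial>\<mu>)" for k using \<epsilon>(1)[of k] by (force simp: not_less)
      \<comment> \<open>Subtracting from the upper bound C makes the integrands nonnegative, as
        Fatou's lemma requires.\<close>
      define F where "F k y = ennreal (C - ln (branch_mass y + \<epsilon> k))" for k y
      have Fm [measurable]: "F k \<in> borel_measurable borel" for k unfolding F_def by measurable
      have F_le: "(\<integral>\<^sup>+y. F k y \<partial>\<mu>) \<le> ennreal (C - c)" for k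
      proof -
        have i: "integrable \<mu> (\<lambda>y. C - ln (branch_mass y + \<epsilon> k))"
          using integrable_ln_branch_mass_plus[OF \<epsilon>(1)] by simp
        have "(\<integral>\<^sup>+y. F k y \<partial>\<mu>) = ennreal (\<integral>y. C - ln (branch_mass y + \<epsilon> k) \<partial>\<mu>)"
          unfolding F_def by (rule nn_integral_eq_integral[OF i]) (use le_C in auto)
        also have "\<dots> \<le> ennreal (C - c)"
          using ge[of k] integrable_ln_branch_mass_plus[OF \<epsilon>(1)] by (intro ennreal_leI) simp
        finally show ?thesis .
      qed
      have "(\<integral>\<^sup>+y. (if branch_mass y = 0 then \<infinity> else ennreal (- ln (branch_mass y))) \<partial>\<mu>) \<le> (\<integral>\<^sup>+y. liminf (\<lambda>k. F k y) \<partial>\<mu>)"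
      proof (rule nn_integral_mono)
        fix y
        show "(if branch_mass y = 0 then \<infinity> else ennreal (- ln (branch_mass y))) \<le> liminf (\<lambda>k. F k y)"
        proof (cases "branch_mass y = 0")
          case True
          \<comment> \<open>Here F k y equals C + ln (k + 1), so the values at zeros of
            \<open>branch_mass\<close> tend to \<infinity>.\<close>
          have "F k y \<ge> ennreal (ln (real (Suc k)))" for k
            unfolding F_def using True C0 by (intro ennreal_leI) (simp add: \<epsilon>_def ln_div)
          moreover have "(\<lambda>k. ennreal (ln (real (Suc k)))) \<longlonglongrightarrow> \<infinity>"
          proof -
            have "filterlim (\<lambda>k. real (Suc k)) at_top sequentially"
              using filterlim_compose[OF filterlim_real_sequentially filterlim_Suc] .
            then have "filterlim (\<lambda>k. ln (real (Suc k))) at_top sequentially"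
              by (rule filterlim_compose[OF ln_at_top])
            then show ?thesis by (simp add: ennreal_tendsto_top_eq_at_top)
          qed
          ultimately have "liminf (\<lambda>k. F k y) \<ge> \<infinity>"
            using Liminf_mono[of "\<lambda>k. ennreal (ln (real (Suc k)))" "\<lambda>k. F k y" sequentially]
            by (simp add: lim_imp_Liminf)
          then show ?thesis using True by simp
        next
          case False
          then have d: "0 < branch_mass y" using branch_mass_nonneg[of y] by simp
          have "(\<lambda>k. F k y) \<longlonglongrightarrow> ennreal (C - ln (branch_mass y))"
            unfolding F_def by (intro tendsto_ennrealI tendsto_intros lim[OF d])
          then have "liminf (\<lambda>k. F k y) = ennreal (C - ln (branch_mass y))"
            by (intro lim_imp_Liminf) auto
          then show ?thesis using False C0 by (simp add: ennreal_leI)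
        qed
      qed
      also have "\<dots> \<le> liminf (\<lambda>k. \<integral>\<^sup>+y. F k y \<partial>\<mu>)"
        by (rule nn_integral_liminf) measurable
      also have "\<dots> \<le> ennreal (C - c)"
        using F_le Liminf_mono[of "\<lambda>k. \<integral>\<^sup>+y. F k y \<partial>\<mu>" "\<lambda>_. ennreal (C - c)" sequentially]
        by (simp add: Liminf_const)
      finally show False using 1(2) by (simp add: top_unique)
    qed
  next
    case 2
    have "(\<lambda>k. \<integral>y. ln (branch_mass y + \<epsilon> k) \<partial>\<mu>) \<longlonglongrightarrow> (\<integral>y. ln (branch_mass y) \<partial>\<mu>)"
    proof (rule integral_dominated_convergence[where w="\<lambda>y. \<bar>ln (branch_mass y)\<bar> + C"])
      show "AE y in \<mu>. (\<lambda>k. ln (branch_mass y + \<epsilon> k)) \<longlonglongrightarrow> ln (branch_mass y)"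
        using 2(2) by eventually_elim (rule lim)
      show "AE y in \<mu>. norm (ln (branch_mass y + \<epsilon> k)) \<le> \<bar>ln (branch_mass y)\<bar> + C" for k
        using 2(2)
      proof eventually_elim
        case (elim y)
        have "ln (branch_mass y) \<le> ln (branch_mass y + \<epsilon> k)" using elim \<epsilon>[of k] by (intro ln_mono) auto
        then show ?case using le_C[of y k] C0 by simp
      qed
    qed (use 2(3) in auto)
    moreover have "(\<integral>y. ln (branch_mass y) \<partial>\<mu>) < c" using assms 2(1) by simp
    ultimately have "eventually (\<lambda>k. (\<integral>y. ln (branch_mass y + \<epsilon> k) \<partial>\<mu>) < c) sequentially"
      by (rule order_tendstoD(2))
    then obtain k where "(\<integral>y. ln (branch_mass y + \<epsilon> k) \<partial>\<mu>) < c" by (auto simp: eventually_sequentially)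
    then show ?thesis using \<epsilon>(1)[of k] by blast
  qed
qed

end

section \<open>Fine partitions\<close>

text \<open>P consists of the atoms of the algebra generated by Q and a finite cover by balls of
  radius r / 2; \<phi> records the memberships of a point. Points of the same atom share a
  ball.\<close>

lemma fine_partition_exists:
  fixes Q :: "'a::metric_space set set"
  assumes "compact (UNIV :: 'a set)" "0 < r" and Q: "finite Q" "partition_on UNIV Q" "Q \<subseteq> sets borel"
  obtains P where "finite P" "partition_on UNIV P" "P \<subseteq> sets borel" "\<And>B. B \<in> P \<Longrightarrow> \<exists>C\<in>Q. B \<subseteq> C"
    "\<And>B y y'. B \<in> P \<Longrightarrow> y \<in> B \<Longrightarrow> y' \<in> B \<Longrightarrow> dist y y' \<le> r"
proof -
  have "0 < r / 2" using assms(2) by simp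
  then obtain Z :: "'a set" where Z: "finite Z" "UNIV \<subseteq> (\<Union>z\<in>Z. ball z (r / 2))"
    using compact_ball_cover[OF assms(1), of "r / 2"] by auto
  define \<phi> where "\<phi> y = ({z \<in> Z. y \<in> ball z (r / 2)}, {C \<in> Q. y \<in> C})" for y
  define P where "P = (\<lambda>y. {y'. \<phi> y' = \<phi> y}) ` UNIV"
  have "range \<phi> \<subseteq> Pow Z \<times> Pow Q" by (auto simp: \<phi>_def)
  then have "finite (range \<phi>)" using Z Q finite_subset by (meson finite_Pow_iff finite_SigmaI)
  moreover have "P = (\<lambda>v. {y'. \<phi> y' = v}) ` range \<phi>" by (auto simp: P_def)
  ultimately have fin: "finite P" by simp
  have part: "partition_on UNIV P"
    by (rule partition_onI) (auto simp: P_def disjnt_def)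
  have \<phi>_eq: "\<phi> y' = \<phi> y \<longleftrightarrow> (\<forall>z\<in>Z. y' \<in> ball z (r / 2) \<longleftrightarrow> y \<in> ball z (r / 2)) \<and> (\<forall>C\<in>Q. y' \<in> C \<longleftrightarrow> y \<in> C)" for y y'
    unfolding \<phi>_def prod.inject by blast
  have level: "{y'. \<phi> y' = \<phi> y} = (\<Inter>z\<in>Z. if y \<in> ball z (r / 2) then ball z (r / 2) else - ball z (r / 2))
      \<inter> (\<Inter>C\<in>Q. if y \<in> C then C else - C)" for y
    by (rule set_eqI, simp only: mem_Collect_eq \<phi>_eq Int_iff INT_iff) (auto split: if_splits)
  have borel: "P \<subseteq> sets borel"
  proof
    fix B assume "B \<in> P"
    then obtain y where B: "B = {y'. \<phi> y' = \<phi> y}" by (auto simp: P_def)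
    have "(\<Inter>z\<in>Z. if y \<in> ball z (r / 2) then ball z (r / 2) else - ball z (r / 2)) \<in> sets borel"
    proof (cases "Z = {}")
      case False
      show ?thesis by (rule sets.finite_INT[OF Z(1) False]) auto
    qed simp
    moreover have "(\<Inter>C\<in>Q. if y \<in> C then C else - C) \<in> sets borel"
    proof (cases "Q = {}")
      case False
      show ?thesis by (rule sets.finite_INT[OF Q(1) False]) (use Q(3) in auto)
    qed simp
    ultimately show "B \<in> sets borel" unfolding B level by (rule sets.Int)
  qed
  have refine: "\<exists>C\<in>Q. B \<subseteq> C" if "B \<in> P" for B
  proof -
    obtain y where B: "B = {y'. \<phi> y' = \<phi> y}" using \<open>B \<in> P\<close> by (auto simp: P_def)
    obtain C where C: "C \<in> Q" "y \<in> C" using partition_onD1[OF Q(2)] by blast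
    then have "B \<subseteq> C" unfolding B level by auto
    then show ?thesis using C by blast
  qed
  have diam: "dist y y' \<le> r" if "B \<in> P" "y \<in> B" "y' \<in> B" for B y y'
  proof -
    have eq: "\<phi> y = \<phi> y'" using that by (auto simp: P_def)
    have "y \<in> (\<Union>z\<in>Z. ball z (r / 2))" using Z(2) by (rule subsetD) simp
    then obtain z where z: "z \<in> Z" "y \<in> ball z (r / 2)" by blast
    then have "z \<in> fst (\<phi> y)" by (simp add: \<phi>_def)
    then have "y' \<in> ball z (r / 2)" unfolding eq by (simp add: \<phi>_def)
    then have "dist y y' < r" using z by (intro dist_triangle_half_r[of z y r y']) auto
    then show ?thesis by simp
  qed
  show ?thesis using that[OF fin part borel refine diam] .
qed

section \<open>Essential points\<close>

lemma closed_essential_points: "closed (essential_points \<alpha>)"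
proof -
  have "\<exists>T. open T \<and> x \<in> T \<and> T \<subseteq> - essential_points \<alpha>" if x: "x \<in> - essential_points \<alpha>" for x
  proof -
    obtain V where V: "open V" "x \<in> V" "\<not> (\<exists>\<mu>\<in>invariant_measures \<alpha>. 0 < measure \<mu> V)"
      using x by (auto simp: essential_points_def)
    then show ?thesis by (intro exI[of _ V]) (auto simp: essential_points_def)
  qed
  then show ?thesis unfolding closed_def by (subst open_subopen) blast
qed

text \<open>The complement is a union of null open sets, possibly uncountably many. It is exhausted
  by countably many compact sets F n, each covered by finitely many of them.\<close>

lemma emeasure_compl_essential_points:
  fixes \<mu> :: "'a::metric_space measure"
  assumes "compact (UNIV :: 'a set)" and \<mu>: "\<mu> \<in> invariant_measures \<alpha>"
  shows "emeasure \<mu> (- essential_points \<alpha>) = 0"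
proof -
  interpret prob_space \<mu> using \<mu> by (simp add: invariant_measures_def)
  have s: "sets \<mu> = sets borel" using \<mu> by (simp add: invariant_measures_def)
  have "open (- essential_points \<alpha>)" using closed_essential_points[of \<alpha>] by (simp add: open_Compl)
  then obtain q :: "'a \<Rightarrow> real" where q: "continuous_on UNIV q" "\<And>x. 0 \<le> q x" "\<And>x. q x \<le> 1"
    "\<And>x. 0 < q x \<longleftrightarrow> x \<in> - essential_points \<alpha>"
    using open_cozero_function[of "- essential_points \<alpha>"] by blast
  define F where "F n = {x. 1 / real (Suc n) \<le> q x}" for n
  have "F n \<in> null_sets \<mu>" for n
  proof -
    have "closed (F n)" unfolding F_def by (intro closed_Collect_le continuous_intros q(1))
    then have c: "compact (F n)" using compact_Int_closed[OF assms(1)] by simp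
    have "\<exists>V. open V \<and> x \<in> V \<and> V \<in> null_sets \<mu>" if x: "x \<in> F n" for x
    proof -
      have "0 < 1 / real (Suc n)" by simp
      also have "\<dots> \<le> q x" using x by (simp add: F_def)
      finally have "x \<notin> essential_points \<alpha>" using q(4) by simp
      then obtain V where V: "open V" "x \<in> V" "measure \<mu> V \<le> 0"
        using \<mu> by (force simp: essential_points_def not_less)
      then have "measure \<mu> V = 0" using measure_nonneg[of \<mu> V] by simp
      then have "V \<in> null_sets \<mu>" using V s by (auto simp: null_sets_def emeasure_eq_measure)
      then show ?thesis using V by blast
    qed
    then obtain V where V: "\<And>x. x \<in> F n \<Longrightarrow> open (V x)" "\<And>x. x \<in> F n \<Longrightarrow> x \<in> V x" "\<And>x. x \<in> F n \<Longrightarrow> V x \<in> null_sets \<mu>"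
      by metis
    obtain D where D: "D \<subseteq> F n" "finite D" "F n \<subseteq> (\<Union>x\<in>D. V x)"
      by (rule compactE_image[OF c, of "F n" V]) (use V in auto)
    have "(\<Union>x\<in>D. V x) \<in> null_sets \<mu>"
      using D V(3) by (intro null_sets.finite_UN) auto
    then show ?thesis
      by (rule null_sets_subset) (use D(3) \<open>closed (F n)\<close> s in \<open>auto simp: borel_closed\<close>)
  qed
  then have null: "(\<Union>n. F n) \<in> null_sets \<mu>" by (intro null_sets_UN) auto
  have "- essential_points \<alpha> \<subseteq> (\<Union>n. F n)"
  proof
    fix x assume "x \<in> - essential_points \<alpha>"
    then have "0 < q x" using q(4) by simp
    then obtain n where "inverse (real (Suc n)) < q x" using reals_Archimedean by blast
    then have "x \<in> F n" by (simp add: F_def inverse_eq_divide)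
    then show "x \<in> (\<Union>n. F n)" by blast
  qed
  moreover have "- essential_points \<alpha> \<in> sets \<mu>"
    using closed_essential_points[of \<alpha>] s by (simp add: borel_closed)
  ultimately have "- essential_points \<alpha> \<in> null_sets \<mu>" using null_sets_subset[OF null] by metis
  then show ?thesis by (simp add: null_sets_def)
qed

lemma non_contracting_systemI:
  fixes \<alpha> :: "'a::metric_space \<Rightarrow> 'a"
  assumes "compact (UNIV :: 'a set)" "continuous_on UNIV \<alpha>" "\<mu> \<in> invariant_measures \<alpha>" "0 < r"
    and "\<And>x y. x \<in> essential_points \<alpha> \<Longrightarrow> y \<in> essential_points \<alpha> \<Longrightarrow> dist x y \<le> r \<Longrightarrow> dist x y \<le> dist (\<alpha> x) (\<alpha> y)"
  shows "non_contracting_system \<alpha> \<mu> (essential_points \<alpha>) r"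
proof -
  have inv: "invariant_measure \<alpha> \<mu>'" if "\<mu>' \<in> invariant_measures \<alpha>" for \<mu>'
    using that borel_measurable_continuous_onI[OF assms(2)] by unfold_locales
  have "\<alpha> x \<in> essential_points \<alpha>" if x: "x \<in> essential_points \<alpha>" for x
    unfolding essential_points_def
  proof safe
    fix V assume V: "open V" "\<alpha> x \<in> V"
    \<comment> \<open>A neighbourhood of \<alpha> x pulls back to one of x, with the same measure
      under every invariant measure.\<close>
    have "open (\<alpha> -` V)" using assms(2) V(1) by (simp add: open_vimage)
    then obtain \<mu>' where \<mu>': "\<mu>' \<in> invariant_measures \<alpha>" "0 < measure \<mu>' (\<alpha> -` V)"
      using x V(2) unfolding essential_points_def by blast
    then show "\<exists>\<mu>'\<in>invariant_measures \<alpha>. 0 < measure \<mu>' V"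
      using invariant_measure.measure_vimage[OF inv, of \<mu>' V] V by (auto simp: borel_open)
  qed
  then have "\<alpha> ` essential_points \<alpha> \<subseteq> essential_points \<alpha>" by blast
  interpret invariant_measure \<alpha> \<mu> by (rule inv[OF assms(3)])
  show ?thesis
    using assms \<open>\<alpha> ` essential_points \<alpha> \<subseteq> essential_points \<alpha>\<close> closed_essential_points[of \<alpha>] emeasure_compl_essential_points[OF assms(1,3)]
    by unfold_locales auto
qed

section \<open>The kernel of a transfer operator\<close>

lemma positive_functional_transfer:
  fixes \<alpha> :: "'a::metric_space \<Rightarrow> 'a"
  assumes "compact (UNIV :: 'a set)" "transfer_operator \<alpha> A"
  shows "positive_functional (\<lambda>f. A f x)"
  using assms by unfold_locales (auto simp: transfer_operator_def)

text \<open>The Riesz theorem gives existence and the integrals of continuous functions give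
  uniqueness, so the definite description in the definition is met.\<close>

lemma transfer_measure:
  fixes \<alpha> :: "'a::metric_space \<Rightarrow> 'a"
  assumes "compact (UNIV :: 'a set)" "transfer_operator \<alpha> A"
  shows "sets (transfer_measure A x) = sets borel" "finite_measure (transfer_measure A x)"
    "continuous_on UNIV f \<Longrightarrow> (\<integral>y. f y \<partial>transfer_measure A x) = A f x"
proof -
  interpret positive_functional "\<lambda>f. A f x" by (rule positive_functional_transfer[OF assms])
  let ?R = "\<lambda>\<nu>. sets \<nu> = sets borel \<and> finite_measure \<nu> \<and> (\<forall>f. continuous_on UNIV f \<longrightarrow> (\<integral>y. f y \<partial>\<nu>) = A f x)"
  have "?R riesz" using finite_measure_riesz riesz_representation by simp
  moreover have "\<nu> = riesz" if "?R \<nu>" for \<nu>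
    by (rule finite_measure_eqI_continuous) (use that finite_measure_riesz riesz_representation in auto)
  ultimately have "?R (transfer_measure A x)" unfolding transfer_measure_def by (rule theI)
  then show "sets (transfer_measure A x) = sets borel" "finite_measure (transfer_measure A x)"
    "continuous_on UNIV f \<Longrightarrow> (\<integral>y. f y \<partial>transfer_measure A x) = A f x" by auto
qed

lemma fibre_kernel_transfer_measure:
  fixes \<alpha> :: "'a::metric_space \<Rightarrow> 'a"
  assumes comp: "compact (UNIV :: 'a set)" and cont: "continuous_on UNIV \<alpha>" and A: "transfer_operator \<alpha> A"
  shows "\<exists>M. fibre_kernel \<alpha> (transfer_measure A) M"
proof -
  note tm = transfer_measure[OF comp A]
  have cA: "continuous_on UNIV (A f)" if "continuous_on UNIV f" for f
    using A that by (simp add: transfer_operator_def)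
  have "compact (A (\<lambda>_. 1) ` UNIV)" using comp cA by (intro compact_continuous_image) auto
  then obtain M where M: "\<And>x. norm (A (\<lambda>_. 1) x) \<le> M" using compact_imp_bounded bounded_iff by (metis rangeI)
  have "0 \<le> M" using M[of undefined] by (meson norm_ge_zero order_trans)
  have "fibre_kernel \<alpha> (transfer_measure A) M"
  proof
    fix x
    interpret nu: finite_measure "transfer_measure A x" by (rule tm)
    have sp: "space (transfer_measure A x) = UNIV" using sets_eq_imp_space_eq[OF tm(1)] by simp
    have "measure (transfer_measure A x) UNIV = A (\<lambda>_. 1) x" using tm(3)[of "\<lambda>_. 1" x] sp by simp
    also have "\<dots> \<le> M" using M[of x] by simp
    finally show "emeasure (transfer_measure A x) UNIV \<le> ennreal M"
      by (simp add: nu.emeasure_eq_measure ennreal_leI)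
    have c: "continuous_on UNIV (\<lambda>z. dist (\<alpha> z) x)" by (intro continuous_intros cont)
    have pull: "\<And>f g. continuous_on UNIV f \<Longrightarrow> continuous_on UNIV g \<Longrightarrow> A (\<lambda>x. f (\<alpha> x) * g x) = (\<lambda>x. f x * A g x)"
      using A by (simp add: transfer_operator_def)
    \<comment> \<open>The transfer identity for the function "distance from x", evaluated at x:
      \<alpha> z has mean distance 0 from x.\<close>
    have "A (\<lambda>z. dist (\<alpha> z) x * 1) = (\<lambda>z. dist z x * A (\<lambda>_. 1) z)"
      by (rule pull) (auto intro!: continuous_intros)
    then have "(\<integral>z. dist (\<alpha> z) x \<partial>transfer_measure A x) = 0"
      using tm(3)[OF c, of x] by simp
    then have "AE z in transfer_measure A x. dist (\<alpha> z) x = 0"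
      by (subst (asm) integral_nonneg_eq_0_iff_AE) (auto intro!: integrable_continuous_compact[OF comp tm(2,1) c])
    then show "AE z in transfer_measure A x. \<alpha> z = x" by simp
  next
    fix f :: "'a \<Rightarrow> real" assume "continuous_on UNIV f"
    then show "(\<lambda>x. \<integral>z. f z \<partial>transfer_measure A x) \<in> borel_measurable borel"
      using cA[of f] tm(3) by (simp add: borel_measurable_continuous_onI)
  qed (use comp cont tm \<open>0 \<le> M\<close> in \<open>auto intro: borel_measurable_continuous_onI\<close>)
  then show ?thesis by blast
qed

section \<open>The t-entropy in terms of a fine partition\<close>

context kernel_partition
begin

text \<open>The bound is first shown with an arbitrary real c above \<open>log_integral\<close>,
  which serves the finite case and the case -\<infinity> alike.\<close>

lemma t_entropy_le:
  assumes A: "\<And>f x. continuous_on UNIV f \<Longrightarrow> A f x = (\<integral>z. f z \<partial>\<nu> x)"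
  shows "t_entropy A \<mu> \<le> log_integral + ereal entropy_rate"
proof -
  have bound: "t_entropy A \<mu> \<le> ereal (c + entropy_rate)" if c: "log_integral < ereal c" for c
  proof (rule ereal_le_epsilon2)
    fix e :: real assume e: "0 < e"
    obtain \<epsilon> where \<epsilon>: "0 < \<epsilon>" "(\<integral>y. ln (branch_mass y + \<epsilon>) \<partial>\<mu>) < c" using log_integral_approx[OF c] by blast
    have e2: "0 < e / 2" using e by simp
    obtain T where T: "continuous_on UNIV T" "\<And>x. 0 < T x"
      "- (\<integral>x. ln (T x) \<partial>\<mu>) + mean T - 1 \<le> (\<integral>y. ln (branch_mass y + \<epsilon>) \<partial>\<mu>) + fibre_entropy + e / 2"
      by (rule test_function_exists[OF \<epsilon>(1) e2]) blast
    have A1: "A ^^ 1 = A" unfolding One_nat_def by simp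
    have mu1: "(\<integral>x. 1 \<partial>\<mu>) = (1 :: real)" by simp
    obtain G where G: "G \<in> partitions_of_unity"
      "(\<Sum>g\<in>G. if (\<integral>x. g x \<partial>\<mu>) = 0 then 0 else ereal (\<integral>x. g x \<partial>\<mu>) * eln (mean g / (\<integral>x. g x \<partial>\<mu>)))
       \<le> ereal (- (\<integral>x. ln (T x) \<partial>\<mu>) + mean T - 1 + e / 2)"
      using partition_of_unity_bound[OF positive_functional_mu positive_functional_mean mu1 T(1,2) e2] by blast
    have "t_entropy A \<mu> \<le> (INF G\<in>partitions_of_unity.
        (\<Sum>g\<in>G. if (\<integral>x. g x \<partial>\<mu>) = 0 then 0
               else ereal (\<integral>x. g x \<partial>\<mu>) * eln ((\<integral>x. (A ^^ 1) g x \<partial>\<mu>) / (\<integral>x. g x \<partial>\<mu>)))) / ereal (real 1)"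
      unfolding t_entropy_def by (rule INF_lower) simp
    also have "\<dots> = (INF G\<in>partitions_of_unity.
        (\<Sum>g\<in>G. if (\<integral>x. g x \<partial>\<mu>) = 0 then 0 else ereal (\<integral>x. g x \<partial>\<mu>) * eln ((\<integral>x. A g x \<partial>\<mu>) / (\<integral>x. g x \<partial>\<mu>))))"
      unfolding A1 by (simp add: one_ereal_def[symmetric])
    also have "\<dots> \<le> (\<Sum>g\<in>G. if (\<integral>x. g x \<partial>\<mu>) = 0 then 0 else ereal (\<integral>x. g x \<partial>\<mu>) * eln ((\<integral>x. A g x \<partial>\<mu>) / (\<integral>x. g x \<partial>\<mu>)))"
      by (rule INF_lower[OF G(1)])
    also have "\<dots> = (\<Sum>g\<in>G. if (\<integral>x. g x \<partial>\<mu>) = 0 then 0 else ereal (\<integral>x. g x \<partial>\<mu>) * eln (mean g / (\<integral>x. g x \<partial>\<mu>)))"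
    proof (rule sum.cong[OF refl])
      fix g assume "g \<in> G"
      then have "continuous_on UNIV g" using G(1) by (auto simp: partitions_of_unity_def)
      then have "(\<integral>x. A g x \<partial>\<mu>) = mean g"
        unfolding mean_def by (intro Bochner_Integration.integral_cong refl A)
      then show "(if (\<integral>x. g x \<partial>\<mu>) = 0 then 0 else ereal (\<integral>x. g x \<partial>\<mu>) * eln ((\<integral>x. A g x \<partial>\<mu>) / (\<integral>x. g x \<partial>\<mu>)))
          = (if (\<integral>x. g x \<partial>\<mu>) = 0 then 0 else ereal (\<integral>x. g x \<partial>\<mu>) * eln (mean g / (\<integral>x. g x \<partial>\<mu>)))"
        by (simp only:)
    qed
    also have "\<dots> \<le> ereal (c + entropy_rate) + ereal e"
      using G(2) T(3) \<epsilon>(2) entropy_rate_eq_fibre_entropy by (elim order_trans) simp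
    finally show "t_entropy A \<mu> \<le> ereal (c + entropy_rate) + ereal e" .
  qed
  show ?thesis
  proof (cases rule: log_integral_cases)
    case 1
    have "t_entropy A \<mu> \<le> ereal B" for B
      using bound[of "B - entropy_rate"] 1 by simp
    then have "t_entropy A \<mu> = -\<infinity>" by (rule ereal_bot)
    then show ?thesis by simp
  next
    case 2
    have "t_entropy A \<mu> \<le> ereal ((\<integral>y. ln (branch_mass y) \<partial>\<mu>) + entropy_rate) + ereal e" if "0 < e" for e
      using bound[of "(\<integral>y. ln (branch_mass y) \<partial>\<mu>) + e"] 2(1) that by (simp add: ac_simps)
    then have "t_entropy A \<mu> \<le> ereal ((\<integral>y. ln (branch_mass y) \<partial>\<mu>) + entropy_rate)"
      by (rule ereal_le_epsilon2)
    then show ?thesis using 2(1) by simp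
  qed
qed

lemma t_entropy_ge:
  assumes A: "\<And>f x. continuous_on UNIV f \<Longrightarrow> A f x = (\<integral>z. f z \<partial>\<nu> x)"
    and A_cont: "\<And>f. continuous_on UNIV f \<Longrightarrow> continuous_on UNIV (A f)"
  shows "log_integral + ereal entropy_rate \<le> t_entropy A \<mu>"
proof (cases rule: log_integral_cases)
  case 1
  then show ?thesis by simp
next
  case 2
  \<comment> \<open>Continuity and nonnegativity persist along the powers of A, so these powers
    agree with those of \<open>transfer\<close> on \<open>ennreal\<close>-valued functions, for
    which the ratio bound is stated.\<close>
  have iter: "continuous_on UNIV ((A ^^ n) g) \<and> (\<forall>x. 0 \<le> (A ^^ n) g x) \<and>
      (transfer ^^ n) (\<lambda>z. ennreal (g z)) = (\<lambda>x. ennreal ((A ^^ n) g x))"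
    if g: "continuous_on UNIV g" "\<And>x. 0 \<le> g x" for g n
  proof (induction n)
    case (Suc n)
    then have c: "continuous_on UNIV ((A ^^ n) g)" "\<And>x. 0 \<le> (A ^^ n) g x" by auto
    have "(transfer ^^ Suc n) (\<lambda>z. ennreal (g z)) = (\<lambda>x. transfer (\<lambda>z. ennreal ((A ^^ n) g z)) x)"
      using Suc by simp
    also have "\<dots> = (\<lambda>x. ennreal ((A ^^ Suc n) g x))"
      using ennreal_integral_nu[OF c] by (simp add: A[OF c(1)])
    finally show ?case using c A_cont[OF c(1)] by (simp add: A[OF c(1)])
  qed (use g in auto)
  let ?c = "(\<integral>y. ln (branch_mass y) \<partial>\<mu>) + entropy_rate"
  have "ereal ?c \<le> t_entropy A \<mu>"
    unfolding t_entropy_def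
  proof (rule INF_greatest)
    fix n :: nat assume n: "n \<in> {1..}"
    have "ereal (real n * ?c) \<le> (INF G\<in>partitions_of_unity.
        (\<Sum>g\<in>G. if (\<integral>x. g x \<partial>\<mu>) = 0 then 0
               else ereal (\<integral>x. g x \<partial>\<mu>) * eln ((\<integral>x. (A ^^ n) g x \<partial>\<mu>) / (\<integral>x. g x \<partial>\<mu>))))"
      unfolding entropy_rate_eq_fibre_entropy
    proof (rule INF_greatest, rule lower_bound[OF 2(2,3)])
      fix G :: "('a \<Rightarrow> real) set" assume G: "G \<in> partitions_of_unity"
      then show "G \<in> partitions_of_unity" .
      fix g assume "g \<in> G"
      then have g: "continuous_on UNIV g" "\<And>x. 0 \<le> g x" using G by (auto simp: partitions_of_unity_def)
      then show "0 \<le> (\<integral>x. (A ^^ n) g x \<partial>\<mu>)" using iter[OF g] by simp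
      show "(\<integral>\<^sup>+x. (transfer ^^ n) (\<lambda>z. ennreal (g z)) x \<partial>\<mu>) = ennreal (\<integral>x. (A ^^ n) g x \<partial>\<mu>)"
        using iter[OF g, of n] by (simp add: nn_integral_eq_integral integrable_mu)
    qed
    then show "ereal ?c \<le> (INF G\<in>partitions_of_unity.
        (\<Sum>g\<in>G. if (\<integral>x. g x \<partial>\<mu>) = 0 then 0
               else ereal (\<integral>x. g x \<partial>\<mu>) * eln ((\<integral>x. (A ^^ n) g x \<partial>\<mu>) / (\<integral>x. g x \<partial>\<mu>)))) / ereal (real n)"
      using n by (subst ereal_le_divide_pos) auto
  qed
  then show ?thesis using 2(1) by simp
qed

end

text \<open>Every finite partition has a fine refinement, and its rate is no smaller.\<close>

lemma (in non_contracting_system) ks_entropy_le: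
  assumes "\<And>P. fine_partition \<alpha> \<mu> P Y r \<Longrightarrow> ereal (invariant_partition.entropy_rate \<alpha> \<mu> P) \<le> c"
  shows "ks_entropy \<alpha> \<mu> \<le> c"
  unfolding ks_entropy_def
proof (rule SUP_least)
  fix Q :: "'a set set" assume "Q \<in> {P. finite P \<and> partition_on UNIV P \<and> P \<subseteq> sets borel}"
  then have Q: "finite Q" "partition_on UNIV Q" "Q \<subseteq> sets borel" by auto
  obtain P where P: "finite P" "partition_on UNIV P" "P \<subseteq> sets borel" "\<And>B. B \<in> P \<Longrightarrow> \<exists>C\<in>Q. B \<subseteq> C"
    "\<And>B y y'. B \<in> P \<Longrightarrow> y \<in> B \<Longrightarrow> y' \<in> B \<Longrightarrow> dist y y' \<le> r"
    by (rule fine_partition_exists[OF compact_univ r_pos Q]) (rule that)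
  interpret Q: invariant_partition \<alpha> \<mu> Q by unfold_locales (use Q in auto)
  interpret P: fine_partition \<alpha> \<mu> P Y r by unfold_locales (use P in auto)
  have "ereal Q.entropy_rate \<le> ereal P.entropy_rate"
    using entropy_rate_refine[OF Q.invariant_partition_axioms P.invariant_partition_axioms P(4)] by simp
  also have "\<dots> \<le> c" by (rule assms) (rule P.fine_partition_axioms)
  finally show "ereal (lim (\<lambda>n. partition_entropy \<mu> (dynamical_join \<alpha> n Q) / real n)) \<le> c"
    by (simp add: Q.lim_partition_entropy)
qed

lemma (in invariant_partition) entropy_rate_le_ks_entropy: "ereal entropy_rate \<le> ks_entropy \<alpha> \<mu>"
  unfolding ks_entropy_def lim_partition_entropy[symmetric]
  by (rule SUP_upper) (use fin part borel in auto)

lemma (in non_contracting_system) fine_partition_ex: "\<exists>P. fine_partition \<alpha> \<mu> P Y r"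
proof -
  have Q: "finite {UNIV :: 'a set}" "partition_on UNIV {UNIV :: 'a set}" "{UNIV :: 'a set} \<subseteq> sets borel"
    by (auto simp: partition_on_space)
  obtain P :: "'a set set" where P: "finite P" "partition_on UNIV P" "P \<subseteq> sets borel" "\<And>B. B \<in> P \<Longrightarrow> \<exists>C\<in>{UNIV}. B \<subseteq> C"
    "\<And>B y y'. B \<in> P \<Longrightarrow> y \<in> B \<Longrightarrow> y' \<in> B \<Longrightarrow> dist y y' \<le> r"
    by (rule fine_partition_exists[OF compact_univ r_pos Q]) (rule that)
  have "fine_partition \<alpha> \<mu> P Y r" by unfold_locales (use P in auto)
  then show ?thesis by blast
qed

text \<open>For each fine P, \<tau> is the integral plus the rate of P. A single P gives \<tau> at
  most the right-hand side; conversely, a finite integral can be subtracted from the identities of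
  all fine P before the supremum is taken.\<close>

theorem t_entropy_eq:
  fixes \<alpha> :: "'a::metric_space \<Rightarrow> 'a"
  assumes comp: "compact (UNIV :: 'a set)" and cont: "continuous_on UNIV \<alpha>"
    and nc: "non_contracting_on (essential_points \<alpha>) \<alpha>" and A: "transfer_operator \<alpha> A"
    and \<mu>: "\<mu> \<in> invariant_measures \<alpha>" and fin: "ks_entropy \<alpha> \<mu> < \<infinity>"
  shows "t_entropy A \<mu> = set_ereal_integral \<mu> (essential_points \<alpha>) (\<lambda>y. eln (cocycle \<alpha> A y)) + ks_entropy \<alpha> \<mu>"
proof -
  define Y where "Y = essential_points \<alpha>"
  define I where "I = set_ereal_integral \<mu> Y (\<lambda>y. eln (cocycle \<alpha> A y))"
  obtain r where r: "0 < r" "\<And>x y. x \<in> Y \<Longrightarrow> y \<in> Y \<Longrightarrow> dist x y \<le> r \<Longrightarrow> dist x y \<le> dist (\<alpha> x) (\<alpha> y)"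
    using nc unfolding non_contracting_on_def Y_def by blast
  interpret non_contracting_system \<alpha> \<mu> Y r
    unfolding Y_def by (rule non_contracting_systemI[OF comp cont \<mu> r(1)]) (use r(2) in \<open>auto simp: Y_def\<close>)
  obtain M where M: "fibre_kernel \<alpha> (transfer_measure A) M"
    using fibre_kernel_transfer_measure[OF comp cont A] by blast
  have kp: "kernel_partition \<alpha> \<mu> P Y r (transfer_measure A) M" if "fine_partition \<alpha> \<mu> P Y r" for P
    using that M by (simp add: kernel_partition_def)
  have A_eq: "A f x = (\<integral>z. f z \<partial>transfer_measure A x)" if "continuous_on UNIV f" for f x
    using transfer_measure(3)[OF comp A that] by simp
  have A_cont: "continuous_on UNIV (A f)" if "continuous_on UNIV f" for f
    using A that by (simp add: transfer_operator_def)
  have I_eq: "kernel_partition.log_integral \<alpha> \<mu> P Y (transfer_measure A) = I"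
    if P: "kernel_partition \<alpha> \<mu> P Y r (transfer_measure A) M" for P
  proof -
    interpret kernel_partition \<alpha> \<mu> P Y r "transfer_measure A" M by (rule P)
    have "e2ennreal (eln (branch_mass y)) * indicator Y y = e2ennreal (eln (cocycle \<alpha> A y)) * indicator Y y"
      "e2ennreal (- eln (branch_mass y)) * indicator Y y = e2ennreal (- eln (cocycle \<alpha> A y)) * indicator Y y" for y
      by (auto simp: indicator_def branch_mass_eq cocycle_def)
    then show ?thesis unfolding log_integral_def I_def set_ereal_integral_def by simp
  qed
  have ge: "I + ereal (invariant_partition.entropy_rate \<alpha> \<mu> P) \<le> t_entropy A \<mu>" 
    and le: "t_entropy A \<mu> \<le> I + ereal (invariant_partition.entropy_rate \<alpha> \<mu> P)"
    if "fine_partition \<alpha> \<mu> P Y r" for P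
    using kernel_partition.t_entropy_ge[OF kp[OF that] A_eq A_cont]
      kernel_partition.t_entropy_le[OF kp[OF that] A_eq] I_eq[OF kp[OF that]] by auto
  obtain P where P: "fine_partition \<alpha> \<mu> P Y r" using fine_partition_ex by blast
  interpret P: fine_partition \<alpha> \<mu> P Y r by (rule P)
  have "t_entropy A \<mu> = I + ks_entropy \<alpha> \<mu>"
  proof (rule antisym)
    have "t_entropy A \<mu> \<le> I + ereal P.entropy_rate" by (rule le[OF P])
    also have "\<dots> \<le> I + ks_entropy \<alpha> \<mu>" by (intro add_left_mono P.entropy_rate_le_ks_entropy)
    finally show "t_entropy A \<mu> \<le> I + ks_entropy \<alpha> \<mu>" .
    interpret K: kernel_partition \<alpha> \<mu> P Y r "transfer_measure A" M by (rule kp[OF P])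
    show "I + ks_entropy \<alpha> \<mu> \<le> t_entropy A \<mu>"
    proof (cases rule: K.log_integral_cases)
      case 1
      then have "I = -\<infinity>" using I_eq[OF kp[OF P]] by simp
      \<comment> \<open>The sum of -\<infinity> and \<infinity> is \<infinity> in
        \<open>ereal\<close>; finiteness of \<open>h\<close> keeps the right-hand side at
        -\<infinity>.\<close>
      then show ?thesis using fin by (cases "ks_entropy \<alpha> \<mu>") auto
    next
      case 2
      then obtain l where l: "I = ereal l" using I_eq[OF kp[OF P]] by simp
      have "ks_entropy \<alpha> \<mu> \<le> t_entropy A \<mu> - ereal l"
      proof (rule ks_entropy_le)
        fix P' assume "fine_partition \<alpha> \<mu> P' Y r"
        then show "ereal (invariant_partition.entropy_rate \<alpha> \<mu> P') \<le> t_entropy A \<mu> - ereal l"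
          using ge[of P'] l by (simp add: ereal_le_minus_iff add.commute)
      qed
      then show ?thesis using l by (simp add: ereal_le_minus_iff add.commute)
    qed
  qed
  then show ?thesis by (simp add: I_def Y_def)
qed

section \<open>Expanding maps\<close>

text \<open>Two points of a fibre within Y at distance at most r coincide, so a ball of radius r / 2
  contains at most one of them.\<close>

lemma fibre_card_le:
  fixes \<alpha> :: "'a::metric_space \<Rightarrow> 'a"
  assumes "compact (UNIV :: 'a set)" "0 < r"
    and nc: "\<And>x y. x \<in> Y \<Longrightarrow> y \<in> Y \<Longrightarrow> dist x y \<le> r \<Longrightarrow> dist x y \<le> dist (\<alpha> x) (\<alpha> y)"
  shows "\<exists>N. \<forall>x. finite (\<alpha> -` {x} \<inter> Y) \<and> card (\<alpha> -` {x} \<inter> Y) \<le> N"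
proof -
  have "0 < r / 2" using assms(2) by simp
  then obtain Z :: "'a set" where Z: "finite Z" "UNIV \<subseteq> (\<Union>z\<in>Z. ball z (r / 2))"
    using compact_ball_cover[OF assms(1), of "r / 2"] by auto
  have "\<exists>z. z \<in> Z \<and> dist z y < r / 2" for y
  proof -
    have "y \<in> (\<Union>z\<in>Z. ball z (r / 2))" using Z(2) by (rule subsetD) simp
    then show ?thesis by auto
  qed
  then obtain c where c: "\<And>y. c y \<in> Z" "\<And>y. dist (c y) y < r / 2" by metis
  have "finite (\<alpha> -` {x} \<inter> Y) \<and> card (\<alpha> -` {x} \<inter> Y) \<le> card Z" for x
  proof -
    have inj: "inj_on c (\<alpha> -` {x} \<inter> Y)"
    proof (rule inj_onI)
      fix y y' assume y: "y \<in> \<alpha> -` {x} \<inter> Y" "y' \<in> \<alpha> -` {x} \<inter> Y" "c y = c y'"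
      have "dist y y' < r"
        by (rule dist_triangle_half_r[of "c y"]) (use c(2)[of y] c(2)[of y'] y(3) in auto)
      then have "dist y y' \<le> dist (\<alpha> y) (\<alpha> y')" using y by (intro nc) auto
      then show "y = y'" using y by simp
    qed
    have sub: "c ` (\<alpha> -` {x} \<inter> Y) \<subseteq> Z" using c(1) by blast
    show ?thesis
      using inj_on_finite[OF inj sub Z(1)] card_inj_on_le[OF inj sub Z(1)] by simp
  qed
  then show ?thesis by blast
qed

text \<open>For x near x0 the fibre over x has exactly one point near each point of the fibre over
  x0 and no others: openness gives at least one, non-contraction at most one, and compactness none
  elsewhere.\<close>

lemma continuous_on_fibre_sum:
  fixes \<alpha> :: "'a::metric_space \<Rightarrow> 'a" and f :: "'a \<Rightarrow> real"
  assumes comp: "compact (UNIV :: 'a set)" and cont: "continuous_on UNIV \<alpha>" and Y: "closed Y"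
    and open_Y: "open_map (top_of_set Y) (top_of_set Y) \<alpha>" and r: "0 < r"
    and nc: "\<And>x y. x \<in> Y \<Longrightarrow> y \<in> Y \<Longrightarrow> dist x y \<le> r \<Longrightarrow> dist x y \<le> dist (\<alpha> x) (\<alpha> y)"
    and f: "continuous_on UNIV f"
  shows "continuous_on Y (\<lambda>x. \<Sum>z\<in>\<alpha> -` {x} \<inter> Y. f z)"
  unfolding continuous_on_def tendsto_iff
proof (intro ballI allI impI)
  fix x0 and e :: real assume x0: "x0 \<in> Y" and e: "0 < e"
  define F0 where "F0 = \<alpha> -` {x0} \<inter> Y"
  have fin: "finite F0" using fibre_card_le[OF comp r nc] by (auto simp: F0_def)
  \<comment> \<open>The \<open>+ 1\<close> allows for an empty fibre.\<close>
  define \<epsilon> where "\<epsilon> = e / (real (card F0) + 1)"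
  have \<epsilon>: "0 < \<epsilon>" "real (card F0) * \<epsilon> < e" using e by (auto simp: \<epsilon>_def field_simps)
  have "uniformly_continuous_on UNIV f" using comp f by (intro compact_uniformly_continuous)
  then obtain d where d: "0 < d" "\<And>z z'. dist z' z < d \<Longrightarrow> dist (f z') (f z) < \<epsilon>"
    unfolding uniformly_continuous_on_def using \<epsilon>(1) by (metis UNIV_I)
  \<comment> \<open>The bound r / 2 makes \<alpha> injective on each U z, and it prevents a point
    from lying in U z for two different z in F0.\<close>
  define \<delta> where "\<delta> = min d (r / 2)"
  have \<delta>: "0 < \<delta>" "\<delta> \<le> d" "\<delta> \<le> r / 2" using d r by (auto simp: \<delta>_def)
  define U where "U z = Y \<inter> ball z \<delta>" for z
  have ev1: "\<forall>\<^sub>F x in at x0 within Y. x \<in> \<alpha> ` U z" if z: "z \<in> F0" for z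
  proof -
    have "openin (top_of_set Y) (U z)" unfolding U_def by (intro openin_open_Int) auto
    then have "openin (top_of_set Y) (\<alpha> ` U z)" using open_Y by (simp add: open_map_def)
    then obtain T where T: "open T" "\<alpha> ` U z = Y \<inter> T" by (auto simp: openin_open)
    have "z \<in> U z" using z \<delta> by (simp add: U_def F0_def)
    then have "x0 \<in> \<alpha> ` U z" using z by (auto simp: F0_def)
    then have "x0 \<in> T" using T by blast
    then show ?thesis unfolding T(2) eventually_at_topological using T(1) by blast
  qed
  have ev2: "\<forall>\<^sub>F x in at x0 within Y. x \<notin> \<alpha> ` (Y - (\<Union>z\<in>F0. U z))"
  proof -
    define C where "C = Y - (\<Union>z\<in>F0. ball z \<delta>)"
    have "closed C" unfolding C_def using Y by (intro closed_Diff) auto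
    then have "compact C" using compact_Int_closed[OF comp] by simp
    then have "compact (\<alpha> ` C)" using cont by (intro compact_continuous_image continuous_on_subset[OF cont]) auto
    then have "open (- \<alpha> ` C)" by (simp add: compact_imp_closed open_Compl)
    moreover have "x0 \<in> - \<alpha> ` C"
    proof -
      have "\<alpha> y \<noteq> x0" if "y \<in> C" for y
      proof
        assume "\<alpha> y = x0"
        then have "y \<in> F0" using that by (simp add: F0_def C_def)
        then show False using that \<delta> by (auto simp: C_def)
      qed
      then show ?thesis by blast
    qed
    moreover have "Y - (\<Union>z\<in>F0. U z) = C" by (auto simp: C_def U_def)
    ultimately show ?thesis unfolding eventually_at_topological by (intro exI[of _ "- \<alpha> ` C"]) auto
  qed
  have "\<forall>\<^sub>F x in at x0 within Y. \<forall>z\<in>F0. x \<in> \<alpha> ` U z"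
    using fin ev1 by (simp add: eventually_ball_finite)
  then show "\<forall>\<^sub>F x in at x0 within Y. dist (\<Sum>z\<in>\<alpha> -` {x} \<inter> Y. f z) (\<Sum>z\<in>\<alpha> -` {x0} \<inter> Y. f z) < e"
    using ev2
  proof eventually_elim
    case (elim x)
    have "\<forall>z\<in>F0. \<exists>s. s \<in> U z \<and> \<alpha> s = x" using elim(1) by blast
    then obtain s where s: "\<And>z. z \<in> F0 \<Longrightarrow> s z \<in> U z" "\<And>z. z \<in> F0 \<Longrightarrow> \<alpha> (s z) = x" by metis
    have uniq: "y = y'" if "y \<in> U z" "y' \<in> U z" "\<alpha> y = x" "\<alpha> y' = x" for y y' z
    proof -
      have "dist y y' < r"
        by (rule dist_triangle_half_r[of z]) (use that \<delta> in \<open>auto simp: U_def\<close>)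
      then have "dist y y' \<le> dist (\<alpha> y) (\<alpha> y')" using that by (intro nc) (auto simp: U_def)
      then show ?thesis using that by simp
    qed
    have "inj_on s F0"
    proof (rule inj_onI)
      fix z z' assume z: "z \<in> F0" "z' \<in> F0" "s z = s z'"
      have "dist z z' < r"
        by (rule dist_triangle_half_l[of z "s z"])
          (use s(1)[OF z(1)] s(1)[OF z(2)] z(3) \<delta> in \<open>auto simp: U_def dist_commute\<close>)
      then have "dist z z' \<le> dist (\<alpha> z) (\<alpha> z')" using z by (intro nc) (auto simp: F0_def)
      then show "z = z'" using z by (simp add: F0_def)
    qed
    moreover have "\<alpha> -` {x} \<inter> Y = s ` F0"
    proof
      show "s ` F0 \<subseteq> \<alpha> -` {x} \<inter> Y" using s by (auto simp: U_def)
      show "\<alpha> -` {x} \<inter> Y \<subseteq> s ` F0"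
      proof
        fix y assume y: "y \<in> \<alpha> -` {x} \<inter> Y"
        then obtain z where z: "z \<in> F0" "y \<in> U z" using elim(2) by blast
        have "y = s z" using y by (intro uniq[OF z(2) s(1)[OF z(1)] _ s(2)[OF z(1)]]) simp
        then show "y \<in> s ` F0" using z by blast
      qed
    qed
    ultimately have "(\<Sum>z\<in>\<alpha> -` {x} \<inter> Y. f z) = (\<Sum>z\<in>F0. f (s z))" by (simp add: sum.reindex)
    then have "dist (\<Sum>z\<in>\<alpha> -` {x} \<inter> Y. f z) (\<Sum>z\<in>F0. f z) = \<bar>\<Sum>z\<in>F0. f (s z) - f z\<bar>"
      by (simp add: dist_real_def sum_subtractf)
    also have "\<dots> \<le> (\<Sum>z\<in>F0. \<bar>f (s z) - f z\<bar>)" by (rule sum_abs)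
    also have "\<dots> \<le> (\<Sum>z\<in>F0. \<epsilon>)"
    proof (rule sum_mono)
      fix z assume "z \<in> F0"
      then have "dist (s z) z < d" using s(1) \<delta> by (force simp: U_def dist_commute)
      then show "\<bar>f (s z) - f z\<bar> \<le> \<epsilon>" using d(2)[of "s z" z] by (simp add: dist_real_def)
    qed
    also have "\<dots> < e" using \<epsilon>(2) by simp
    finally show ?case by (simp add: F0_def)
  qed
qed

text \<open>Counting measure on the fibre is transported to the Borel sets of the whole space, where
  \<open>fibre_kernel\<close> expects its measures.\<close>

definition counting_kernel :: "('a::metric_space \<Rightarrow> 'a) \<Rightarrow> 'a set \<Rightarrow> 'a \<Rightarrow> 'a measure" where
  "counting_kernel \<alpha> Y x = distr (count_space (\<alpha> -` {x} \<inter> Y)) borel (\<lambda>z. z)"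

lemma emeasure_counting_kernel:
  assumes "finite (\<alpha> -` {x} \<inter> Y)" "E \<in> sets borel"
  shows "emeasure (counting_kernel \<alpha> Y x) E = real (card (E \<inter> (\<alpha> -` {x} \<inter> Y)))"
proof -
  let ?F = "\<alpha> -` {x} \<inter> Y"
  have "emeasure (count_space ?F) (E \<inter> ?F) = of_nat (card (E \<inter> ?F))"
    by (rule emeasure_count_space_finite) (use assms(1) in auto)
  then show ?thesis
    unfolding counting_kernel_def using assms(2)
    by (subst emeasure_distr) (auto simp: ennreal_of_nat_eq_real_of_nat)
qed

lemma integral_counting_kernel:
  fixes f :: "'a::metric_space \<Rightarrow> real"
  assumes "finite (\<alpha> -` {x} \<inter> Y)" "f \<in> borel_measurable borel"
  shows "(\<integral>z. f z \<partial>counting_kernel \<alpha> Y x) = (\<Sum>z\<in>\<alpha> -` {x} \<inter> Y. f z)"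
  unfolding counting_kernel_def using assms
  by (subst integral_distr) (auto simp: lebesgue_integral_count_space_finite)

lemma fibre_kernel_counting_kernel:
  fixes \<alpha> :: "'a::metric_space \<Rightarrow> 'a"
  assumes comp: "compact (UNIV :: 'a set)" and cont: "continuous_on UNIV \<alpha>" and Y: "closed Y" "\<alpha> ` Y \<subseteq> Y"
    and open_Y: "open_map (top_of_set Y) (top_of_set Y) \<alpha>" and r: "0 < r"
    and nc: "\<And>x y. x \<in> Y \<Longrightarrow> y \<in> Y \<Longrightarrow> dist x y \<le> r \<Longrightarrow> dist x y \<le> dist (\<alpha> x) (\<alpha> y)"
  shows "\<exists>M. fibre_kernel \<alpha> (counting_kernel \<alpha> Y) M"
proof -
  from fibre_card_le[OF comp r nc] obtain N where "\<forall>x. finite (\<alpha> -` {x} \<inter> Y) \<and> card (\<alpha> -` {x} \<inter> Y) \<le> N" ..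
  then have N: "\<And>x. finite (\<alpha> -` {x} \<inter> Y)" "\<And>x. card (\<alpha> -` {x} \<inter> Y) \<le> N" by simp_all
  have "fibre_kernel \<alpha> (counting_kernel \<alpha> Y) (real N)"
  proof
    fix x
    show "sets (counting_kernel \<alpha> Y x) = sets borel" by (simp add: counting_kernel_def)
    show "emeasure (counting_kernel \<alpha> Y x) UNIV \<le> ennreal (real N)"
      using N by (simp add: emeasure_counting_kernel ennreal_leI)
    have "{z. \<alpha> z = x} \<in> sets borel"
      using continuous_closed_vimage[of "{x}" \<alpha>] cont by (simp add: vimage_def borel_closed continuous_on_eq_continuous_at)
    then show "AE z in counting_kernel \<alpha> Y x. \<alpha> z = x"
      unfolding counting_kernel_def by (subst AE_distr_iff) (auto simp: AE_count_space)
  next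
    fix f :: "'a \<Rightarrow> real" assume f: "continuous_on UNIV f"
    then have fm: "f \<in> borel_measurable borel" by (rule borel_measurable_continuous_onI)
    \<comment> \<open>Points outside Y have no preimage in Y, so the fibre sum is 0 there and
      continuity on the closed set Y yields measurability.\<close>
    have "(\<lambda>x. \<integral>z. f z \<partial>counting_kernel \<alpha> Y x) = (\<lambda>x. indicator Y x *\<^sub>R (\<Sum>z\<in>\<alpha> -` {x} \<inter> Y. f z))"
    proof
      fix x
      show "(\<integral>z. f z \<partial>counting_kernel \<alpha> Y x) = indicator Y x *\<^sub>R (\<Sum>z\<in>\<alpha> -` {x} \<inter> Y. f z)"
      proof (cases "x \<in> Y")
        case False
        then have "\<alpha> -` {x} \<inter> Y = {}" using Y(2) by blast
        then show ?thesis using integral_counting_kernel[OF N(1) fm] by simp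
      qed (simp add: integral_counting_kernel[OF N(1) fm])
    qed
    then show "(\<lambda>x. \<integral>z. f z \<partial>counting_kernel \<alpha> Y x) \<in> borel_measurable borel"
      using borel_measurable_continuous_on_indicator[OF borel_closed[OF Y(1)]
          continuous_on_fibre_sum[OF comp cont Y(1) open_Y r nc f]] by simp
  qed (use comp cont in \<open>auto intro: borel_measurable_continuous_onI\<close>)
  then show ?thesis by blast
qed

lemma continuous_extension_real:
  fixes \<Phi> :: "'a::metric_space \<Rightarrow> real"
  assumes "closed Y" "continuous_on Y \<Phi>"
  obtains \<Psi> where "continuous_on UNIV \<Psi>" "\<And>x. x \<in> Y \<Longrightarrow> \<Psi> x = \<Phi> x"
proof -
  have n: "normal_space (euclidean :: 'a topology)"
    by (rule metrizable_imp_normal_space) (rule metrizable_space_euclidean)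
  have c: "closedin euclidean Y" using assms(1) by simp
  have m: "continuous_map (top_of_set Y) euclideanreal \<Phi>" using assms(2) by simp
  obtain \<Psi> where "continuous_map euclidean euclideanreal \<Psi>" "\<And>x. x \<in> Y \<Longrightarrow> \<Psi> x = \<Phi> x"
    by (rule Tietze_extension_realinterval[OF n c is_interval_univ _ m]) auto
  then show ?thesis using that[of \<Psi>] by simp
qed

section \<open>Variational formula and semicontinuity of the entropy\<close>

context
  fixes \<alpha> :: "'a::metric_space \<Rightarrow> 'a" and r :: real
  assumes comp: "compact (UNIV :: 'a set)" and cont: "continuous_on UNIV \<alpha>"
    and open_ess: "open_on_ess \<alpha>" and r: "0 < r"
    and nc: "\<And>x y. x \<in> essential_points \<alpha> \<Longrightarrow> y \<in> essential_points \<alpha> \<Longrightarrow> dist x y \<le> r \<Longrightarrow> dist x y \<le> dist (\<alpha> x) (\<alpha> y)"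
begin

abbreviation (input) "ess_kernel \<equiv> counting_kernel \<alpha> (essential_points \<alpha>)"

lemma system: "\<mu> \<in> invariant_measures \<alpha> \<Longrightarrow> non_contracting_system \<alpha> \<mu> (essential_points \<alpha>) r"
  by (rule non_contracting_systemI[OF comp cont _ r nc])

lemma counting_kernel_partition:
  assumes \<mu>: "\<mu> \<in> invariant_measures \<alpha>"
  obtains M where "\<And>P. fine_partition \<alpha> \<mu> P (essential_points \<alpha>) r \<Longrightarrow> kernel_partition \<alpha> \<mu> P (essential_points \<alpha>) r ess_kernel M"
proof -
  have "\<alpha> ` essential_points \<alpha> \<subseteq> essential_points \<alpha>"
    using non_contracting_system.image_Y[OF system[OF \<mu>]] .
  then obtain M where "fibre_kernel \<alpha> ess_kernel M"
    using fibre_kernel_counting_kernel[OF comp cont closed_essential_points _ open_ess[unfolded open_on_ess_def] r nc] by blast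
  then show ?thesis by (intro that[of M]) (simp add: kernel_partition_def)
qed

lemma finite_fibre: "finite (\<alpha> -` {x} \<inter> essential_points \<alpha>)"
proof -
  from fibre_card_le[OF comp r nc] obtain N
    where "\<forall>x. finite (\<alpha> -` {x} \<inter> essential_points \<alpha>) \<and> card (\<alpha> -` {x} \<inter> essential_points \<alpha>) \<le> N" ..
  then show ?thesis by simp
qed

lemma branch_mass_counting:
  assumes "kernel_partition \<alpha> \<mu> P (essential_points \<alpha>) r ess_kernel M" "y \<in> essential_points \<alpha>"
  shows "kernel_partition.branch_mass \<alpha> P (essential_points \<alpha>) ess_kernel y = 1"
proof -
  interpret kernel_partition \<alpha> \<mu> P "essential_points \<alpha>" r ess_kernel M by fact
  have "{y} \<inter> (\<alpha> -` {\<alpha> y} \<inter> essential_points \<alpha>) = {y}" using assms(2) by blast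
  then have "emeasure (ess_kernel (\<alpha> y)) {y} = 1"
    using emeasure_counting_kernel[OF finite_fibre, of "{y}" "\<alpha> y"] by simp
  then show ?thesis by (simp add: branch_mass_eq[OF assms(2)] measure_def)
qed

text \<open>The expression bounded in \<open>fibre_entropy_le_test\<close>, for the counting kernel.
  The next two lemmas show that its infimum over positive continuous T is
  \<open>ks_entropy\<close>.\<close>

definition test_integral :: "'a measure \<Rightarrow> ('a \<Rightarrow> real) \<Rightarrow> real" where
  "test_integral \<mu> T = - (\<integral>x. ln (T x) \<partial>\<mu>) + (\<integral>x. (\<integral>z. T z \<partial>ess_kernel x) \<partial>\<mu>) - 1"

text \<open>One T bounds the rates of all fine partitions at once, hence their supremum.\<close>

lemma ks_entropy_le_test_integral:
  assumes \<mu>: "\<mu> \<in> invariant_measures \<alpha>" and T: "continuous_on UNIV T" "\<And>x. 0 < T x"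
  shows "ks_entropy \<alpha> \<mu> \<le> ereal (test_integral \<mu> T)"
proof (rule non_contracting_system.ks_entropy_le[OF system[OF \<mu>]])
  obtain M where M: "\<And>P. fine_partition \<alpha> \<mu> P (essential_points \<alpha>) r \<Longrightarrow> kernel_partition \<alpha> \<mu> P (essential_points \<alpha>) r ess_kernel M"
    by (rule counting_kernel_partition[OF \<mu>]) blast
  fix P assume "fine_partition \<alpha> \<mu> P (essential_points \<alpha>) r"
  then have kp: "kernel_partition \<alpha> \<mu> P (essential_points \<alpha>) r ess_kernel M" by (rule M)
  interpret kernel_partition \<alpha> \<mu> P "essential_points \<alpha>" r ess_kernel M by (rule kp)
  show "ereal entropy_rate \<le> ereal (test_integral \<mu> T)"
    using fibre_entropy_le_test[OF branch_mass_counting[OF kp] T]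
    by (simp add: entropy_rate_eq_fibre_entropy test_integral_def mean_def)
qed

lemma test_integral_approx:
  assumes \<mu>: "\<mu> \<in> invariant_measures \<alpha>" and c: "ks_entropy \<alpha> \<mu> < c"
  obtains T where "continuous_on UNIV T" "\<And>x. 0 < T x" "ereal (test_integral \<mu> T) < c"
proof -
  interpret non_contracting_system \<alpha> \<mu> "essential_points \<alpha>" r by (rule system[OF \<mu>])
  obtain P where P: "fine_partition \<alpha> \<mu> P (essential_points \<alpha>) r" using fine_partition_ex by blast
  obtain M where M: "\<And>P. fine_partition \<alpha> \<mu> P (essential_points \<alpha>) r \<Longrightarrow> kernel_partition \<alpha> \<mu> P (essential_points \<alpha>) r ess_kernel M"
    by (rule counting_kernel_partition[OF \<mu>]) blast
  have kp: "kernel_partition \<alpha> \<mu> P (essential_points \<alpha>) r ess_kernel M" using P by (rule M)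
  interpret kernel_partition \<alpha> \<mu> P "essential_points \<alpha>" r ess_kernel M by (rule kp)
  have "ereal fibre_entropy < c"
    using entropy_rate_le_ks_entropy c by (simp add: entropy_rate_eq_fibre_entropy order_le_less_trans)
  then obtain b where b: "ereal fibre_entropy < ereal b" "ereal b < c" using ereal_dense2 by blast
  \<comment> \<open>One e absorbs the error of the test function, the other the integral of ln (1 +
    e).\<close>
  define e where "e = (b - fibre_entropy) / 2"
  have e: "0 < e" using b(1) by (simp add: e_def)
  obtain T where T: "continuous_on UNIV T" "\<And>x. 0 < T x"
      "- (\<integral>x. ln (T x) \<partial>\<mu>) + mean T - 1 \<le> (\<integral>y. ln (branch_mass y + e) \<partial>\<mu>) + fibre_entropy + e"
    by (rule test_function_exists[OF e e]) blast
  have "(\<integral>y. ln (branch_mass y + e) \<partial>\<mu>) = (\<integral>y. ln (1 + e) \<partial>\<mu>)"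
    by (rule integral_cong_AE) (use AE_Y branch_mass_counting[OF kp] in \<open>auto elim!: eventually_mono\<close>)
  also have "\<dots> \<le> e" using ln_add_one_self_le_self[of e] e by simp
  finally have "(\<integral>y. ln (branch_mass y + e) \<partial>\<mu>) \<le> e" .
  moreover have "b = fibre_entropy + 2 * e" by (simp add: e_def field_simps)
  ultimately have "test_integral \<mu> T \<le> b" using T(3) unfolding test_integral_def mean_def by linarith
  then have "ereal (test_integral \<mu> T) < c" using b(2) by (meson ereal_less_eq(3) order_le_less_trans)
  then show ?thesis using that T by blast
qed

text \<open>The integrand is known to be continuous only on the essential points. Invariant measures
  live there, so a Tietze extension has the same integrals, and one \<Psi> serves all of these
  measures, as a weak-* neighbourhood requires.\<close>

lemma test_integral_continuous:
  assumes T: "continuous_on UNIV T" "\<And>x. 0 < T x"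
  obtains \<Psi> where "continuous_on UNIV \<Psi>" "\<And>\<mu>. \<mu> \<in> invariant_measures \<alpha> \<Longrightarrow> test_integral \<mu> T = (\<integral>x. \<Psi> x \<partial>\<mu>)"
proof -
  define \<Phi> where "\<Phi> x = - ln (T x) + (\<Sum>z\<in>\<alpha> -` {x} \<inter> essential_points \<alpha>. T z) - 1" for x
  have "continuous_on (essential_points \<alpha>) \<Phi>"
    unfolding \<Phi>_def
  proof (intro continuous_intros)
    show "continuous_on (essential_points \<alpha>) T" using T(1) by (rule continuous_on_subset) simp
    show "continuous_on (essential_points \<alpha>) (\<lambda>x. \<Sum>z\<in>\<alpha> -` {x} \<inter> essential_points \<alpha>. T z)"
      by (rule continuous_on_fibre_sum[OF comp cont closed_essential_points open_ess[unfolded open_on_ess_def] r nc T(1)])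
  qed (use T(2) in \<open>auto simp: less_imp_neq[symmetric]\<close>)
  then obtain \<Psi> where \<Psi>: "continuous_on UNIV \<Psi>" "\<And>x. x \<in> essential_points \<alpha> \<Longrightarrow> \<Psi> x = \<Phi> x"
    using continuous_extension_real[OF closed_essential_points] by blast
  have "test_integral \<mu> T = (\<integral>x. \<Psi> x \<partial>\<mu>)" if \<mu>: "\<mu> \<in> invariant_measures \<alpha>" for \<mu>
  proof -
    interpret non_contracting_system \<alpha> \<mu> "essential_points \<alpha>" r by (rule system[OF \<mu>])
    obtain P where P: "fine_partition \<alpha> \<mu> P (essential_points \<alpha>) r" using fine_partition_ex by blast
    obtain M where M: "\<And>P. fine_partition \<alpha> \<mu> P (essential_points \<alpha>) r \<Longrightarrow> kernel_partition \<alpha> \<mu> P (essential_points \<alpha>) r ess_kernel M"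
      by (rule counting_kernel_partition[OF \<mu>]) blast
    interpret kernel_partition \<alpha> \<mu> P "essential_points \<alpha>" r ess_kernel M using P by (rule M)
    have Tm: "T \<in> borel_measurable borel" using T(1) by (rule borel_measurable_continuous_onI)
    have lnT: "continuous_on UNIV (\<lambda>x. ln (T x))"
      using T by (intro continuous_intros) (auto simp: less_imp_neq[symmetric])
    have "test_integral \<mu> T = (\<integral>x. - ln (T x) + (\<integral>z. T z \<partial>ess_kernel x) - 1 \<partial>\<mu>)"
      unfolding test_integral_def using integrable_mu[OF lnT] integrable_mu_nu[OF T(1)] by simp
    also have "\<dots> = (\<integral>x. \<Psi> x \<partial>\<mu>)"
    proof (rule integral_cong_AE)
      show "(\<lambda>x. - ln (T x) + (\<integral>z. T z \<partial>ess_kernel x) - 1) \<in> borel_measurable \<mu>"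
        using borel_measurable_integrable[OF integrable_mu[OF lnT]] borel_measurable_integrable[OF integrable_mu_nu[OF T(1)]]
        by (intro borel_measurable_diff borel_measurable_add borel_measurable_uminus) auto
      show "\<Psi> \<in> borel_measurable \<mu>" by (rule borel_measurable_integrable[OF integrable_mu[OF \<Psi>(1)]])
      show "AE x in \<mu>. - ln (T x) + (\<integral>z. T z \<partial>ess_kernel x) - 1 = \<Psi> x"
        using AE_Y by eventually_elim (simp add: \<Psi>(2) \<Phi>_def integral_counting_kernel[OF finite_fibre Tm])
    qed
    finally show ?thesis .
  qed
  then show ?thesis using that \<Psi>(1) by blast
qed

lemma ks_entropy_range: "ks_entropy \<alpha> \<in> invariant_measures \<alpha> \<rightarrow> {0..<\<infinity>}"
proof
  fix \<mu> assume \<mu>: "\<mu> \<in> invariant_measures \<alpha>"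
  interpret non_contracting_system \<alpha> \<mu> "essential_points \<alpha>" r by (rule system[OF \<mu>])
  obtain P where P: "fine_partition \<alpha> \<mu> P (essential_points \<alpha>) r" using fine_partition_ex by blast
  interpret P: fine_partition \<alpha> \<mu> P "essential_points \<alpha>" r by (rule P)
  have "0 \<le> P.entropy_rate"
    by (rule LIMSEQ_le_const[OF P.entropy_rate]) (auto simp: P.block_entropy_nonneg)
  then have "0 \<le> ks_entropy \<alpha> \<mu>"
    using P.entropy_rate_le_ks_entropy by (metis ereal_less_eq(5) order_trans)
  \<comment> \<open>T = 1 gives the mean number of preimages in the essential set minus 1, a finite
    bound.\<close>
  moreover have "ks_entropy \<alpha> \<mu> \<le> ereal (test_integral \<mu> (\<lambda>_. 1))"
    by (rule ks_entropy_le_test_integral[OF \<mu>]) auto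
  ultimately show "ks_entropy \<alpha> \<mu> \<in> {0..<\<infinity>}" by auto
qed

lemma topspace_weak_star: "topspace (weak_star_topology M) = M"
  unfolding weak_star_topology_def topology_generated_by_topspace
proof
  show "M \<subseteq> \<Union>{{\<mu> \<in> M. (\<integral>x. f x \<partial>\<mu>) \<in> U} |f U. continuous_on UNIV f \<and> open (U :: real set)}"
  proof
    fix \<mu> assume "\<mu> \<in> M"
    then have "\<mu> \<in> {\<mu> \<in> M. (\<integral>x. 0 \<partial>\<mu>) \<in> (UNIV :: real set)}" by simp
    moreover have "{\<mu> \<in> M. (\<integral>x. 0 \<partial>\<mu>) \<in> (UNIV :: real set)}
        \<in> {{\<mu> \<in> M. (\<integral>x. f x \<partial>\<mu>) \<in> U} |f U. continuous_on UNIV f \<and> open (U :: real set)}"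
      by (intro CollectI exI[of _ "\<lambda>_. 0"] exI[of _ UNIV] conjI refl) auto
    ultimately show "\<mu> \<in> \<Union>{{\<mu> \<in> M. (\<integral>x. f x \<partial>\<mu>) \<in> U} |f U. continuous_on UNIV f \<and> open (U :: real set)}"
      by (rule UnionI[rotated])
  qed
qed blast

lemma ks_entropy_usc: "upper_semicontinuous_map (weak_star_topology (invariant_measures \<alpha>)) (ks_entropy \<alpha>)"
  unfolding upper_semicontinuous_map_def topspace_weak_star
proof
  fix c :: ereal
  let ?X = "weak_star_topology (invariant_measures \<alpha>)"
  have "\<exists>V. openin ?X V \<and> \<mu> \<in> V \<and> V \<subseteq> {\<mu> \<in> invariant_measures \<alpha>. ks_entropy \<alpha> \<mu> < c}"
    if \<mu>: "\<mu> \<in> invariant_measures \<alpha>" "ks_entropy \<alpha> \<mu> < c" for \<mu>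
  proof -
    obtain T where T: "continuous_on UNIV T" "\<And>x. 0 < T x" "ereal (test_integral \<mu> T) < c"
      by (rule test_integral_approx[OF \<mu>]) blast
    obtain \<Psi> where \<Psi>: "continuous_on UNIV \<Psi>" "\<And>\<mu>. \<mu> \<in> invariant_measures \<alpha> \<Longrightarrow> test_integral \<mu> T = (\<integral>x. \<Psi> x \<partial>\<mu>)"
      by (rule test_integral_continuous[OF T(1,2)]) blast
    define U where "U = {t. ereal t < c}"
    have "open U" unfolding U_def by (intro open_Collect_less continuous_intros)
    \<comment> \<open>A subbasic open set of the weak-* topology; by the choice of \<Psi>, it
      consists of the measures whose test integral at this T is below c.\<close>
    define V where "V = {\<mu> \<in> invariant_measures \<alpha>. (\<integral>x. \<Psi> x \<partial>\<mu>) \<in> U}"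
    have "openin ?X V"
      unfolding weak_star_topology_def
      by (rule topology_generated_by_Basis) (use \<Psi>(1) \<open>open U\<close> in \<open>auto simp: V_def\<close>)
    moreover have "\<mu> \<in> V" using \<mu>(1) T(3) \<Psi>(2)[OF \<mu>(1)] by (simp add: V_def U_def)
    moreover have "V \<subseteq> {\<mu> \<in> invariant_measures \<alpha>. ks_entropy \<alpha> \<mu> < c}"
    proof
      fix \<mu>' assume "\<mu>' \<in> V"
      then have \<mu>': "\<mu>' \<in> invariant_measures \<alpha>" "ereal (test_integral \<mu>' T) < c"
        using \<Psi>(2) by (auto simp: V_def U_def)
      then show "\<mu>' \<in> {\<mu> \<in> invariant_measures \<alpha>. ks_entropy \<alpha> \<mu> < c}"
        using ks_entropy_le_test_integral[OF \<mu>'(1) T(1,2)] by (simp add: order_le_less_trans)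
    qed
    ultimately show ?thesis by blast
  qed
  then show "openin ?X {\<mu> \<in> invariant_measures \<alpha>. ks_entropy \<alpha> \<mu> < c}"
    by (subst openin_subopen) blast
qed

end

theorem theorem34:
  fixes \<alpha> :: "'a::metric_space \<Rightarrow> 'a"
  assumes "compact (UNIV :: 'a set)" and "continuous_on UNIV \<alpha>"
  shows
    "(open_on_ess \<alpha> \<and>
      non_contracting_on (essential_points \<alpha>) \<alpha> \<and>
      finite_sheeted_on (essential_points \<alpha>) \<alpha> \<and>
      ks_entropy \<alpha> \<in> invariant_measures \<alpha> \<rightarrow> {0..<\<infinity>} \<and>
      upper_semicontinuous_map (weak_star_topology (invariant_measures \<alpha>)) (ks_entropy \<alpha>) \<longrightarrow>
      (\<forall>A. transfer_operator \<alpha> A \<and> ess_compatible \<alpha> A \<longrightarrow>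
        (\<forall>\<mu>\<in>invariant_measures \<alpha>.
           t_entropy A \<mu> =
             set_ereal_integral \<mu> (essential_points \<alpha>) (\<lambda>y. eln (cocycle \<alpha> A y)) + ks_entropy \<alpha> \<mu>))) \<and>
     (open_on_ess \<alpha> \<and> expanding_on (essential_points \<alpha>) \<alpha> \<longrightarrow>
      non_contracting_on (essential_points \<alpha>) \<alpha> \<and>
      finite_sheeted_on (essential_points \<alpha>) \<alpha> \<and>
      ks_entropy \<alpha> \<in> invariant_measures \<alpha> \<rightarrow> {0..<\<infinity>} \<and>
      upper_semicontinuous_map (weak_star_topology (invariant_measures \<alpha>)) (ks_entropy \<alpha>))"
proof (intro conjI impI allI ballI; (elim conjE)?)
  fix A \<mu>
  assume "non_contracting_on (essential_points \<alpha>) \<alpha>" "transfer_operator \<alpha> A" "\<mu> \<in> invariant_measures \<alpha>"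
    and "ks_entropy \<alpha> \<in> invariant_measures \<alpha> \<rightarrow> {0..<\<infinity>}"
  then show "t_entropy A \<mu> =
      set_ereal_integral \<mu> (essential_points \<alpha>) (\<lambda>y. eln (cocycle \<alpha> A y)) + ks_entropy \<alpha> \<mu>"
    using assms by (intro t_entropy_eq) auto
next
  assume op: "open_on_ess \<alpha>" and "expanding_on (essential_points \<alpha>) \<alpha>"
  then obtain r \<Lambda> where r: "0 < r" "1 < \<Lambda>"
    "\<And>x y. x \<in> essential_points \<alpha> \<Longrightarrow> y \<in> essential_points \<alpha> \<Longrightarrow> dist x y \<le> r \<Longrightarrow> \<Lambda> * dist x y \<le> dist (\<alpha> x) (\<alpha> y)"
    unfolding expanding_on_def by blast
  have nc: "dist x y \<le> dist (\<alpha> x) (\<alpha> y)"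
    if "x \<in> essential_points \<alpha>" "y \<in> essential_points \<alpha>" "dist x y \<le> r" for x y
  proof -
    have "1 * dist x y \<le> \<Lambda> * dist x y" using r(2) by (intro mult_right_mono) auto
    then show ?thesis using r(3)[OF that] by simp
  qed
  show "non_contracting_on (essential_points \<alpha>) \<alpha>"
    unfolding non_contracting_on_def using r(1) nc by blast
  from fibre_card_le[OF assms(1) r(1) nc] obtain N
    where "\<forall>x. finite (\<alpha> -` {x} \<inter> essential_points \<alpha>) \<and> card (\<alpha> -` {x} \<inter> essential_points \<alpha>) \<le> N" ..
  then show "finite_sheeted_on (essential_points \<alpha>) \<alpha>"
    unfolding finite_sheeted_on_def by (intro exI[of _ N]) simp
  show "ks_entropy \<alpha> \<in> invariant_measures \<alpha> \<rightarrow> {0..<\<infinity>}"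
    by (rule ks_entropy_range[OF assms op r(1) nc])
  show "upper_semicontinuous_map (weak_star_topology (invariant_measures \<alpha>)) (ks_entropy \<alpha>)"
    by (rule ks_entropy_usc[OF assms op r(1) nc])
qed

end
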